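(* In the standing setting described in the context, define $\psi\in L^2(\mathbb{R}^d)$ by $$\psi=\sum_{\vec n\in\mathbb{Z}^d}(-1)^{\vec q_A\circ\vec n}\,\overline{h_{\vec\ell_A-\vec n}}\,D_AT_{\vec n}\varphi,$$ i.e. $\psi(\vec t)=\sqrt2\sum_{\vec n\in\mathbb{Z}^d}(-1)^{\vec q_A\circ\vec n}\overline{h_{\vec\ell_A-\vec n}}\,\varphi(A\vec t-\vec n)$. Then $\{D_A^nT_{\vec\ell}\psi: n\in\mathbb{Z},\vec\ell\in\mathbb{Z}^d\}$ is a Parseval's frame (normalized tight frame) for $L^2(\mathbb{R}^d)$, i.e. $\sum_{n\in\mathbb{Z}}\sum_{\vec\ell\in\mathbb{Z}^d}|\langle f,D_A^nT_{\vec\ell}\psi\rangle|^2=\|f\|^2$ for all $f\in L^2(\mathbb{R}^d)$.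
   Context: Notation: $\vec x\circ\vec y=\sum_j x_j\overline{y_j}$ for $\vec x,\vec y\in\mathbb{C}^d$; $A^\tau$ is the transpose; a matrix is expansive if all its eigenvalues have modulus $>1$. $(T_{\vec\ell}f)(\vec t)=f(\vec t-\vec\ell)$ and $(D_Af)(\vec t)=\sqrt2 f(A\vec t)$ on $L^2(\mathbb{R}^d)$, with $\langle f,g\rangle=\int f\overline g$. Fourier transform: $\hat f(\vec s)=(\mathcal F f)(\vec s)=(2\pi)^{-d/2}\int_{\mathbb{R}^d}e^{-i\vec s\circ\vec t}f(\vec t)\,d\vec t$ on $L^1\cap L^2$, extended to a unitary on $L^2(\mathbb{R}^d)$. Standing setting: $A$ is a $d\times d$ expansive integral matrix with $|\det A|=2$ such that $A\mathbb{Z}^d=A^\tau\mathbb{Z}^d$, and $\vec\ell_A,\vec q_A\in\mathbb{Z}^d$ satisfy: $\mathbb{Z}^d=(\vec\ell_A+A\mathbb{Z}^d)\dot\cup A\mathbb{Z}^d$; $\vec q_A\circ A\mathbb{Z}^d\subseteq2\mathbb{Z}$ and $\vec q_A\circ(\vec\ell_A+A\mathbb{Z}^d)\subseteq2\mathbb{Z}+1$; for $\vec m\in A\mathbb{Z}^d$ and $\vec n\in\mathbb{Z}^d$, $\mathbb{Z}^d=(\vec n-A\mathbb{Z}^d)\dot\cup(\vec\ell_A-\vec m-\vec n+A\mathbb{Z}^d)$; for $\vec m\in\vec\ell_A+A\mathbb{Z}^d$ and $\vec n\in\mathbb{Z}^d$, $\vec n-A\mathbb{Z}^d=\vec\ell_A-\vec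 m-\vec n+A\mathbb{Z}^d$. The complex numbers $\{h_{\vec n}\}_{\vec n\in\mathbb{Z}^d}$ satisfy $\sum_{\vec n}h_{\vec n}\overline{h_{\vec n+\vec k}}=\delta_{\vec0,\vec k}$ for all $\vec k\in A\mathbb{Z}^d$ and $\sum_{\vec n}h_{\vec n}=\sqrt2$, and $h_{\vec n}=0$ for $\vec n\notin\Lambda_0=\mathbb{Z}^d\cap[-N_0,N_0]^d$ for some $N_0\in\mathbb{N}$. Let $m_0(\vec t)=\frac1{\sqrt2}\sum_{\vec n\in\Lambda_0}h_{\vec n}e^{-i\vec n\circ\vec t}$ ($\vec t\in\mathbb{C}^d$), $g(\vec\xi)=(2\pi)^{-d/2}\prod_{j=1}^\infty m_0((A^\tau)^{-j}\vec\xi)$ for $\vec\xi\in\mathbb{R}^d$, and $\varphi=\mathcal F^{-1}g$ (which lies in $L^2(\mathbb{R}^d)$). *)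

theory Defs
  imports "HOL-Analysis.Analysis"
begin

definition dotz :: "int^'d \<Rightarrow> int^'d \<Rightarrow> int" where
  "dotz x y = (\<Sum>j\<in>UNIV. x$j * y$j)"

definition rvec :: "int^'d \<Rightarrow> real^'d" where
  "rvec n = (\<chi> j. real_of_int (n$j))"

definition rmat :: "int^'d^'d \<Rightarrow> real^'d^'d" where
  "rmat A = (\<chi> i j. real_of_int (A$i$j))"

definition cmat :: "int^'d^'d \<Rightarrow> complex^'d^'d" where
  "cmat A = (\<chi> i j. complex_of_int (A$i$j))"

definition latt :: "int^'d^'d \<Rightarrow> (int^'d) set" where
  "latt A = range (\<lambda>k. A *v k)"

definition expansive :: "int^'d^'d \<Rightarrow> bool" where
  "expansive A \<longleftrightarrow> (\<forall>c::complex. (\<exists>v::complex^'d. v \<noteq> 0 \<and> cmat A *v v = c *s v) \<longrightarrow> cmod c > 1)"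

definition sq_int :: "(real^'d \<Rightarrow> complex) \<Rightarrow> bool" where
  "sq_int f \<longleftrightarrow> f \<in> borel_measurable lborel \<and> integrable lborel (\<lambda>t. (cmod (f t))^2)"

definition L2_norm :: "(real^'d \<Rightarrow> complex) \<Rightarrow> real" where
  "L2_norm f = sqrt (LINT t|lborel. (cmod (f t))^2)"

definition L2_inner :: "(real^'d \<Rightarrow> complex) \<Rightarrow> (real^'d \<Rightarrow> complex) \<Rightarrow> complex" where
  "L2_inner f g = (LINT t|lborel. f t * cnj (g t))"

definition fourier1 :: "(real^'d \<Rightarrow> complex) \<Rightarrow> real^'d \<Rightarrow> complex" where
  "fourier1 f s = complex_of_real ((2*pi) powr (- real CARD('d) / 2)) *
      (LINT t|lborel. cis (- (s \<bullet> t)) * f t)"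

text \<open>Unitary extension of the Fourier transform to L^2 (by density of L^1 \<inter> L^2):
  F is the Fourier transform of f \<in> L^2.\<close>
definition fourier_L2 :: "(real^'d \<Rightarrow> complex) \<Rightarrow> (real^'d \<Rightarrow> complex) \<Rightarrow> bool" where
  "fourier_L2 f F \<longleftrightarrow> sq_int f \<and> sq_int F \<and>
     (\<exists>u :: nat \<Rightarrow> real^'d \<Rightarrow> complex.
        (\<forall>k. integrable lborel (u k) \<and> sq_int (u k)) \<and>
        (\<lambda>k. L2_norm (\<lambda>t. u k t - f t)) \<longlonglongrightarrow> 0 \<and>
        (\<lambda>k. L2_norm (\<lambda>t. fourier1 (u k) t - F t)) \<longlonglongrightarrow> 0)"

definition transl :: "int^'d \<Rightarrow> (real^'d \<Rightarrow> complex) \<Rightarrow> real^'d \<Rightarrow> complex" where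
  "transl l f t = f (t - rvec l)"

definition dil :: "int^'d^'d \<Rightarrow> (real^'d \<Rightarrow> complex) \<Rightarrow> real^'d \<Rightarrow> complex" where
  "dil A f t = complex_of_real (sqrt 2) * f (rmat A *v t)"

definition dil_inv :: "int^'d^'d \<Rightarrow> (real^'d \<Rightarrow> complex) \<Rightarrow> real^'d \<Rightarrow> complex" where
  "dil_inv A f t = f (matrix_inv (rmat A) *v t) / complex_of_real (sqrt 2)"

definition dil_pow :: "int^'d^'d \<Rightarrow> int \<Rightarrow> (real^'d \<Rightarrow> complex) \<Rightarrow> real^'d \<Rightarrow> complex" where
  "dil_pow A n = (if 0 \<le> n then dil A ^^ nat n else dil_inv A ^^ nat (- n))"

definition mask0 :: "(int^'d \<Rightarrow> complex) \<Rightarrow> nat \<Rightarrow> real^'d \<Rightarrow> complex" where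
  "mask0 h N0 t = (1 / complex_of_real (sqrt 2)) *
     (\<Sum>n\<in>{n::int^'d. \<forall>j. \<bar>n$j\<bar> \<le> int N0}. h n * cis (- (rvec n \<bullet> t)))"

definition gfun :: "int^'d^'d \<Rightarrow> (int^'d \<Rightarrow> complex) \<Rightarrow> nat \<Rightarrow> real^'d \<Rightarrow> complex" where
  "gfun A h N0 \<xi> = complex_of_real ((2*pi) powr (- real CARD('d) / 2)) *
     prodinf (\<lambda>j. mask0 h N0 (((\<lambda>x. matrix_inv (transpose (rmat A)) *v x) ^^ Suc j) \<xi>))"

end

theory Submission
  imports Defs "HOL-Probability.Probability" "HOL-Computational_Algebra.Fundamental_Theorem_Algebra"
begin

text \<open>
  Let \<open>V f = (\<Sum>n. h n * D T\<^sub>n f)\<close> and let \<open>\<phi>\<^sub>n = V\<^sup>n \<chi>\<close> with \<open>\<chi>\<close> the indicator function of the unit cube.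
  The integer translates of every \<open>\<phi>\<^sub>n\<close> are orthonormal, all \<open>\<phi>\<^sub>n\<close> live on one fixed ball and have
  integral 1, and their Fourier transforms converge boundedly and pointwise to the infinite product
  \<open>g\<close>. Testing against Fourier transforms of integrable functions, which are dense in \<open>L\<^sup>2\<close>, shows that
  \<open>\<phi>\<^sub>n\<close> converges weakly to \<open>\<phi>\<close>. Hence \<open>E f = (\<Sum>l. |\<langle>f, T\<^sub>l \<phi>\<rangle>|\<^sup>2) \<le> \<parallel>f\<parallel>\<^sup>2\<close>, and \<open>\<phi>\<close> satisfies the refinement
  equation weakly. The conditions on \<open>h\<close> and \<open>q\<^sub>A\<close> say that the two-channel filter bank is unitary, so
  \<open>(\<Sum>l. |\<langle>f, T\<^sub>l \<psi>\<rangle>|\<^sup>2) = E (D\<^sup>-\<^sup>1 f) - E f\<close>. Summing over dilations telescopes. In the limit of large \<open>J\<close>,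
  \<open>D\<^sup>J f\<close> concentrates at the origin, so that \<open>E (D\<^sup>J f)\<close> tends to 0, while the step function with values
  \<open>\<langle>D\<^sup>-\<^sup>J f, T\<^sub>l \<phi>\<rangle>\<close> on the unit cube at \<open>l\<close> differs from \<open>D\<^sup>-\<^sup>J f\<close> by an average of the \<open>L\<^sup>2\<close> moduli of
  continuity of \<open>f\<close> at the points \<open>A\<^sup>-\<^sup>J u\<close> with \<open>u\<close> in a ball, so that \<open>E (D\<^sup>-\<^sup>J f)\<close> tends to \<open>\<parallel>f\<parallel>\<^sup>2\<close>.
\<close>

subsection \<open>Square-integrable functions\<close>

lemma sq_int_measurable [measurable_dest]: "sq_int f \<Longrightarrow> f \<in> borel_measurable borel"
  by (simp add: sq_int_def)

lemma sq_int_integrable_norm2: "sq_int f \<Longrightarrow> integrable lborel (\<lambda>t. (cmod (f t))\<^sup>2)"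
  by (simp add: sq_int_def)

lemma borel_measurable_cnj [measurable (raw)]:
  "f \<in> borel_measurable M \<Longrightarrow> (\<lambda>x. cnj (f x)) \<in> borel_measurable M"
  by (rule borel_measurable_continuous_on[where f = cnj]) (auto intro: continuous_intros)

lemma borel_measurable_cis [measurable (raw)]:
  "f \<in> borel_measurable M \<Longrightarrow> (\<lambda>x. cis (f x)) \<in> borel_measurable M"
  by (rule borel_measurable_continuous_on[where f = cis]) (auto intro: continuous_intros)

lemma power2_norm_add_le: "(norm (x + y))\<^sup>2 \<le> 2 * (norm x)\<^sup>2 + 2 * (norm y)\<^sup>2"
  for x y :: "'a::real_normed_vector"
proof -
  have "(norm (x + y))\<^sup>2 \<le> (norm x + norm y)\<^sup>2"
    by (intro power_mono norm_triangle_ineq) auto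
  also have "\<dots> \<le> 2 * (norm x)\<^sup>2 + 2 * (norm y)\<^sup>2"
    using sum_squares_bound[of "norm x" "norm y"] by (simp add: power2_sum)
  finally show ?thesis .
qed

lemma norm_mult_le_sum_squares: "norm x * norm y \<le> (norm x)\<^sup>2 + (norm y)\<^sup>2"
  using sum_squares_bound[of "norm x" "norm y"] mult_nonneg_nonneg[OF norm_ge_zero norm_ge_zero, of x y]
  by linarith

lemma sq_int_bound:
  assumes "integrable lborel g" "f \<in> borel_measurable borel" "\<And>t. (cmod (f t))\<^sup>2 \<le> g t"
  shows "sq_int f"
  unfolding sq_int_def
proof (intro conjI)
  note assms(2)[measurable]
  show "f \<in> borel_measurable lborel" by simp
  show "integrable lborel (\<lambda>t. (cmod (f t))\<^sup>2)"
    by (rule Bochner_Integration.integrable_bound[OF assms(1)])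
       (use assms(3) in \<open>auto intro!: AE_I2 order_trans[OF _ abs_ge_self]\<close>)
qed

lemma sq_int_zero [simp]: "sq_int (\<lambda>t. 0)"
  by (simp add: sq_int_def)

lemma sq_int_add:
  assumes f [measurable]: "sq_int f" and g [measurable]: "sq_int g"
  shows "sq_int (\<lambda>t. f t + g t)"
proof (rule sq_int_bound)
  show "integrable lborel (\<lambda>t. 2 * (cmod (f t))\<^sup>2 + 2 * (cmod (g t))\<^sup>2)"
    using assms by (simp add: sq_int_def)
qed (measurable, rule power2_norm_add_le)

lemma sq_int_cmult: "sq_int f \<Longrightarrow> sq_int (\<lambda>t. c * f t)"
  by (auto simp: sq_int_def norm_mult power_mult_distrib)

lemma sq_int_diff: "sq_int f \<Longrightarrow> sq_int g \<Longrightarrow> sq_int (\<lambda>t. f t - g t)"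
  using sq_int_add[of f "\<lambda>t. -1 * g t"] sq_int_cmult[of g "-1"] by simp

lemma sq_int_sum:
  assumes "\<And>i. i \<in> I \<Longrightarrow> sq_int (f i)"
  shows "sq_int (\<lambda>t. \<Sum>i\<in>I. f i t)"
  using assms by (induction I rule: infinite_finite_induct) (auto intro: sq_int_add)

lemma sq_int_cnj: "sq_int f \<Longrightarrow> sq_int (\<lambda>t. cnj (f t))"
  by (auto simp: sq_int_def)

lemma sq_int_mult_indicator:
  assumes [measurable]: "sq_int f" "S \<in> sets borel"
  shows "sq_int (\<lambda>t. f t * indicator S t)"
  by (rule sq_int_bound[OF sq_int_integrable_norm2[OF assms(1)]]) (auto simp: indicator_def)

lemma nn_integral_norm_sq:
  assumes "sq_int f"
  shows "(\<integral>\<^sup>+t. ennreal ((cmod (f t))\<^sup>2) \<partial>lborel) = ennreal ((L2_norm f)\<^sup>2)"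
  using nn_integral_eq_integral[OF sq_int_integrable_norm2[OF assms]] by (simp add: L2_norm_def)

lemma nn_integral_norm_sq_le_imp:
  assumes [measurable]: "f \<in> borel_measurable borel"
    and bound: "(\<integral>\<^sup>+t. ennreal ((cmod (f t))\<^sup>2) \<partial>lborel) \<le> ennreal c" and "0 \<le> c"
  shows "sq_int f" "(L2_norm f)\<^sup>2 \<le> c"
proof -
  have "integrable lborel (\<lambda>t. (cmod (f t))\<^sup>2)"
    using bound by (intro integrableI_bounded) (auto simp: le_less_trans)
  then show "sq_int f" by (simp add: sq_int_def)
  then show "(L2_norm f)\<^sup>2 \<le> c"
    using bound \<open>0 \<le> c\<close> by (simp add: nn_integral_norm_sq)
qed

lemma L2_norm_nonneg [simp]: "0 \<le> L2_norm f"
  by (simp add: L2_norm_def)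

lemma L2_norm_sq: "(L2_norm f)\<^sup>2 = (LINT t|lborel. (cmod (f t))\<^sup>2)"
  by (simp add: L2_norm_def)

lemma L2_norm_cnj: "L2_norm (\<lambda>t. cnj (f t)) = L2_norm f"
  by (simp add: L2_norm_def)

lemma L2_norm_minus_commute: "L2_norm (\<lambda>t. f t - g t) = L2_norm (\<lambda>t. g t - f t)"
  by (simp add: L2_norm_def norm_minus_commute)

lemma L2_norm_tendsto_0_dominated:
  fixes u :: "nat \<Rightarrow> real^'d \<Rightarrow> complex"
  assumes "integrable lborel w" and [measurable]: "\<And>n. u n \<in> borel_measurable borel"
    and "AE x in lborel. (\<lambda>n. u n x) \<longlonglongrightarrow> 0" and "\<And>n x. (cmod (u n x))\<^sup>2 \<le> w x"
  shows "(\<lambda>n. L2_norm (u n)) \<longlonglongrightarrow> 0"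
proof -
  have "(\<lambda>n. LINT x|lborel. (cmod (u n x))\<^sup>2) \<longlonglongrightarrow> (LINT x|(lborel :: (real^'d) measure). (0::real))"
  proof (rule integral_dominated_convergence[OF _ _ assms(1)])
    show "AE x in lborel. (\<lambda>n. (cmod (u n x))\<^sup>2) \<longlonglongrightarrow> 0"
      using assms(3) by eventually_elim (auto intro: tendsto_eq_intros)
  qed (use assms(4) in auto)
  then have "(\<lambda>n. sqrt (LINT x|lborel. (cmod (u n x))\<^sup>2)) \<longlonglongrightarrow> sqrt 0"
    by (intro tendsto_real_sqrt) simp
  then show ?thesis by (simp add: L2_norm_def)
qed

lemma integrable_L2_inner:
  assumes f [measurable]: "sq_int f" and g [measurable]: "sq_int g"
  shows "integrable lborel (\<lambda>t. f t * cnj (g t))"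
proof (rule Bochner_Integration.integrable_bound)
  show "integrable lborel (\<lambda>t. (cmod (f t))\<^sup>2 + (cmod (g t))\<^sup>2)"
    using assms by (simp add: sq_int_def)
  show "AE t in lborel. norm (f t * cnj (g t)) \<le> norm ((cmod (f t))\<^sup>2 + (cmod (g t))\<^sup>2)"
    using norm_mult_le_sum_squares by (auto simp: norm_mult)
qed measurable

lemma L2_inner_self: "L2_inner f f = complex_of_real ((L2_norm f)\<^sup>2)"
  unfolding L2_inner_def L2_norm_sq complex_norm_square[symmetric] integral_complex_of_real[symmetric]
  by simp

lemma L2_inner_commute: "L2_inner g f = cnj (L2_inner f g)"
  unfolding L2_inner_def Bochner_Integration.integral_cnj[symmetric] by (simp add: mult.commute)

lemma L2_inner_diff_left:
  assumes "sq_int f" "sq_int g" "sq_int e"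
  shows "L2_inner (\<lambda>t. f t - g t) e = L2_inner f e - L2_inner g e"
  unfolding L2_inner_def using assms
  by (subst Bochner_Integration.integral_diff[symmetric])
     (auto simp: algebra_simps intro: integrable_L2_inner)

lemma L2_inner_diff_right:
  assumes "sq_int f" "sq_int g" "sq_int e"
  shows "L2_inner e (\<lambda>t. f t - g t) = L2_inner e f - L2_inner e g"
  by (subst (1 2 3) L2_inner_commute) (simp add: L2_inner_diff_left assms)

lemma L2_inner_cmult_left: "L2_inner (\<lambda>t. c * f t) e = c * L2_inner f e"
  unfolding L2_inner_def by (simp add: mult.assoc)

lemma L2_inner_cmult_right: "L2_inner f (\<lambda>t. c * e t) = cnj c * L2_inner f e"
  by (subst (1 2) L2_inner_commute) (simp add: L2_inner_cmult_left)

lemma L2_inner_sum_left: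
  assumes "\<And>i. i \<in> I \<Longrightarrow> sq_int (f i)" "sq_int e"
  shows "L2_inner (\<lambda>t. \<Sum>i\<in>I. f i t) e = (\<Sum>i\<in>I. L2_inner (f i) e)"
  unfolding L2_inner_def sum_distrib_right
  by (rule Bochner_Integration.integral_sum) (use assms in \<open>auto intro: integrable_L2_inner\<close>)

lemma L2_inner_sum_right:
  assumes "\<And>i. i \<in> I \<Longrightarrow> sq_int (f i)" "sq_int e"
  shows "L2_inner e (\<lambda>t. \<Sum>i\<in>I. f i t) = (\<Sum>i\<in>I. L2_inner e (f i))"
proof -
  have "L2_inner e (\<lambda>t. \<Sum>i\<in>I. f i t) = cnj (\<Sum>i\<in>I. L2_inner (f i) e)"
    by (subst L2_inner_commute) (simp add: L2_inner_sum_left assms)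
  also have "\<dots> = (\<Sum>i\<in>I. L2_inner e (f i))"
    unfolding cnj_sum by (intro sum.cong refl L2_inner_commute[symmetric])
  finally show ?thesis .
qed

lemma L2_Cauchy_Schwarz_norm:
  assumes f [measurable]: "sq_int f" and g [measurable]: "sq_int g"
  shows "(LINT t|lborel. cmod (f t) * cmod (g t)) \<le> L2_norm f * L2_norm g"
proof (rule power2_le_imp_le)
  let ?I = "LINT t|lborel. cmod (f t) * cmod (g t)"
  have "integrable lborel (\<lambda>t. cmod (f t) * cmod (g t))"
    using integrable_norm[OF integrable_L2_inner[OF assms]] by (simp add: norm_mult)
  then have "ennreal ?I = (\<integral>\<^sup>+t. ennreal (cmod (f t)) * ennreal (cmod (g t)) \<partial>lborel)"
    by (subst nn_integral_eq_integral[symmetric]) (auto simp: ennreal_mult)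
  then have "(ennreal ?I)\<^sup>2
      \<le> (\<integral>\<^sup>+t. (ennreal (cmod (f t)))\<^sup>2 \<partial>lborel) * (\<integral>\<^sup>+t. (ennreal (cmod (g t)))\<^sup>2 \<partial>lborel)"
    by (simp only:) (rule Cauchy_Schwarz_nn_integral; measurable)
  then have "(ennreal ?I)\<^sup>2 \<le> ennreal ((L2_norm f)\<^sup>2) * ennreal ((L2_norm g)\<^sup>2)"
    by (simp add: ennreal_power nn_integral_norm_sq assms)
  moreover have "0 \<le> ?I" by (intro integral_nonneg_AE) auto
  ultimately show "?I\<^sup>2 \<le> (L2_norm f * L2_norm g)\<^sup>2"
    by (simp add: ennreal_power ennreal_mult[symmetric] power_mult_distrib)
qed simp

lemma L2_Cauchy_Schwarz:
  assumes "sq_int f" "sq_int g"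
  shows "cmod (L2_inner f g) \<le> L2_norm f * L2_norm g"
proof -
  have "cmod (L2_inner f g) \<le> (LINT t|lborel. cmod (f t * cnj (g t)))"
    unfolding L2_inner_def by (rule integral_norm_bound)
  also have "\<dots> \<le> L2_norm f * L2_norm g"
    using L2_Cauchy_Schwarz_norm[OF assms] by (simp add: norm_mult)
  finally show ?thesis .
qed

lemma L2_norm_triangle:
  assumes f: "sq_int f" and g: "sq_int g"
  shows "L2_norm (\<lambda>t. f t + g t) \<le> L2_norm f + L2_norm g"
proof (rule power2_le_imp_le)
  note squares = sq_int_integrable_norm2[OF f] sq_int_integrable_norm2[OF g]
  have product: "integrable lborel (\<lambda>t. cmod (f t) * cmod (g t))"
    using integrable_norm[OF integrable_L2_inner[OF assms]] by (simp add: norm_mult)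
  have "(L2_norm (\<lambda>t. f t + g t))\<^sup>2
      \<le> (LINT t|lborel. (cmod (f t))\<^sup>2 + (cmod (g t))\<^sup>2 + 2 * (cmod (f t) * cmod (g t)))"
    unfolding L2_norm_sq
  proof (rule integral_mono)
    show "integrable lborel (\<lambda>t. (cmod (f t))\<^sup>2 + (cmod (g t))\<^sup>2 + 2 * (cmod (f t) * cmod (g t)))"
      using squares product by auto
    fix t
    have "(cmod (f t + g t))\<^sup>2 \<le> (cmod (f t) + cmod (g t))\<^sup>2"
      by (intro power_mono norm_triangle_ineq) auto
    then show "(cmod (f t + g t))\<^sup>2 \<le> (cmod (f t))\<^sup>2 + (cmod (g t))\<^sup>2 + 2 * (cmod (f t) * cmod (g t))"
      by (simp add: power2_sum algebra_simps)
  qed (rule sq_int_integrable_norm2[OF sq_int_add[OF assms]])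
  also have "\<dots> = (L2_norm f)\<^sup>2 + (L2_norm g)\<^sup>2 + 2 * (LINT t|lborel. cmod (f t) * cmod (g t))"
    unfolding L2_norm_sq using squares product by simp
  also have "\<dots> \<le> (L2_norm f + L2_norm g)\<^sup>2"
    using L2_Cauchy_Schwarz_norm[OF assms] by (simp add: power2_sum)
  finally show "(L2_norm (\<lambda>t. f t + g t))\<^sup>2 \<le> (L2_norm f + L2_norm g)\<^sup>2" .
qed simp

lemma L2_norm_triangle_diff:
  assumes "sq_int f" "sq_int g"
  shows "L2_norm (\<lambda>t. f t - g t) \<le> L2_norm f + L2_norm g"
  using L2_norm_triangle[OF assms(1) sq_int_cmult[OF assms(2), of "-1"]] by (simp add: L2_norm_def)

lemma L2_norm_triangle_via:
  assumes "sq_int f" "sq_int g" "sq_int e"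
  shows "L2_norm (\<lambda>t. f t - e t) \<le> L2_norm (\<lambda>t. f t - g t) + L2_norm (\<lambda>t. g t - e t)"
  using L2_norm_triangle[OF sq_int_diff[OF assms(1,2)] sq_int_diff[OF assms(2,3)]] by simp

lemma L2_norm_le_add_diff:
  assumes "sq_int f" "sq_int g"
  shows "L2_norm f \<le> L2_norm g + L2_norm (\<lambda>t. f t - g t)"
  using L2_norm_triangle[OF assms(2) sq_int_diff[OF assms]] by simp

lemma L2_inner_tendsto_left:
  assumes "sq_int g" "\<And>k. sq_int (u k)" "sq_int f" "(\<lambda>k. L2_norm (\<lambda>t. u k t - f t)) \<longlonglongrightarrow> 0"
  shows "(\<lambda>k. L2_inner (u k) g) \<longlonglongrightarrow> L2_inner f g"
proof (rule LIM_zero_cancel, rule Lim_null_comparison)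
  show "(\<lambda>k. L2_norm (\<lambda>t. u k t - f t) * L2_norm g) \<longlonglongrightarrow> 0"
    using tendsto_mult_left_zero[OF assms(4)] by simp
  have "cmod (L2_inner (u k) g - L2_inner f g) \<le> L2_norm (\<lambda>t. u k t - f t) * L2_norm g" for k
    using L2_Cauchy_Schwarz[OF sq_int_diff[OF assms(2,3)] assms(1)]
    by (simp add: L2_inner_diff_left assms)
  then show "\<forall>\<^sub>F k in sequentially. norm (L2_inner (u k) g - L2_inner f g)
      \<le> L2_norm (\<lambda>t. u k t - f t) * L2_norm g"
    by simp
qed

lemma L2_weakly_null_dense:
  assumes w: "\<And>n. sq_int (w n)" and bound: "\<And>n. L2_norm (w n) \<le> B" and f: "sq_int f"
    and dense: "\<And>\<epsilon>. 0 < \<epsilon> \<Longrightarrow> \<exists>e. sq_int e \<and> L2_norm (\<lambda>t. f t - e t) < \<epsilon> \<and>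
      (\<lambda>n. L2_inner e (w n)) \<longlonglongrightarrow> 0"
  shows "(\<lambda>n. L2_inner f (w n)) \<longlonglongrightarrow> 0"
proof (rule LIMSEQ_I)
  have "0 \<le> B" using bound[of 0] L2_norm_nonneg order_trans by blast
  fix \<epsilon> :: real assume "0 < \<epsilon>"
  with \<open>0 \<le> B\<close> obtain e where e: "sq_int e" and dist: "L2_norm (\<lambda>t. f t - e t) < \<epsilon> / (2 * (B + 1))"
    and lim: "(\<lambda>n. L2_inner e (w n)) \<longlonglongrightarrow> 0"
    using dense[of "\<epsilon> / (2 * (B + 1))"] by auto
  have dist_le: "norm (L2_inner (\<lambda>t. f t - e t) (w n)) \<le> \<epsilon> / 2" for n
  proof -
    have "norm (L2_inner (\<lambda>t. f t - e t) (w n)) \<le> L2_norm (\<lambda>t. f t - e t) * L2_norm (w n)"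
      by (intro L2_Cauchy_Schwarz sq_int_diff f e w)
    also have "\<dots> \<le> \<epsilon> / (2 * (B + 1)) * (B + 1)"
      using bound[of n] dist \<open>0 \<le> B\<close> \<open>0 < \<epsilon>\<close> by (intro mult_mono) auto
    also have "\<dots> = \<epsilon> / 2" using \<open>0 \<le> B\<close> by (simp add: field_simps)
    finally show ?thesis .
  qed
  obtain n0 where n0: "\<And>n. n0 \<le> n \<Longrightarrow> norm (L2_inner e (w n)) < \<epsilon> / 2"
    using LIMSEQ_D[OF lim, of "\<epsilon> / 2"] \<open>0 < \<epsilon>\<close> by auto
  have "norm (L2_inner f (w n) - 0) < \<epsilon>" if "n0 \<le> n" for n
  proof -
    have "L2_inner f (w n) = L2_inner (\<lambda>t. f t - e t) (w n) + L2_inner e (w n)"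
      by (simp add: L2_inner_diff_left f e w)
    then have "norm (L2_inner f (w n)) \<le> norm (L2_inner (\<lambda>t. f t - e t) (w n)) + norm (L2_inner e (w n))"
      by (simp add: norm_triangle_ineq)
    then show ?thesis using dist_le[of n] n0[OF that] by simp
  qed
  then show "\<exists>n0. \<forall>n\<ge>n0. norm (L2_inner f (w n) - 0) < \<epsilon>" by blast
qed

lemma L2_weak_limit_dense:
  assumes v: "\<And>n. sq_int (v n)" and bound: "\<And>n. L2_norm (v n) \<le> B" and \<phi>: "sq_int \<phi>" and f: "sq_int f"
    and dense: "\<And>\<epsilon>. 0 < \<epsilon> \<Longrightarrow> \<exists>e. sq_int e \<and> L2_norm (\<lambda>t. f t - e t) < \<epsilon> \<and>
      (\<lambda>n. L2_inner (v n) e) \<longlonglongrightarrow> L2_inner \<phi> e"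
  shows "(\<lambda>n. L2_inner f (v n)) \<longlonglongrightarrow> L2_inner f \<phi>"
proof -
  have "(\<lambda>n. L2_inner f (\<lambda>t. v n t - \<phi> t)) \<longlonglongrightarrow> 0"
  proof (rule L2_weakly_null_dense[OF sq_int_diff[OF v \<phi>] _ f])
    show "L2_norm (\<lambda>t. v n t - \<phi> t) \<le> B + L2_norm \<phi>" for n
      using L2_norm_triangle_diff[OF v \<phi>, of n] bound[of n] by linarith
    fix \<epsilon> :: real assume "0 < \<epsilon>"
    then obtain e where e: "sq_int e" "L2_norm (\<lambda>t. f t - e t) < \<epsilon>"
      and lim: "(\<lambda>n. L2_inner (v n) e) \<longlonglongrightarrow> L2_inner \<phi> e"
      using dense by blast
    have "(\<lambda>n. L2_inner e (v n)) \<longlonglongrightarrow> L2_inner e \<phi>"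
      by (subst (1 2) L2_inner_commute) (rule tendsto_cnj[OF lim])
    then have "(\<lambda>n. L2_inner e (\<lambda>t. v n t - \<phi> t)) \<longlonglongrightarrow> 0"
      by (simp add: L2_inner_diff_right v \<phi> e LIM_zero)
    with e show "\<exists>e. sq_int e \<and> L2_norm (\<lambda>t. f t - e t) < \<epsilon> \<and> (\<lambda>n. L2_inner e (\<lambda>t. v n t - \<phi> t)) \<longlonglongrightarrow> 0"
      by blast
  qed
  then show ?thesis
    by (intro LIM_zero_cancel[of _ "L2_inner f \<phi>"]) (simp add: L2_inner_diff_right v \<phi> f)
qed

lemma L2_orthonormal_sum_distance:
  assumes f: "sq_int f" and "finite I" and e: "\<And>i. i \<in> I \<Longrightarrow> sq_int (e i)"
    and orthonormal: "\<And>i j. i \<in> I \<Longrightarrow> j \<in> I \<Longrightarrow> L2_inner (e i) (e j) = (if i = j then 1 else 0)"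
  shows "(L2_norm (\<lambda>t. f t - (\<Sum>i\<in>I. L2_inner f (e i) * e i t)))\<^sup>2
    = (L2_norm f)\<^sup>2 - (\<Sum>i\<in>I. (cmod (L2_inner f (e i)))\<^sup>2)"
proof -
  define c where "c i = L2_inner f (e i)" for i
  define s where "s = (\<lambda>t. \<Sum>i\<in>I. c i * e i t)"
  define S where "S = (\<Sum>i\<in>I. (cmod (c i))\<^sup>2)"
  have s: "sq_int s"
    unfolding s_def by (intro sq_int_sum sq_int_cmult e)
  have inner_s: "L2_inner g s = (\<Sum>i\<in>I. cnj (c i) * L2_inner g (e i))" if "sq_int g" for g
    unfolding s_def by (subst L2_inner_sum_right) (simp_all add: e sq_int_cmult that L2_inner_cmult_right)
  have f_s: "L2_inner f s = complex_of_real S"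
    by (simp add: inner_s f S_def complex_norm_square mult.commute flip: c_def del: of_real_power)
  have e_s: "L2_inner (e i) s = cnj (c i)" if "i \<in> I" for i
  proof -
    have "L2_inner (e i) s = (\<Sum>j\<in>I. if j = i then cnj (c j) else 0)"
      unfolding inner_s[OF e[OF that]] using that by (intro sum.cong) (auto simp: orthonormal)
    then show ?thesis using that \<open>finite I\<close> by simp
  qed
  have "L2_inner s s = (\<Sum>i\<in>I. c i * L2_inner (e i) s)"
    by (subst (1) s_def) (subst L2_inner_sum_left, auto simp: e s sq_int_cmult L2_inner_cmult_left)
  then have s_s: "L2_inner s s = complex_of_real S"
    by (simp add: e_s S_def complex_norm_square del: of_real_power)
  have "complex_of_real ((L2_norm (\<lambda>t. f t - s t))\<^sup>2)
      = L2_inner f f - L2_inner f s - (L2_inner s f - L2_inner s s)"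
    unfolding L2_inner_self[symmetric]
    by (subst L2_inner_diff_left) (auto simp: f s sq_int_diff L2_inner_diff_right)
  also have "\<dots> = complex_of_real ((L2_norm f)\<^sup>2 - S)"
    using L2_inner_commute[of s f] L2_inner_self[of f] by (simp add: f_s s_s)
  finally show ?thesis
    unfolding s_def S_def c_def by (simp only: of_real_eq_iff)
qed

lemma L2_Bessel_finite:
  assumes "sq_int f" "finite I" "\<And>i. i \<in> I \<Longrightarrow> sq_int (e i)"
    and "\<And>i j. i \<in> I \<Longrightarrow> j \<in> I \<Longrightarrow> L2_inner (e i) (e j) = (if i = j then 1 else 0)"
  shows "(\<Sum>i\<in>I. (cmod (L2_inner f (e i)))\<^sup>2) \<le> (L2_norm f)\<^sup>2"
proof -
  have "0 \<le> (L2_norm f)\<^sup>2 - (\<Sum>i\<in>I. (cmod (L2_inner f (e i)))\<^sup>2)"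
    by (subst L2_orthonormal_sum_distance[OF assms, symmetric]) simp_all
  then show ?thesis by simp
qed

subsection \<open>The integer lattice and linear changes of variables\<close>

lemma rvec_add: "rvec (m + n) = rvec m + rvec n"
  by (simp add: rvec_def vec_eq_iff)

lemma rvec_diff: "rvec (m - n) = rvec m - rvec n"
  by (simp add: rvec_def vec_eq_iff)

lemma rvec_uminus: "rvec (- n) = - rvec n"
  by (simp add: rvec_def vec_eq_iff)

lemma rvec_zero [simp]: "rvec 0 = 0"
  by (simp add: rvec_def vec_eq_iff)

lemma rvec_inject [simp]: "rvec m = rvec n \<longleftrightarrow> m = n"
  by (simp add: rvec_def vec_eq_iff)

lemma rvec_matrix: "rvec (A *v k) = rmat A *v rvec k"
  by (simp add: rvec_def rmat_def matrix_vector_mult_def vec_eq_iff)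

lemma finite_box_int: "finite {n::int^'d. \<forall>j. \<bar>n$j\<bar> \<le> int N}"
proof -
  have "{n::int^'d. \<forall>j. \<bar>n$j\<bar> \<le> int N} \<subseteq> vec_lambda ` (PiE UNIV (\<lambda>_. {- int N..int N}))"
  proof
    fix n :: "int^'d" assume "n \<in> {n. \<forall>j. \<bar>n$j\<bar> \<le> int N}"
    then show "n \<in> vec_lambda ` (PiE UNIV (\<lambda>_. {- int N..int N}))"
      by (intro image_eqI[where x="vec_nth n"]) (auto simp: PiE_def abs_le_iff minus_le_iff)
  qed
  then show ?thesis by (rule finite_subset) (intro finite_imageI finite_PiE; simp)
qed

lemma finite_rvec_norm_le: "finite {n::int^'d. norm (rvec n) \<le> r}"
proof (rule finite_subset[OF _ finite_box_int])
  show "{n::int^'d. norm (rvec n) \<le> r} \<subseteq> {n. \<forall>j. \<bar>n$j\<bar> \<le> int (nat \<lceil>r\<rceil>)}"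
  proof (intro subsetI CollectI allI)
    fix n :: "int^'d" and j assume "n \<in> {n. norm (rvec n) \<le> r}"
    then have "real_of_int \<bar>n$j\<bar> \<le> r"
      using component_le_norm_cart[of "rvec n" j] by (simp add: rvec_def)
    then show "\<bar>n$j\<bar> \<le> int (nat \<lceil>r\<rceil>)" by linarith
  qed
qed

definition ucube :: "(real^'d) set" where
  "ucube = {x. \<forall>j. 0 \<le> x$j \<and> x$j < 1}"

definition vfloor :: "real^'d \<Rightarrow> int^'d" where
  "vfloor x = (\<chi> j. \<lfloor>x$j\<rfloor>)"

lemma ucube_measurable [measurable]: "(ucube :: (real^'d) set) \<in> sets borel"
proof -
  have "Measurable.pred borel (\<lambda>x::real^'d. \<forall>j\<in>UNIV. 0 \<le> x$j \<and> x$j < 1)"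
    by measurable
  then show ?thesis by (simp add: pred_def ucube_def)
qed

lemma emeasure_ucube [simp]: "emeasure lborel (ucube :: (real^'d) set) = 1"
proof (rule antisym)
  have unit: "emeasure lborel (cbox 0 (1::real^'d)) = 1" "emeasure lborel (box 0 (1::real^'d)) = 1"
    by (auto simp: emeasure_lborel_cbox_eq emeasure_lborel_box_eq Basis_vec_def inner_axis intro!: prod.neutral)
  have "ucube \<subseteq> cbox 0 (1::real^'d)" "box 0 (1::real^'d) \<subseteq> ucube"
    by (auto simp: ucube_def mem_box_cart less_imp_le)
  then show "emeasure lborel (ucube :: (real^'d) set) \<le> 1" "1 \<le> emeasure lborel (ucube :: (real^'d) set)"
    using emeasure_mono[of ucube "cbox 0 (1::real^'d)" lborel] emeasure_mono[of "box 0 (1::real^'d)" ucube lborel]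
    by (simp_all add: unit)
qed

lemma diff_rvec_in_ucube_iff: "x - rvec n \<in> ucube \<longleftrightarrow> n = vfloor x"
proof -
  have "0 \<le> x$j - of_int (n$j) \<and> x$j - of_int (n$j) < 1 \<longleftrightarrow> n$j = \<lfloor>x$j\<rfloor>" for j
    by linarith
  then show ?thesis
    by (simp add: ucube_def rvec_def vfloor_def vec_eq_iff)
qed

lemma add_rvec_in_ucube_iff: "x + rvec n \<in> ucube \<longleftrightarrow> n = - vfloor x"
  using diff_rvec_in_ucube_iff[of x "- n"] by (simp add: rvec_uminus) (metis minus_minus)

lemma vfloor_add_rvec: "x \<in> ucube \<Longrightarrow> vfloor (x + rvec n) = n"
  by (metis add_diff_cancel_right' diff_rvec_in_ucube_iff)

lemma norm_ucube_le:
  fixes x :: "real^'d"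
  assumes "x \<in> ucube" shows "norm x \<le> real CARD('d)"
proof -
  have "norm x \<le> (\<Sum>i\<in>UNIV. \<bar>x$i\<bar>)" by (rule norm_le_l1_cart)
  also have "\<dots> \<le> (\<Sum>i\<in>(UNIV::'d set). 1)"
    using assms by (intro sum_mono) (auto simp: ucube_def less_imp_le)
  finally show ?thesis by simp
qed

lemma measurable_vfloor [measurable]: "vfloor \<in> borel \<rightarrow>\<^sub>M count_space (UNIV :: (int^'d) set)"
proof (rule measurable_count_space_eq2_countable[THEN iffD2], safe)
  fix n :: "int^'d"
  have "vfloor -` {n} \<inter> space borel = {x. x - rvec n \<in> ucube}"
    by (auto simp: diff_rvec_in_ucube_iff)
  also have "\<dots> \<in> sets borel" by measurable
  finally show "vfloor -` {n} \<inter> space borel \<in> sets borel" .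
qed simp_all

lemma nn_integral_lborel_translate:
  fixes F :: "'a::euclidean_space \<Rightarrow> ennreal"
  assumes [measurable]: "F \<in> borel_measurable borel"
  shows "(\<integral>\<^sup>+x. F (x + c) \<partial>lborel) = (\<integral>\<^sup>+x. F x \<partial>lborel)"
proof -
  have "(\<integral>\<^sup>+x. F x \<partial>lborel) = (\<integral>\<^sup>+x. F x \<partial>(distr lborel borel ((+) c)))"
    by (simp add: lborel_distr_plus)
  also have "\<dots> = (\<integral>\<^sup>+x. F (x + c) \<partial>lborel)"
    by (subst nn_integral_distr) (auto simp: add.commute)
  finally show ?thesis ..
qed

lemma integral_lborel_translate:
  fixes F :: "'a::euclidean_space \<Rightarrow> 'b::{banach, second_countable_topology}"
  assumes [measurable]: "F \<in> borel_measurable borel"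
  shows "(LINT x|lborel. F (x + c)) = (LINT x|lborel. F x)"
    and "integrable lborel (\<lambda>x. F (x + c)) \<longleftrightarrow> integrable lborel F"
proof -
  have "(LINT x|lborel. F x) = (LINT x|(distr lborel borel ((+) c)). F x)"
    by (simp add: lborel_distr_plus)
  also have "\<dots> = (LINT x|lborel. F (x + c))"
    by (subst integral_distr) (auto simp: add.commute)
  finally show "(LINT x|lborel. F (x + c)) = (LINT x|lborel. F x)" ..
  have "integrable lborel F \<longleftrightarrow> integrable (distr lborel borel ((+) c)) F"
    by (simp add: lborel_distr_plus)
  also have "\<dots> \<longleftrightarrow> integrable lborel (\<lambda>x. F (x + c))"
    by (subst integrable_distr_eq) (auto simp: add.commute)
  finally show "integrable lborel (\<lambda>x. F (x + c)) \<longleftrightarrow> integrable lborel F" ..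
qed

lemma nn_integral_count_space_swap:
  fixes F :: "'i::countable \<Rightarrow> 'a::euclidean_space \<Rightarrow> ennreal"
  assumes "\<And>i. F i \<in> borel_measurable borel"
  shows "(\<integral>\<^sup>+i. (\<integral>\<^sup>+x. F i x \<partial>lborel) \<partial>count_space UNIV)
       = (\<integral>\<^sup>+x. (\<integral>\<^sup>+i. F i x \<partial>count_space UNIV) \<partial>lborel)"
proof -
  interpret C: sigma_finite_measure "count_space (UNIV :: 'i set)"
    by (rule sigma_finite_measure_count_space)
  interpret pair_sigma_finite "count_space (UNIV :: 'i set)" "lborel :: 'a measure" ..
  have "case_prod F \<in> borel_measurable (count_space UNIV \<Otimes>\<^sub>M (lborel :: 'a measure))"
    by (rule measurable_pair_measure_countable1) (auto simp: assms)
  from Fubini'[OF this] show ?thesis by simp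
qed

lemma nn_integral_periodize:
  fixes F :: "real^'d \<Rightarrow> ennreal"
  assumes [measurable]: "F \<in> borel_measurable borel"
  shows "(\<integral>\<^sup>+x. F x \<partial>lborel)
       = (\<integral>\<^sup>+x. (\<integral>\<^sup>+n. F (x + rvec n) \<partial>count_space UNIV) * indicator ucube x \<partial>lborel)"
proof -
  have "(\<integral>\<^sup>+n. F x * indicator ucube (x - rvec n) \<partial>count_space UNIV) = F x" for x
  proof -
    have "(\<integral>\<^sup>+n. F x * indicator ucube (x - rvec n) \<partial>count_space UNIV)
        = (\<integral>\<^sup>+n. F x * indicator {vfloor x} n \<partial>count_space UNIV)"
      by (intro nn_integral_cong) (auto simp: indicator_def diff_rvec_in_ucube_iff)
    then show ?thesis by simp
  qed
  then have "(\<integral>\<^sup>+x. F x \<partial>lborel)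
      = (\<integral>\<^sup>+x. (\<integral>\<^sup>+n. F x * indicator ucube (x - rvec n) \<partial>count_space UNIV) \<partial>lborel)"
    by simp
  also have "\<dots> = (\<integral>\<^sup>+n. (\<integral>\<^sup>+x. F x * indicator ucube (x - rvec n) \<partial>lborel) \<partial>count_space UNIV)"
    by (rule nn_integral_count_space_swap[symmetric]) measurable
  also have "\<dots> = (\<integral>\<^sup>+n. (\<integral>\<^sup>+x. F (x + rvec n) * indicator ucube x \<partial>lborel) \<partial>count_space UNIV)"
  proof (rule nn_integral_cong)
    fix n :: "int^'d"
    show "(\<integral>\<^sup>+x. F x * indicator ucube (x - rvec n) \<partial>lborel)
        = (\<integral>\<^sup>+x. F (x + rvec n) * indicator ucube x \<partial>lborel)"
      by (subst nn_integral_lborel_translate[where c="rvec n", symmetric]) auto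
  qed
  also have "\<dots> = (\<integral>\<^sup>+x. (\<integral>\<^sup>+n. F (x + rvec n) * indicator ucube x \<partial>count_space UNIV) \<partial>lborel)"
    by (rule nn_integral_count_space_swap) measurable
  finally show ?thesis
    by (simp add: nn_integral_multc)
qed

lemma nn_integral_linear_translate:
  fixes T S :: "'a::euclidean_space \<Rightarrow> 'a"
  assumes "linear T" and TS: "\<And>y. T (S y) = y" and [measurable]: "G \<in> borel_measurable borel"
  shows "(\<integral>\<^sup>+x. G (T x + y) \<partial>lborel) = (\<integral>\<^sup>+x. G (T x) \<partial>lborel)"
proof -
  have [measurable]: "T \<in> borel_measurable borel"
    using \<open>linear T\<close> by (intro borel_measurable_continuous_onI linear_continuous_on) (simp add: linear_conv_bounded_linear)
  have "(\<integral>\<^sup>+x. G (T x + y) \<partial>lborel) = (\<integral>\<^sup>+x. G (T (x + S y)) \<partial>lborel)"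
    by (simp add: linear_add[OF \<open>linear T\<close>] TS)
  also have "\<dots> = (\<integral>\<^sup>+x. G (T x) \<partial>lborel)"
    by (rule nn_integral_lborel_translate) measurable
  finally show ?thesis .
qed

text \<open>Uniqueness of Haar measure: both sides are \<open>\<integral>\<integral> g y * F (T x + y)\<close>.\<close>

lemma nn_integral_linear_exchange:
  fixes T S :: "'a::euclidean_space \<Rightarrow> 'a"
  assumes T: "linear T" "\<And>y. T (S y) = y"
    and [measurable]: "g \<in> borel_measurable borel" "F \<in> borel_measurable borel"
  shows "(\<integral>\<^sup>+y. g y \<partial>lborel) * (\<integral>\<^sup>+x. F (T x) \<partial>lborel)
    = (\<integral>\<^sup>+x. g (- T x) \<partial>lborel) * (\<integral>\<^sup>+y. F y \<partial>lborel)"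
proof -
  have [measurable]: "T \<in> borel_measurable borel"
    using T by (intro borel_measurable_continuous_onI linear_continuous_on) (simp add: linear_conv_bounded_linear)
  have "(\<integral>\<^sup>+y. g y \<partial>lborel) * (\<integral>\<^sup>+x. F (T x) \<partial>lborel)
      = (\<integral>\<^sup>+y. (\<integral>\<^sup>+x. g y * F (T x + y) \<partial>lborel) \<partial>lborel)"
    by (simp add: nn_integral_multc nn_integral_cmult nn_integral_linear_translate[OF T])
  also have "\<dots> = (\<integral>\<^sup>+x. (\<integral>\<^sup>+y. g y * F (T x + y) \<partial>lborel) \<partial>lborel)"
    by (rule lborel_pair.Fubini') measurable
  also have "\<dots> = (\<integral>\<^sup>+x. (\<integral>\<^sup>+y. g (y - T x) * F y \<partial>lborel) \<partial>lborel)"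
  proof (rule nn_integral_cong)
    fix x
    show "(\<integral>\<^sup>+y. g y * F (T x + y) \<partial>lborel) = (\<integral>\<^sup>+y. g (y - T x) * F y \<partial>lborel)"
      by (subst (2) nn_integral_lborel_translate[where c="T x", symmetric]) (auto simp: add.commute)
  qed
  also have "\<dots> = (\<integral>\<^sup>+y. (\<integral>\<^sup>+x. g (y - T x) * F y \<partial>lborel) \<partial>lborel)"
    by (rule lborel_pair.Fubini') measurable
  also have "\<dots> = (\<integral>\<^sup>+y. (\<integral>\<^sup>+x. g (- T x) \<partial>lborel) * F y \<partial>lborel)"
    using nn_integral_linear_translate[OF T, of "\<lambda>z. g (- z)" "- _"]
    by (intro nn_integral_cong) (simp add: nn_integral_multc)
  finally show ?thesis
    by (simp add: nn_integral_cmult)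
qed

lemma nn_integral_linear_scale:
  fixes T S :: "'a::euclidean_space \<Rightarrow> 'a"
  assumes "linear T" "\<And>y. T (S y) = y"
  obtains c where "\<And>F. F \<in> borel_measurable borel \<Longrightarrow>
    (\<integral>\<^sup>+x. F (T x) \<partial>lborel) = c * (\<integral>\<^sup>+x. F x \<partial>lborel)"
proof
  have "(\<integral>\<^sup>+y. indicator (cbox 0 One) y \<partial>(lborel :: 'a measure)) = 1"
    by (simp add: emeasure_lborel_cbox_eq)
  then show "(\<integral>\<^sup>+x. F (T x) \<partial>lborel) = (\<integral>\<^sup>+x. indicator (cbox 0 One) (- T x) \<partial>lborel) * (\<integral>\<^sup>+x. F x \<partial>lborel)"
    if "F \<in> borel_measurable borel" for F
    using nn_integral_linear_exchange[OF assms borel_measurable_indicator that, of "cbox 0 One"] by simp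
qed

subsection \<open>Expansive matrices\<close>

abbreviation mat_iter :: "'a::semiring_1^'d^'d \<Rightarrow> nat \<Rightarrow> 'a^'d \<Rightarrow> 'a^'d" where
  "mat_iter M j \<equiv> ((*v) M) ^^ j"

lemma mat_iter_Suc_right: "mat_iter M (Suc j) x = mat_iter M j (M *v x)"
  by (simp add: funpow_swap1)

lemma linear_mat_iter: "Vector_Spaces.linear (*s) (*s) (mat_iter M j)"
  for M :: "'a::field^'d^'d"
proof (induction j)
  case (Suc j)
  then show ?case
    using Vector_Spaces.linear_compose[OF Suc matrix_vector_mul_linear_gen[of M]] by (simp add: o_def)
qed (simp add: vec.linear_id[unfolded id_def] id_def)

lemmas mat_iter_add = vec.linear_add[OF linear_mat_iter]
  and mat_iter_diff = vec.linear_diff[OF linear_mat_iter]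
  and mat_iter_scale = vec.linear_scale[OF linear_mat_iter]
  and mat_iter_sum = vec.linear_sum[OF linear_mat_iter]

definition poly_apply :: "'a::field^'d^'d \<Rightarrow> 'a poly \<Rightarrow> 'a^'d \<Rightarrow> 'a^'d" where
  "poly_apply M p v = (\<Sum>i\<le>degree p. coeff p i *s mat_iter M i v)"

lemma poly_apply_degree_le:
  assumes "degree p \<le> n"
  shows "poly_apply M p v = (\<Sum>i\<le>n. coeff p i *s mat_iter M i v)"
  unfolding poly_apply_def using assms
  by (intro sum.mono_neutral_left) (auto simp: coeff_eq_0)

lemma poly_apply_add: "poly_apply M (p + q) v = poly_apply M p v + poly_apply M q v"
  by (subst (1 2 3) poly_apply_degree_le[where n = "max (degree p) (degree q)"])
     (auto simp: degree_add_le vec.scale_left_distrib sum.distrib)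

lemma poly_apply_smult: "poly_apply M (smult c p) v = c *s poly_apply M p v"
  by (subst (1 2) poly_apply_degree_le[where n = "degree p"])
     (auto simp: degree_smult_le vec.scale_sum_right)

lemma poly_apply_pCons_0: "poly_apply M (pCons 0 p) v = poly_apply M p (M *v v)"
proof -
  have "poly_apply M (pCons 0 p) v = (\<Sum>i\<le>Suc (degree p). coeff (pCons 0 p) i *s mat_iter M i v)"
    by (rule poly_apply_degree_le) (simp add: degree_pCons_le)
  also have "\<dots> = (\<Sum>i\<le>degree p. coeff p i *s mat_iter M (Suc i) v)"
    by (subst sum.atMost_Suc_shift) simp
  finally show ?thesis
    by (simp only: poly_apply_def mat_iter_Suc_right)
qed

lemma poly_apply_diff_vec: "poly_apply M p (v - w) = poly_apply M p v - poly_apply M p w"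
  by (simp add: poly_apply_def mat_iter_diff vec.scale_right_diff_distrib sum_subtractf)

lemma poly_apply_scale_vec: "poly_apply M p (c *s v) = c *s poly_apply M p v"
  unfolding poly_apply_def mat_iter_scale vec.scale_sum_right
  by (intro sum.cong refl) (simp add: mult.commute)

lemma poly_apply_mult_vec: "poly_apply M p (M *v v) = M *v poly_apply M p v"
  by (simp add: poly_apply_def funpow_swap1[symmetric] vector_scalar_commute
    vec.linear_sum[OF matrix_vector_mul_linear_gen])

lemma poly_apply_linear_factor:
  "poly_apply M ([:- c, 1:] * q) v = poly_apply M q (M *v v - c *s v)"
proof -
  have "[:- c, 1:] * q = smult (- c) q + pCons 0 q" by simp
  then show ?thesis
    by (simp only: poly_apply_add poly_apply_smult poly_apply_pCons_0 poly_apply_diff_vec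
      poly_apply_scale_vec) simp
qed

lemma ex_nontrivial_relation:
  fixes f :: "nat \<Rightarrow> 'a::field^'d"
  shows "\<exists>a. (\<exists>i\<le>CARD('d). a i \<noteq> 0) \<and> (\<Sum>i\<le>CARD('d). a i *s f i) = 0"
proof (cases "inj_on f {..CARD('d)}")
  case True
  have "vec.dim (f ` {..CARD('d)}) < card (f ` {..CARD('d)})"
    using vec.dim_subset_UNIV[of "f ` {..CARD('d)}"] True
    by (simp add: vec.dimension_def card_cart_basis card_image)
  then have "vec.dependent (f ` {..CARD('d)})"
    by (intro vec.dependent_biggerset_general) simp
  then obtain u w where u: "w \<in> f ` {..CARD('d)}" "u w \<noteq> 0" "(\<Sum>w\<in>f ` {..CARD('d)}. u w *s w) = 0"
    by (auto simp: vec.dependent_finite)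
  then have "(\<Sum>i\<le>CARD('d). u (f i) *s f i) = 0"
    by (simp add: sum.reindex[OF True])
  with u(1,2) show ?thesis by (intro exI[of _ "\<lambda>i. u (f i)"]) auto
next
  case False
  then obtain i j where ij: "i \<le> CARD('d)" "j \<le> CARD('d)" "i \<noteq> j" "f i = f j"
    by (auto simp: inj_on_def)
  define a :: "nat \<Rightarrow> 'a" where "a k = (if k = i then 1 else if k = j then - 1 else 0)" for k
  have "(\<Sum>k\<le>CARD('d). a k *s f k)
      = (\<Sum>k\<le>CARD('d). (if k = i then f i else 0) - (if k = j then f j else 0))"
    using ij by (intro sum.cong) (auto simp: a_def)
  also have "\<dots> = 0" using ij by (simp add: sum_subtractf)
  finally show ?thesis using ij(1) by (intro exI[of _ a]) (auto simp: a_def)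
qed

lemma ex_annihilating_poly:
  fixes M :: "'a::field^'d^'d"
  shows "\<exists>p. p \<noteq> 0 \<and> poly_apply M p v = 0"
proof -
  obtain a i where a: "i \<le> CARD('d)" "a i \<noteq> 0" "(\<Sum>i\<le>CARD('d). a i *s mat_iter M i v) = 0"
    using ex_nontrivial_relation[of "\<lambda>i. mat_iter M i v"] by metis
  define p where "p = (\<Sum>i\<le>CARD('d). monom (a i) i)"
  have coeff_p: "coeff p i = (if i \<le> CARD('d) then a i else 0)" for i
    by (simp add: p_def coeff_sum)
  have "p \<noteq> 0" using coeff_p[of i] a(1,2) by auto
  moreover have "degree p \<le> CARD('d)" by (intro degree_le) (auto simp: coeff_p)
  then have "poly_apply M p v = 0"
    using a(3) by (subst poly_apply_degree_le) (auto simp: coeff_p)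
  ultimately show ?thesis by blast
qed

definition decaying_orbit :: "'a::real_normed_field^'d^'d \<Rightarrow> 'a^'d \<Rightarrow> bool" where
  "decaying_orbit M v \<longleftrightarrow> (\<exists>C r. 0 < r \<and> r < 1 \<and> (\<forall>j. norm (mat_iter M j v) \<le> C * r ^ j))"

lemma norm_scale_vec: "norm (c *s v) = norm c * norm v"
  for v :: "'a::real_normed_field^'d"
  by (simp add: norm_vec_def L2_set_def norm_mult power_mult_distrib sum_distrib_left[symmetric] real_sqrt_mult)

lemma geometric_bound_of_recursion:
  fixes a :: "nat \<Rightarrow> real"
  assumes c: "0 \<le> c" "c < 1" and r: "0 < r" "r < 1" and "0 \<le> C"
    and recursion: "\<And>j. a (Suc j) \<le> c * a j + C * r ^ j"
  shows "\<exists>D s. 0 < s \<and> s < 1 \<and> (\<forall>j. a j \<le> D * s ^ j)"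
proof -
  define s where "s = (max r c + 1) / 2"
  define D where "D = \<bar>a 0\<bar> + C / (s - c)"
  have s: "0 < s" "s < 1" "r \<le> s" "c < s"
    using r c by (auto simp: s_def max_def)
  have D: "c * D + C \<le> s * D"
  proof -
    have "(s - c) * D = (s - c) * \<bar>a 0\<bar> + C"
      using s by (simp add: D_def field_simps)
    moreover have "0 \<le> (s - c) * \<bar>a 0\<bar>" using s by simp
    ultimately show ?thesis by (simp add: algebra_simps)
  qed
  have "a j \<le> D * s ^ j" for j
  proof (induction j)
    case 0
    have "0 \<le> C / (s - c)" using \<open>0 \<le> C\<close> s by simp
    then show ?case by (simp add: D_def)
  next
    case (Suc j)
    have "a (Suc j) \<le> c * (D * s ^ j) + C * s ^ j"
    proof (rule order_trans[OF recursion add_mono])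
      show "c * a j \<le> c * (D * s ^ j)" using Suc c(1) by (rule mult_left_mono)
      show "C * r ^ j \<le> C * s ^ j" using s(3) r(1) \<open>0 \<le> C\<close> by (intro mult_left_mono power_mono) auto
    qed
    also have "\<dots> = (c * D + C) * s ^ j" by (simp add: algebra_simps)
    also have "\<dots> \<le> (s * D) * s ^ j" using D s(1) by (intro mult_right_mono) auto
    finally show ?case by (simp add: mult_ac)
  qed
  with s(1,2) show ?thesis by blast
qed

lemma decaying_orbit_shifted:
  fixes M :: "'a::real_normed_field^'d^'d"
  assumes "norm c < 1" "decaying_orbit M (M *v v - c *s v)"
  shows "decaying_orbit M v"
proof -
  define w where "w = M *v v - c *s v"
  obtain C r where r: "0 < r" "r < 1" and decay: "\<And>j. norm (mat_iter M j w) \<le> C * r ^ j"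
    using assms(2) unfolding decaying_orbit_def w_def by blast
  have "0 \<le> C" using decay[of 0] by (auto intro: order_trans[OF norm_ge_zero])
  have "norm (mat_iter M (Suc j) v) \<le> norm c * norm (mat_iter M j v) + C * r ^ j" for j
  proof -
    have "mat_iter M (Suc j) v = mat_iter M j (c *s v + w)"
      by (simp add: w_def funpow_swap1)
    then have "norm (mat_iter M (Suc j) v) \<le> norm (c *s mat_iter M j v) + norm (mat_iter M j w)"
      by (simp only: mat_iter_add mat_iter_scale norm_triangle_ineq)
    then show ?thesis using decay[of j] by (simp add: norm_scale_vec)
  qed
  then show ?thesis
    using geometric_bound_of_recursion[OF norm_ge_zero assms(1) r \<open>0 \<le> C\<close>, of "\<lambda>j. norm (mat_iter M j v)"]
    unfolding decaying_orbit_def by blast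
qed

text \<open>In an annihilating polynomial, linear factors whose root is not an eigenvalue can be cancelled.\<close>

lemma decaying_orbit_annihilated:
  fixes M :: "complex^'d^'d"
  assumes eigenvalues: "\<And>c v. v \<noteq> 0 \<Longrightarrow> M *v v = c *s v \<Longrightarrow> cmod c < 1"
    and "p \<noteq> 0" "poly_apply M p v = 0"
  shows "decaying_orbit M v"
  using assms(2,3)
proof (induction "degree p" arbitrary: p v)
  case 0
  then obtain a where "p = [:a:]" "a \<noteq> 0"
    by (metis degree_eq_zeroE pCons_0_0)
  with 0 have "v = 0" by (simp add: poly_apply_def)
  then have "mat_iter M j v = 0" for j by (induction j) auto
  then show ?case
    unfolding decaying_orbit_def by (intro exI[of _ 0] exI[of _ "1/2"]) auto
next
  case (Suc n)
  have "\<not> constant (poly p)"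
    using Suc.hyps(2) by (simp add: constant_degree)
  then obtain c where "poly p c = 0"
    using fundamental_theorem_of_algebra by blast
  then obtain q where q: "p = [:- c, 1:] * q"
    by (metis poly_eq_0_iff_dvd dvdE)
  with Suc.prems have "q \<noteq> 0" by auto
  then have degree_q: "n = degree q"
    using Suc.hyps(2) degree_mult_eq[of "[:- c, 1:]" q] unfolding q by simp
  have q_shifted: "poly_apply M q (M *v v - c *s v) = 0"
    using Suc.prems(2) unfolding q poly_apply_linear_factor .
  show ?case
  proof (cases "cmod c < 1")
    case False
    have "M *v poly_apply M q v = c *s poly_apply M q v"
      using q_shifted by (simp add: poly_apply_diff_vec poly_apply_scale_vec poly_apply_mult_vec)
    with eigenvalues False have "poly_apply M q v = 0" by blast
    then show ?thesis by (rule Suc.hyps(1)[OF degree_q \<open>q \<noteq> 0\<close>])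
  next
    case True
    then show ?thesis
      by (rule decaying_orbit_shifted) (rule Suc.hyps(1)[OF degree_q \<open>q \<noteq> 0\<close> q_shifted])
  qed
qed

definition geometric_decay :: "real^'d^'d \<Rightarrow> bool" where
  "geometric_decay M \<longleftrightarrow> (\<exists>C r. 0 \<le> C \<and> 0 < r \<and> r < 1 \<and> (\<forall>j x. norm (mat_iter M j x) \<le> C * r ^ j * norm x))"

lemma geometric_decayE:
  assumes "geometric_decay M"
  obtains C r where "0 \<le> C" "0 < r" "r < 1" "\<And>j x. norm (mat_iter M j x) \<le> C * r ^ j * norm x"
  using assms unfolding geometric_decay_def by blast

lemma geometric_decay_tendsto_0:
  assumes "geometric_decay M"
  shows "(\<lambda>j. mat_iter M j x) \<longlonglongrightarrow> 0"
proof -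
  obtain C r where decay: "0 \<le> C" "0 < r" "r < 1" "\<And>j x. norm (mat_iter M j x) \<le> C * r ^ j * norm x"
    using geometric_decayE[OF assms] by blast
  show ?thesis
  proof (rule Lim_null_comparison)
    show "\<forall>\<^sub>F j in sequentially. norm (mat_iter M j x) \<le> C * r ^ j * norm x" using decay(4) by simp
    show "(\<lambda>j. C * r ^ j * norm x) \<longlonglongrightarrow> 0"
      using decay by (intro tendsto_mult_left_zero tendsto_mult_right_zero LIMSEQ_power_zero) auto
  qed
qed

lemma geometric_decay_if_decaying_orbits:
  fixes M :: "real^'d^'d"
  assumes "\<And>x. decaying_orbit M x"
  shows "geometric_decay M"
proof -
  obtain C r where decay: "\<And>x. 0 < r x" "\<And>x. r x < 1" "\<And>x j. norm (mat_iter M j x) \<le> C x * r x ^ j"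
    using assms unfolding decaying_orbit_def by metis
  define s where "s = Max (range (\<lambda>i. r (axis i 1)))"
  define D where "D = (\<Sum>i\<in>UNIV. C (axis i 1))"
  have s: "0 < s" "s < 1" "\<And>i. r (axis i 1) \<le> s"
    using decay by (auto simp: s_def Max_gr_iff)
  have C_nonneg: "0 \<le> C x" for x using decay(3)[of 0 x] by (auto intro: order_trans[OF norm_ge_zero])
  have "norm (mat_iter M j x) \<le> D * s ^ j * norm x" for j x
  proof -
    have "mat_iter M j x = (\<Sum>i\<in>UNIV. x$i *s mat_iter M j (axis i 1))"
      by (subst basis_expansion[of x, symmetric]) (simp only: mat_iter_sum mat_iter_scale)
    also have "norm \<dots> \<le> (\<Sum>i\<in>UNIV. norm x * (C (axis i 1) * s ^ j))"
    proof (rule sum_norm_le)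
      fix i
      have "norm (mat_iter M j (axis i 1)) \<le> C (axis i 1) * s ^ j"
        using decay(3)[of j "axis i 1"] power_mono[OF s(3)[of i] less_imp_le[OF decay(1)], of j] C_nonneg
        by (meson mult_left_mono order_trans)
      then show "norm (x$i *s mat_iter M j (axis i 1)) \<le> norm x * (C (axis i 1) * s ^ j)"
        using component_le_norm_cart[of x i] by (simp add: norm_scale_vec mult_mono)
    qed
    also have "\<dots> = D * s ^ j * norm x"
      by (simp add: D_def sum_distrib_left sum_distrib_right mult_ac)
    finally show ?thesis .
  qed
  moreover have "0 \<le> D" using C_nonneg by (simp add: D_def sum_nonneg)
  ultimately show ?thesis using s unfolding geometric_decay_def by blast
qed

lemma inner_mat_iter_adjoint:
  assumes "\<And>x y. (N *v x) \<bullet> y = x \<bullet> (M *v y)"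
  shows "mat_iter N j x \<bullet> y = x \<bullet> mat_iter M j (y :: real^'d)"
  by (induction j arbitrary: y) (simp_all add: assms funpow_swap1[of "(*v) M"])

lemma geometric_decay_adjoint:
  fixes M N :: "real^'d^'d"
  assumes adjoint: "\<And>x y. (N *v x) \<bullet> y = x \<bullet> (M *v y)" and "geometric_decay M"
  shows "geometric_decay N"
proof -
  obtain C r where decay: "0 \<le> C" "0 < r" "r < 1" "\<And>j x. norm (mat_iter M j x) \<le> C * r ^ j * norm x"
    using geometric_decayE[OF assms(2)] by blast
  have "norm (mat_iter N j x) \<le> C * r ^ j * norm x" for j x
  proof -
    let ?z = "mat_iter N j x"
    have "norm ?z * norm ?z = ?z \<bullet> ?z" by (simp add: dot_square_norm power2_eq_square)
    also have "\<dots> = x \<bullet> mat_iter M j ?z" by (rule inner_mat_iter_adjoint[OF adjoint])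
    also have "\<dots> \<le> norm x * norm (mat_iter M j ?z)" by (rule norm_cauchy_schwarz)
    also have "\<dots> \<le> norm x * (C * r ^ j * norm ?z)" by (intro mult_left_mono decay) auto
    finally have "norm ?z * norm ?z \<le> (C * r ^ j * norm x) * norm ?z" by (simp add: mult_ac)
    moreover have "0 \<le> C * r ^ j * norm x" using decay by simp
    ultimately show ?thesis
      by (cases "norm ?z = 0") (auto dest: mult_right_le_imp_le)
  qed
  then show ?thesis using decay(1-3) unfolding geometric_decay_def by blast
qed

lemma matrix_inv_mult_vec:
  fixes M :: "'a::field^'n^'n"
  assumes "invertible M"
  shows "matrix_inv M *v (M *v x) = x" "M *v (matrix_inv M *v x) = x"
  using someI_ex[OF assms[unfolded invertible_def]]
  by (simp_all add: matrix_vector_mul_assoc matrix_inv_def)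

lemma borel_measurable_matrix_vector_mult [measurable]:
  fixes M :: "real^'n^'m"
  shows "(\<lambda>x. M *v x) \<in> borel \<rightarrow>\<^sub>M borel"
  by (intro borel_measurable_continuous_onI matrix_vector_mult_linear_continuous_on)

definition cvec :: "real^'d \<Rightarrow> complex^'d" where
  "cvec x = (\<chi> i. complex_of_real (x$i))"

lemma cmat_mult_cvec: "cmat A *v cvec x = cvec (rmat A *v x)"
  by (simp add: cvec_def vec_eq_iff cmat_def rmat_def matrix_vector_mult_def)

lemma cvec_eq_0_iff: "cvec x = 0 \<longleftrightarrow> x = 0"
  by (simp add: cvec_def vec_eq_iff)

lemma norm_cvec: "norm (cvec x) = norm x"
  by (simp add: cvec_def norm_vec_def L2_set_def)

locale expansive_matrix =
  fixes A :: "int^'d^'d"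
  assumes expA: "expansive A"
begin

abbreviation "R \<equiv> rmat A"
abbreviation "Rinv \<equiv> matrix_inv (rmat A)"
abbreviation "Rtinv \<equiv> matrix_inv (transpose (rmat A))"

lemma cmat_mult_eq_0D: "v = 0" if "cmat A *v v = 0"
proof (rule ccontr)
  assume "v \<noteq> 0"
  with that expA have "cmod 0 > 1"
    unfolding expansive_def by (metis vector_smult_lzero)
  then show False by simp
qed

lemma invertible_cmat: "invertible (cmat A)"
  using cmat_mult_eq_0D matrix_left_invertible_ker invertible_left_inverse by blast

lemma invertible_R: "invertible R"
proof -
  have "x = 0" if "R *v x = 0" for x
    using cmat_mult_eq_0D[of "cvec x"] that by (simp add: cmat_mult_cvec cvec_eq_0_iff)
  then show ?thesis
    using matrix_left_invertible_ker invertible_left_inverse by blast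
qed

lemma R_Rinv [simp]: "R *v (Rinv *v x) = x" and Rinv_R [simp]: "Rinv *v (R *v x) = x"
  using invertible_R by (simp_all add: matrix_inv_mult_vec)

lemma mat_iter_Rinv_R: "mat_iter Rinv j (mat_iter R j x) = x"
  by (induction j) (simp_all add: funpow_swap1[of "(*v) Rinv"])

lemma A_inject [simp]: "A *v k = A *v l \<longleftrightarrow> k = l"
  by (metis Rinv_R rvec_inject rvec_matrix)

lemma inverse_eigenvalue_less_1:
  assumes v: "v \<noteq> 0" "matrix_inv (cmat A) *v v = c *s v"
  shows "cmod c < 1"
proof -
  have "v = c *s (cmat A *v v)"
    using matrix_inv_mult_vec(2)[OF invertible_cmat, of v] v(2) by (simp add: vector_scalar_commute)
  moreover from this have "c \<noteq> 0" using v(1) by auto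
  ultimately have "cmat A *v v = (1/c) *s v"
    by (metis divide_inverse mult.left_neutral mult.commute right_inverse vector_smult_assoc vector_smult_lid)
  then have "1 < cmod (1/c)" using expA v(1) unfolding expansive_def by blast
  then show ?thesis using \<open>c \<noteq> 0\<close> by (simp add: norm_divide field_simps)
qed

lemma geometric_decay_Rinv: "geometric_decay Rinv"
proof (rule geometric_decay_if_decaying_orbits)
  fix x
  let ?M = "matrix_inv (cmat A)"
  have "?M *v cvec y = cvec (Rinv *v y)" for y
    using matrix_inv_mult_vec(1)[OF invertible_cmat, of "cvec (Rinv *v y)"] by (simp add: cmat_mult_cvec)
  then have "mat_iter ?M j (cvec x) = cvec (mat_iter Rinv j x)" for j
    by (induction j) simp_all
  moreover have "decaying_orbit ?M (cvec x)"
    using ex_annihilating_poly decaying_orbit_annihilated inverse_eigenvalue_less_1 by metis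
  ultimately show "decaying_orbit Rinv x"
    by (simp add: decaying_orbit_def norm_cvec)
qed

lemma inner_Rtinv: "(Rtinv *v x) \<bullet> y = x \<bullet> (Rinv *v y)"
proof -
  have "(Rtinv *v x) \<bullet> y = (Rtinv *v x) \<bullet> (R *v (Rinv *v y))"
    by simp
  also have "\<dots> = (transpose R *v (Rtinv *v x)) \<bullet> (Rinv *v y)"
    by (simp only: dot_lmul_matrix transpose_matrix_vector)
  also have "\<dots> = x \<bullet> (Rinv *v y)"
    using matrix_inv_mult_vec(2)[OF transpose_invertible[OF invertible_R]] by simp
  finally show ?thesis .
qed

lemma geometric_decay_Rtinv: "geometric_decay Rtinv"
  using inner_Rtinv geometric_decay_Rinv by (rule geometric_decay_adjoint)

end

lemma latt_uminus: "k \<in> latt A \<Longrightarrow> - k \<in> latt A"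
  unfolding latt_def by (auto intro!: image_eqI[where x="- _"] simp: matrix_vector_mult_def vec_eq_iff sum_negf)

lemma latt_zero: "0 \<in> latt A"
  unfolding latt_def by (auto intro!: image_eqI[where x=0])

locale dilation_lattice = expansive_matrix A
  for A :: "int^'d^'d" +
  fixes lA :: "int^'d"
  assumes part: "UNIV = ((\<lambda>k. lA + k) ` latt A) \<union> latt A"
    and disj: "((\<lambda>k. lA + k) ` latt A) \<inter> latt A = {}"
begin

lemma add_lA_in_latt_iff: "n + lA \<in> latt A \<longleftrightarrow> n \<notin> latt A"
proof
  assume "n + lA \<in> latt A"
  then have "- n \<in> (\<lambda>k. lA + k) ` latt A"
    by (intro image_eqI[where x="- (n + lA)"]) (auto dest: latt_uminus)
  then show "n \<notin> latt A" using disj latt_uminus by blast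
next
  assume "n \<notin> latt A"
  then have "- n \<in> (\<lambda>k. lA + k) ` latt A"
    using part latt_uminus[of "- n" A] by auto
  then obtain k where "k \<in> latt A" "- n = lA + k" by blast
  moreover from this have "n + lA = - k" by (simp add: algebra_simps minus_equation_iff[of n])
  ultimately show "n + lA \<in> latt A" using latt_uminus by simp
qed

text \<open>The cells \<open>Rinv *v (ucube - rvec m)\<close> for \<open>m\<close> in the two cosets tile the space: every point lies in
  exactly one of their integer translates.\<close>

lemma ucube_coset_cover:
  "(\<integral>\<^sup>+k. indicator ucube (y + rvec (A *v k)) + indicator ucube (y + rvec (A *v k - lA)) \<partial>count_space UNIV)
    = (1::ennreal)"
proof -
  let ?n = "- vfloor y"
  obtain k' where k': "if ?n \<in> latt A then ?n = A *v k' else ?n + lA = A *v k'"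
    using add_lA_in_latt_iff[of ?n] by (auto simp: latt_def)
  have "(A *v k = ?n \<or> A *v k - lA = ?n) \<longleftrightarrow> k = k'" "\<not> (A *v k = ?n \<and> A *v k - lA = ?n)" for k
  proof -
    have A_latt: "A *v k \<in> latt A" by (simp add: latt_def)
    show "\<not> (A *v k = ?n \<and> A *v k - lA = ?n)"
      using A_latt add_lA_in_latt_iff[of ?n] by (metis diff_add_cancel)
    show "(A *v k = ?n \<or> A *v k - lA = ?n) \<longleftrightarrow> k = k'"
      using k' A_latt add_lA_in_latt_iff[of ?n]
      by (metis A_inject add_diff_cancel_right' diff_add_cancel)
  qed
  then have "(\<integral>\<^sup>+k. indicator ucube (y + rvec (A *v k)) + indicator ucube (y + rvec (A *v k - lA)) \<partial>count_space UNIV)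
      = (\<integral>\<^sup>+k. indicator {k'} k \<partial>count_space UNIV)"
    by (intro nn_integral_cong) (auto simp: indicator_def add_rvec_in_ucube_iff)
  then show ?thesis by simp
qed

lemma nn_integral_dilate:
  fixes F :: "real^'d \<Rightarrow> ennreal"
  assumes F: "F \<in> borel_measurable borel"
  shows "(\<integral>\<^sup>+x. F (R *v x) \<partial>lborel) = ennreal (1/2) * (\<integral>\<^sup>+x. F x \<partial>lborel)"
proof -
  obtain c where c: "\<And>F. F \<in> borel_measurable borel \<Longrightarrow>
    (\<integral>\<^sup>+x. F (R *v x) \<partial>lborel) = c * (\<integral>\<^sup>+x. F x \<partial>lborel)"
    using nn_integral_linear_scale[of "(*v) R" "(*v) Rinv"] by auto
  define q :: "real^'d \<Rightarrow> ennreal" where "q = indicator ucube"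
  have [measurable]: "q \<in> borel_measurable borel" and q_integral: "(\<integral>\<^sup>+x. q x \<partial>lborel) = 1"
    by (simp_all add: q_def)
  have "1 = (\<integral>\<^sup>+x. indicator (ucube :: (real^'d) set) x \<partial>lborel)" by simp
  also have "\<dots> = (\<integral>\<^sup>+x. (\<integral>\<^sup>+n. q (R *v (x + rvec n)) + q (R *v (x + rvec n) - rvec lA) \<partial>count_space UNIV)
      * indicator ucube x \<partial>lborel)"
    using ucube_coset_cover
    by (simp add: q_def matrix_vector_right_distrib rvec_matrix rvec_diff add_diff_eq)
  also have "\<dots> = (\<integral>\<^sup>+x. q (R *v x) + q (R *v x - rvec lA) \<partial>lborel)"
    by (rule nn_integral_periodize[symmetric]) measurable
  also have "\<dots> = c * (\<integral>\<^sup>+x. q x \<partial>lborel) + c * (\<integral>\<^sup>+x. q (x - rvec lA) \<partial>lborel)"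
    by (subst nn_integral_add) (auto simp: c[of q] c[of "\<lambda>x. q (x - rvec lA)"])
  also have "\<dots> = c + c"
    using nn_integral_lborel_translate[of q "- rvec lA"] q_integral by simp
  finally have double: "c + c = 1" ..
  then obtain r where r: "c = ennreal r" "0 \<le> r" by (cases c) auto
  then have "ennreal (r + r) = ennreal 1"
    using double by (simp only: ennreal_plus ennreal_1)
  then have "r = 1/2" using r(2) by (subst (asm) ennreal_inj) auto
  then have "c = ennreal (1/2)" using r(1) by (simp only:)
  then show ?thesis using c[OF F] by simp
qed

lemma distr_dilate: "distr lborel borel (\<lambda>x. R *v x) = density lborel (\<lambda>_. ennreal (1/2))"
proof (rule measure_eqI)
  fix S assume "S \<in> sets (distr lborel borel (\<lambda>x. R *v x))"
  then have [measurable]: "S \<in> sets borel" by simp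
  have "emeasure (distr lborel borel (\<lambda>x. R *v x)) S
      = (\<integral>\<^sup>+x. indicator S x \<partial>(distr lborel borel (\<lambda>x. R *v x)))"
    by simp
  also have "\<dots> = (\<integral>\<^sup>+x. indicator S (R *v x) \<partial>lborel)"
    by (subst nn_integral_distr) auto
  also have "\<dots> = ennreal (1/2) * emeasure lborel S"
    by (subst nn_integral_dilate) auto
  also have "\<dots> = emeasure (density lborel (\<lambda>_. ennreal (1/2))) S"
    by (simp add: emeasure_density nn_integral_cmult_indicator)
  finally show "emeasure (distr lborel borel (\<lambda>x. R *v x)) S
      = emeasure (density lborel (\<lambda>_. ennreal (1/2))) S" .
qed simp

lemma integral_dilate:
  fixes F :: "real^'d \<Rightarrow> 'b::{banach, second_countable_topology}"
  assumes [measurable]: "F \<in> borel_measurable borel"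
  shows "(LINT x|lborel. F (R *v x)) = (1/2) *\<^sub>R (LINT x|lborel. F x)"
    and "integrable lborel (\<lambda>x. F (R *v x)) \<longleftrightarrow> integrable lborel F"
proof -
  have "(LINT x|lborel. F (R *v x)) = (LINT x|distr lborel borel (\<lambda>x. R *v x). F x)"
    by (subst integral_distr) auto
  also have "\<dots> = (1/2) *\<^sub>R (LINT x|lborel. F x)"
    unfolding distr_dilate by (subst integral_density) auto
  finally show "(LINT x|lborel. F (R *v x)) = (1/2) *\<^sub>R (LINT x|lborel. F x)" .
  have "integrable lborel (\<lambda>x. F (R *v x)) \<longleftrightarrow> integrable (distr lborel borel (\<lambda>x. R *v x)) F"
    by (subst integrable_distr_eq) auto
  also have "\<dots> \<longleftrightarrow> integrable lborel F"
    unfolding distr_dilate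
    using integrable_scaleR_right[of 2 lborel "\<lambda>x. (1/2) *\<^sub>R F x"]
    by (subst integrable_density) auto
  finally show "integrable lborel (\<lambda>x. F (R *v x)) \<longleftrightarrow> integrable lborel F" .
qed

lemma integral_dilate_inv:
  fixes F :: "real^'d \<Rightarrow> 'b::{banach, second_countable_topology}"
  assumes [measurable]: "F \<in> borel_measurable borel"
  shows "(LINT x|lborel. F (Rinv *v x)) = 2 *\<^sub>R (LINT x|lborel. F x)"
    and "integrable lborel (\<lambda>x. F (Rinv *v x)) \<longleftrightarrow> integrable lborel F"
  using integral_dilate[of "\<lambda>x. F (Rinv *v x)"] by (simp_all add: field_simps)

end

subsection \<open>Continuity of translations\<close>

lemma integrable_indicator_cball: "integrable lborel (indicator (cball x r) :: 'a::euclidean_space \<Rightarrow> real)"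
  using emeasure_lborel_cball_finite[of x r] by (intro integrable_real_indicator) auto

lemma sq_int_indicator_cball: "sq_int (indicator (cball x r))"
  by (rule sq_int_bound[OF integrable_indicator_cball]) (auto simp: indicator_def intro!: borel_measurable_indicator)

definition bounded_support :: "real \<Rightarrow> ('a::euclidean_space \<Rightarrow> complex) \<Rightarrow> bool" where
  "bounded_support M f \<longleftrightarrow>
    f \<in> borel_measurable borel \<and> (\<forall>x. cmod (f x) \<le> M) \<and> (\<forall>x. M < norm x \<longrightarrow> f x = 0)"

lemma
  assumes "bounded_support M f"
  shows bounded_support_measurable: "f \<in> borel_measurable borel"
    and bounded_support_norm_le: "cmod (f x) \<le> M"
    and bounded_support_eq_0: "M < norm x \<Longrightarrow> f x = 0"
  using assms by (auto simp: bounded_support_def)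

lemma
  fixes f :: "real^'d \<Rightarrow> complex"
  assumes f: "bounded_support M f"
  shows integrable_bounded_support: "integrable lborel f" and sq_int_bounded_support: "sq_int f"
proof -
  note [measurable] = bounded_support_measurable[OF f]
  have dominated: "cmod (f x) \<le> M * indicator (cball 0 M) x" for x
    using bounded_support_norm_le[OF f, of x] bounded_support_eq_0[OF f, of x] by (cases "norm x \<le> M") auto
  show "integrable lborel f"
    by (rule Bochner_Integration.integrable_bound[OF integrable_mult_right[of M, OF integrable_indicator_cball]])
       (auto intro!: AE_I2 order_trans[OF dominated abs_ge_self])
  show "sq_int f"
  proof (rule sq_int_bound[OF integrable_mult_right[of "M\<^sup>2", OF integrable_indicator_cball]])
    fix x show "(cmod (f x))\<^sup>2 \<le> M\<^sup>2 * indicator (cball 0 M) x"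
      using power_mono[OF dominated norm_ge_zero, of x 2] by (cases "norm x \<le> M") (auto simp: power_mult_distrib)
  qed simp
qed

lemma L2_dense_bounded_support:
  fixes f :: "real^'d \<Rightarrow> complex"
  assumes f: "sq_int f" and "0 < \<epsilon>"
  obtains M e where "bounded_support M e" "L2_norm (\<lambda>x. f x - e x) < \<epsilon>"
proof -
  note [measurable] = sq_int_measurable[OF f]
  define T where "T M x = (if cmod (f x) \<le> real M \<and> norm x \<le> real M then f x else 0)" for M x
  have [measurable]: "T M \<in> borel_measurable borel" for M
    unfolding T_def by measurable
  have lim: "(\<lambda>M. L2_norm (\<lambda>x. f x - T M x)) \<longlonglongrightarrow> 0"
  proof (rule L2_norm_tendsto_0_dominated[OF sq_int_integrable_norm2[OF f]])
    show "AE x in lborel. (\<lambda>M. f x - T M x) \<longlonglongrightarrow> 0"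
    proof (intro AE_I2 tendsto_eventually)
      fix x
      obtain M0 :: nat where "max (cmod (f x)) (norm x) \<le> real M0" using real_arch_simple by blast
      then show "\<forall>\<^sub>F M in sequentially. f x - T M x = 0"
        by (intro eventually_sequentiallyI[of M0]) (auto simp: T_def)
    qed
  qed (auto simp: T_def)
  obtain M where "L2_norm (\<lambda>x. f x - T M x) < \<epsilon>"
    using eventually_happens'[OF sequentially_bot order_tendstoD(2)[OF lim \<open>0 < \<epsilon>\<close>]] by blast
  moreover have "bounded_support (real M) (T M)"
    by (simp add: bounded_support_def) (simp add: T_def)
  ultimately show ?thesis by (rule that[rotated])
qed

lemma borel_measurable_AE_limit_of_continuous:
  fixes f :: "'a::euclidean_space \<Rightarrow> 'b::euclidean_space"
  assumes "f \<in> borel_measurable borel"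
  obtains g where "\<And>n. continuous_on UNIV (g n)" "AE x in lborel. (\<lambda>n::nat. g n x) \<longlonglongrightarrow> f x"
proof -
  have "f \<in> borel_measurable lebesgue"
    by (rule measurable_completion) (simp add: assms)
  then have "f measurable_on UNIV"
    by (rule lebesgue_measurable_imp_measurable_on) simp
  then obtain N g where N: "negligible N" and g: "\<And>n. continuous_on UNIV (g n)"
    and lim: "\<And>x. x \<notin> N \<Longrightarrow> (\<lambda>n. g n x) \<longlonglongrightarrow> f x"
    unfolding measurable_on_def by auto
  have "AE x in lebesgue. x \<notin> N"
    using N by (intro AE_not_in) (simp add: negligible_iff_null_sets)
  then have "AE x in lborel. x \<notin> N" by (simp add: AE_completion_iff)
  then have "AE x in lborel. (\<lambda>n. g n x) \<longlonglongrightarrow> f x"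
    by eventually_elim (rule lim)
  with g show ?thesis by (rule that)
qed

lemma bounded_support_AE_limit_of_continuous:
  fixes f :: "'a::euclidean_space \<Rightarrow> complex"
  assumes f: "bounded_support M f"
  obtains G where "\<And>n. continuous_on UNIV (G n)" "\<And>n. bounded_support (M + 1) (G n)"
    "AE x in lborel. (\<lambda>n::nat. G n x) \<longlonglongrightarrow> f x"
proof -
  obtain g where g: "\<And>n. continuous_on UNIV (g n)" and lim: "AE x in lborel. (\<lambda>n::nat. g n x) \<longlonglongrightarrow> f x"
    using borel_measurable_AE_limit_of_continuous[OF bounded_support_measurable[OF f]] by blast
  define clamp where "clamp = closest_point (cball (0::complex) M)"
  define cutoff where "cutoff x = max 0 (min 1 (M + 1 - norm x))" for x :: 'a
  define G where "G n x = of_real (cutoff x) * clamp (g n x)" for n x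
  have "0 \<le> M" using bounded_support_norm_le[OF f] order_trans[OF norm_ge_zero] by blast
  then have clamp: "continuous_on UNIV clamp" "\<And>z. cmod (clamp z) \<le> M" "\<And>z. cmod z \<le> M \<Longrightarrow> clamp z = z"
    using closest_point_in_set[of "cball (0::complex) M"] closest_point_self[of _ "cball (0::complex) M"]
    by (auto simp: clamp_def intro!: continuous_on_closest_point)
  have cutoff: "continuous_on UNIV cutoff" "\<And>x. 0 \<le> cutoff x" "\<And>x. cutoff x \<le> 1"
    by (auto simp: cutoff_def intro!: continuous_intros)
  have G_continuous: "continuous_on UNIV (G n)" for n
    unfolding G_def by (intro continuous_intros cutoff continuous_on_compose2[OF clamp(1) g]) auto
  have "cmod (G n x) \<le> M" for n x
    using mult_mono[OF cutoff(3)[of x] clamp(2)[of "g n x"]] cutoff(2)[of x] by (simp add: G_def norm_mult)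
  then have "bounded_support (M + 1) (G n)" for n
    using borel_measurable_continuous_onI[OF G_continuous]
    by (simp add: bounded_support_def add_increasing2) (simp add: G_def cutoff_def)
  moreover have "AE x in lborel. (\<lambda>n. G n x) \<longlonglongrightarrow> f x"
    using lim
  proof eventually_elim
    case (elim x)
    have "isCont clamp (f x)" using clamp(1) by (simp add: continuous_on_eq_continuous_at)
    then have "(\<lambda>n. G n x) \<longlonglongrightarrow> of_real (cutoff x) * clamp (f x)"
      unfolding G_def by (intro tendsto_intros isCont_tendsto_compose[OF _ elim])
    moreover have "of_real (cutoff x) * clamp (f x) = f x"
      using bounded_support_norm_le[OF f, of x] bounded_support_eq_0[OF f, of x]
      by (cases "norm x \<le> M") (auto simp: clamp(3) cutoff_def)
    ultimately show ?case by simp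
  qed
  ultimately show ?thesis using that G_continuous by blast
qed

lemma bounded_support_diff_sq_le:
  assumes f: "bounded_support M f" and g: "bounded_support M g"
  shows "(cmod (f x - g x))\<^sup>2 \<le> (2 * M)\<^sup>2 * indicator (cball 0 M) x"
proof (cases "norm x \<le> M")
  case True
  have "cmod (f x - g x) \<le> 2 * M"
    using norm_triangle_ineq4[of "f x" "g x"] bounded_support_norm_le[OF f, of x] bounded_support_norm_le[OF g, of x]
    by linarith
  then show ?thesis using True power_mono[of "cmod (f x - g x)" "2 * M" 2] by simp
next
  case False
  then show ?thesis by (simp add: bounded_support_eq_0[OF f] bounded_support_eq_0[OF g])
qed

lemma bounded_support_mono:
  assumes "bounded_support M f" "M \<le> M'"
  shows "bounded_support M' f"
  using assms by (auto simp: bounded_support_def intro: order_trans)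

lemma L2_dense_continuous_bounded_support:
  fixes f :: "real^'d \<Rightarrow> complex"
  assumes f: "sq_int f" and "0 < \<epsilon>"
  obtains M g where "continuous_on UNIV g" "bounded_support M g" "L2_norm (\<lambda>x. f x - g x) < \<epsilon>"
proof -
  obtain M e where e: "bounded_support M e" and f_e: "L2_norm (\<lambda>x. f x - e x) < \<epsilon>/2"
    using L2_dense_bounded_support[OF f half_gt_zero[OF \<open>0 < \<epsilon>\<close>]] by blast
  obtain G where G: "\<And>n. continuous_on UNIV (G n)" "\<And>n. bounded_support (M + 1) (G n)"
    and lim: "AE x in lborel. (\<lambda>n::nat. G n x) \<longlonglongrightarrow> e x"
    using bounded_support_AE_limit_of_continuous[OF e] by blast
  note [measurable] = bounded_support_measurable[OF e] bounded_support_measurable[OF G(2)]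
  have "(\<lambda>n. L2_norm (\<lambda>x. e x - G n x)) \<longlonglongrightarrow> 0"
  proof (rule L2_norm_tendsto_0_dominated)
    show "integrable lborel (\<lambda>x. (2 * (M + 1))\<^sup>2 * indicator (cball (0::real^'d) (M + 1)) x :: real)"
      by (rule integrable_mult_right[OF integrable_indicator_cball])
    show "AE x in lborel. (\<lambda>n. e x - G n x) \<longlonglongrightarrow> 0"
      using lim by eventually_elim (auto intro: tendsto_eq_intros)
  qed (measurable, intro bounded_support_diff_sq_le G bounded_support_mono[OF e], simp)
  from order_tendstoD(2)[OF this half_gt_zero[OF \<open>0 < \<epsilon>\<close>]]
  obtain n where e_G: "L2_norm (\<lambda>x. e x - G n x) < \<epsilon>/2"
    using eventually_happens'[OF sequentially_bot] by blast
  have "L2_norm (\<lambda>x. f x - G n x) < \<epsilon>"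
    using L2_norm_triangle_via[OF f sq_int_bounded_support[OF e] sq_int_bounded_support[OF G(2)], of n] f_e e_G
    by linarith
  with G show ?thesis using that by blast
qed

lemma
  assumes "sq_int f"
  shows sq_int_shift: "sq_int (\<lambda>t. f (t + u))"
    and L2_norm_shift: "L2_norm (\<lambda>t. f (t + u)) = L2_norm f"
proof -
  note [measurable] = sq_int_measurable[OF assms]
  have "(\<lambda>t. f (t + u)) \<in> borel_measurable borel" by measurable
  then show "sq_int (\<lambda>t. f (t + u))" "L2_norm (\<lambda>t. f (t + u)) = L2_norm f"
    using assms integral_lborel_translate[of "\<lambda>t. (cmod (f t))\<^sup>2" u]
    by (simp_all add: sq_int_def L2_norm_def)
qed

definition L2_modulus :: "(real^'d \<Rightarrow> complex) \<Rightarrow> real^'d \<Rightarrow> real" where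
  "L2_modulus f u = L2_norm (\<lambda>t. f (t + u) - f t)"

lemma borel_measurable_L2_modulus [measurable]:
  assumes [measurable]: "f \<in> borel_measurable borel"
  shows "L2_modulus f \<in> borel_measurable borel"
  unfolding L2_modulus_def L2_norm_def by measurable

lemma L2_modulus_nonneg: "0 \<le> L2_modulus f u"
  by (simp add: L2_modulus_def)

lemma L2_modulus_le: "sq_int f \<Longrightarrow> L2_modulus f u \<le> 2 * L2_norm f"
  using L2_norm_triangle_diff[OF sq_int_shift, of f f u] by (simp add: L2_modulus_def L2_norm_shift)

lemma L2_modulus_le_add_diff:
  assumes f: "sq_int f" and g: "sq_int g"
  shows "L2_modulus f u \<le> L2_modulus g u + 2 * L2_norm (\<lambda>t. f t - g t)"
proof -
  let ?d = "\<lambda>t. f t - g t"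
  have d: "sq_int ?d" by (intro sq_int_diff f g)
  have "L2_modulus f u = L2_norm (\<lambda>t. (g (t + u) - g t) + (?d (t + u) - ?d t))"
    by (simp add: L2_modulus_def)
  also have "\<dots> \<le> L2_modulus g u + L2_modulus ?d u"
    unfolding L2_modulus_def by (intro L2_norm_triangle sq_int_diff sq_int_shift f g)
  also have "L2_modulus ?d u \<le> 2 * L2_norm ?d" by (rule L2_modulus_le[OF d])
  finally show ?thesis by simp
qed

lemma L2_modulus_tendsto_0_continuous:
  assumes cont: "continuous_on UNIV g" and g: "bounded_support M g" and u: "u \<longlonglongrightarrow> (0 :: real^'d)"
  shows "(\<lambda>n. L2_modulus g (u n)) \<longlonglongrightarrow> 0"
proof -
  note [measurable] = bounded_support_measurable[OF g]
  obtain K where K: "\<And>n. norm (u n) \<le> K"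
    using u convergent_imp_Bseq[of u] by (auto simp: convergent_def Bseq_def)
  then have "0 \<le> K" using order_trans[OF norm_ge_zero] by blast
  have shifted: "bounded_support (M + K) (\<lambda>x. g (x + u n))" for n
    unfolding bounded_support_def
  proof (intro conjI allI impI)
    show "cmod (g (x + u n)) \<le> M + K" for x
      using bounded_support_norm_le[OF g, of "x + u n"] \<open>0 \<le> K\<close> by linarith
    show "g (x + u n) = 0" if "M + K < norm x" for x
      using that K[of n] norm_triangle_ineq4[of "x + u n" "u n"] by (intro bounded_support_eq_0[OF g]) simp
  qed measurable
  show ?thesis
    unfolding L2_modulus_def
  proof (rule L2_norm_tendsto_0_dominated)
    show "integrable lborel (\<lambda>x. (2 * (M + K))\<^sup>2 * indicator (cball (0::real^'d) (M + K)) x :: real)"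
      by (rule integrable_mult_right[OF integrable_indicator_cball])
    show "AE x in lborel. (\<lambda>n. g (x + u n) - g x) \<longlonglongrightarrow> 0"
    proof (rule AE_I2)
      fix x
      have "(\<lambda>n. g (x + u n)) \<longlonglongrightarrow> g (x + 0)"
        using cont u by (intro isCont_tendsto_compose[of _ g] tendsto_intros) (simp add: continuous_on_eq_continuous_at)
      then show "(\<lambda>n. g (x + u n) - g x) \<longlonglongrightarrow> 0" by (auto intro: tendsto_eq_intros)
    qed
  qed (measurable, use \<open>0 \<le> K\<close> in \<open>intro bounded_support_diff_sq_le[OF shifted bounded_support_mono[OF g]], simp\<close>)
qed

theorem L2_modulus_tendsto_0:
  assumes f: "sq_int f" and u: "u \<longlonglongrightarrow> (0 :: real^'d)"
  shows "(\<lambda>n. L2_modulus f (u n)) \<longlonglongrightarrow> 0"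
proof (rule LIMSEQ_I)
  fix \<epsilon> :: real assume "0 < \<epsilon>"
  then have "0 < \<epsilon>/4" by simp
  then obtain M g where g: "continuous_on UNIV g" "bounded_support M g"
    and f_g: "L2_norm (\<lambda>x. f x - g x) < \<epsilon>/4"
    using L2_dense_continuous_bounded_support[OF f] by blast
  obtain n0 where "\<And>n. n0 \<le> n \<Longrightarrow> L2_modulus g (u n) < \<epsilon>/2"
    using order_tendstoD(2)[OF L2_modulus_tendsto_0_continuous[OF g u], of "\<epsilon>/2"] \<open>0 < \<epsilon>\<close>
    by (auto simp: eventually_sequentially)
  then have "norm (L2_modulus f (u n) - 0) < \<epsilon>" if "n0 \<le> n" for n
    using L2_modulus_le_add_diff[OF f sq_int_bounded_support[OF g(2)], of "u n"] f_g
      L2_modulus_nonneg[of f "u n"] that by fastforce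
  then show "\<exists>n0. \<forall>n\<ge>n0. norm (L2_modulus f (u n) - 0) < \<epsilon>" by blast
qed

lemma L2_modulus_sq_le: "sq_int f \<Longrightarrow> (L2_modulus f u)\<^sup>2 \<le> (2 * L2_norm f)\<^sup>2"
  by (intro power_mono L2_modulus_le L2_modulus_nonneg)

lemma nn_integral_L2_modulus:
  "sq_int f \<Longrightarrow> (\<integral>\<^sup>+x. ennreal ((cmod (f (x + u) - f x))\<^sup>2) \<partial>lborel) = ennreal ((L2_modulus f u)\<^sup>2)"
  unfolding L2_modulus_def by (intro nn_integral_norm_sq sq_int_diff sq_int_shift)

lemma nn_integral_weighted_L2_modulus:
  assumes f: "sq_int f" and [measurable]: "k \<in> borel_measurable borel"
  shows "(\<integral>\<^sup>+x. (\<integral>\<^sup>+u. ennreal ((cmod (f (x + u) - f x))\<^sup>2) * k u \<partial>lborel) \<partial>lborel)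
    = (\<integral>\<^sup>+u. ennreal ((L2_modulus f u)\<^sup>2) * k u \<partial>lborel)"
proof -
  note [measurable] = sq_int_measurable[OF f]
  have "(\<integral>\<^sup>+x. (\<integral>\<^sup>+u. ennreal ((cmod (f (x + u) - f x))\<^sup>2) * k u \<partial>lborel) \<partial>lborel)
      = (\<integral>\<^sup>+u. (\<integral>\<^sup>+x. ennreal ((cmod (f (x + u) - f x))\<^sup>2) * k u \<partial>lborel) \<partial>lborel)"
    by (rule lborel_pair.Fubini') measurable
  then show ?thesis
    by (simp add: nn_integral_multc nn_integral_L2_modulus[OF f])
qed

lemma integrable_L2_modulus_average:
  assumes f [measurable]: "sq_int f" and k: "integrable lborel k"
    and [measurable]: "T \<in> borel_measurable borel"
  shows "integrable lborel (\<lambda>y::real^'d. k y * (L2_modulus f (T y))\<^sup>2)"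
proof (rule Bochner_Integration.integrable_bound)
  show "integrable lborel (\<lambda>y. (2 * L2_norm f)\<^sup>2 * \<bar>k y\<bar>)" using k by simp
  have [measurable]: "k \<in> borel_measurable borel" using borel_measurable_integrable[OF k] by simp
  show "(\<lambda>y. k y * (L2_modulus f (T y))\<^sup>2) \<in> borel_measurable lborel" by measurable
  show "AE y in lborel. norm (k y * (L2_modulus f (T y))\<^sup>2) \<le> norm ((2 * L2_norm f)\<^sup>2 * \<bar>k y\<bar>)"
    using L2_modulus_sq_le[OF f]
    by (auto simp: abs_mult mult.commute[of _ "\<bar>k _\<bar>"] intro!: mult_left_mono)
qed

lemma L2_modulus_average_tendsto_0:
  assumes f [measurable]: "sq_int f" and k: "integrable lborel k"
    and [measurable]: "\<And>n. T n \<in> borel_measurable borel" and T_lim: "\<And>y. (\<lambda>n. T n y) \<longlonglongrightarrow> 0"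
  shows "(\<lambda>n. LINT y|lborel. k (y::real^'d) * (L2_modulus f (T n y))\<^sup>2) \<longlonglongrightarrow> 0"
proof -
  have [measurable]: "k \<in> borel_measurable borel" using borel_measurable_integrable[OF k] by simp
  have "(\<lambda>n. LINT y|lborel. k y * (L2_modulus f (T n y))\<^sup>2) \<longlonglongrightarrow> (LINT y|(lborel :: (real^'d) measure). 0)"
  proof (rule integral_dominated_convergence)
    show "integrable lborel (\<lambda>y. (2 * L2_norm f)\<^sup>2 * \<bar>k y\<bar>)" using k by simp
    show "AE y in lborel. (\<lambda>n. k y * (L2_modulus f (T n y))\<^sup>2) \<longlonglongrightarrow> 0"
      using L2_modulus_tendsto_0[OF f T_lim] by (auto intro!: AE_I2 tendsto_eq_intros)
    show "AE y in lborel. norm (k y * (L2_modulus f (T n y))\<^sup>2) \<le> (2 * L2_norm f)\<^sup>2 * \<bar>k y\<bar>" for n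
      using L2_modulus_sq_le[OF f]
      by (auto simp: abs_mult mult.commute[of _ "\<bar>k _\<bar>"] intro!: mult_left_mono)
  qed measurable
  then show ?thesis by simp
qed

subsection \<open>Gaussian kernels and mollification\<close>

lemma integral_lborel_prod_vec:
  fixes f :: "'d::finite \<Rightarrow> real \<Rightarrow> 'b::{real_normed_field,banach,second_countable_topology}"
  assumes f: "\<And>i. integrable lborel (f i)"
  shows "integrable lborel (\<lambda>x::real^'d. \<Prod>i\<in>UNIV. f i (x$i))"
    and "(LINT x|lborel. (\<Prod>i\<in>UNIV. f i ((x::real^'d)$i))) = (\<Prod>i\<in>UNIV. LINT t|lborel. f i t)"
proof -
  interpret product_sigma_finite "\<lambda>_::real^'d. lborel :: real measure" ..
  have Basis_eq: "(Basis :: (real^'d) set) = range (\<lambda>i. axis i 1)"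
    by (auto simp: Basis_vec_def)
  have inj_axis: "inj (\<lambda>i. axis i (1::real) :: real^'d)"
    by (auto simp: inj_on_def axis_eq_axis)
  have [measurable]: "f i \<in> borel_measurable borel" for i
    using borel_measurable_integrable[OF f[of i]] by simp
  have prod_Basis: "(\<Prod>i\<in>UNIV. f i (x$i)) = (\<Prod>b\<in>Basis. f (axis_index b) (x \<bullet> b))" for x :: "real^'d"
    unfolding Basis_eq by (subst prod.reindex[OF inj_axis]) (simp add: inner_axis)
  have coordinate: "((\<Sum>b\<in>Basis. y b *\<^sub>R b) :: real^'d) \<bullet> b' = y b'" if "b' \<in> Basis" for y b'
    using that by simp
  have [measurable]: "(\<lambda>y. \<Sum>b\<in>Basis. y b *\<^sub>R b) \<in> Pi\<^sub>M Basis (\<lambda>_. lborel) \<rightarrow>\<^sub>M (borel :: (real^'d) measure)"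
    by measurable
  have [measurable]: "(\<lambda>x::real^'d. \<Prod>b\<in>Basis. f (axis_index b) (x \<bullet> b)) \<in> borel_measurable borel"
    by measurable
  have prod_coordinates: "(\<Prod>b\<in>Basis. f (axis_index b) (((\<Sum>b\<in>Basis. y b *\<^sub>R b) :: real^'d) \<bullet> b))
      = (\<Prod>b\<in>Basis. f (axis_index b) (y b))" for y :: "real^'d \<Rightarrow> real"
    by (intro prod.cong refl) (simp add: coordinate)
  have "integrable (Pi\<^sub>M (Basis :: (real^'d) set) (\<lambda>_. lborel)) (\<lambda>y. \<Prod>b\<in>Basis. f (axis_index b) (y b))"
    by (rule product_integrable_prod) (auto simp: f)
  then show "integrable lborel (\<lambda>x::real^'d. \<Prod>i\<in>UNIV. f i (x$i))"
    unfolding prod_Basis by (subst lborel_eq) (simp add: integrable_distr_eq prod_coordinates)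
  have "(LINT x|lborel. (\<Prod>i\<in>UNIV. f i ((x::real^'d)$i)))
      = (LINT y|Pi\<^sub>M (Basis :: (real^'d) set) (\<lambda>_. lborel). (\<Prod>b\<in>Basis. f (axis_index b) (y b)))"
    unfolding prod_Basis by (subst lborel_eq) (simp add: integral_distr prod_coordinates)
  also have "\<dots> = (\<Prod>b\<in>(Basis :: (real^'d) set). LINT t|lborel. f (axis_index b) t)"
    by (rule product_integral_prod) (auto simp: f)
  also have "\<dots> = (\<Prod>i\<in>UNIV. LINT t|lborel. f i t)"
    unfolding Basis_eq by (subst prod.reindex[OF inj_axis]) simp
  finally show "(LINT x|lborel. (\<Prod>i\<in>UNIV. f i ((x::real^'d)$i))) = (\<Prod>i\<in>UNIV. LINT t|lborel. f i t)" .
qed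

lemma gaussian_integrable:
  assumes "0 < \<sigma>"
  shows "integrable lborel (\<lambda>s::real. exp (- (\<sigma>\<^sup>2 * s\<^sup>2 / 2)))"
proof -
  have "exp (- (\<sigma>\<^sup>2 * s\<^sup>2 / 2)) = (sqrt (2 * pi) / \<sigma>) * normal_density 0 (1/\<sigma>) s" for s
    using assms by (simp add: normal_density_def real_sqrt_mult real_sqrt_divide field_simps power2_eq_square)
  then show ?thesis
    using assms by (simp only:) (intro integrable_mult_right integrable_normal_density, simp)
qed

lemma two_pi_normal_density:
  assumes "0 < \<sigma>"
  shows "2 * pi * normal_density 0 \<sigma> w = sqrt (2 * pi) / \<sigma> * exp (- (w/\<sigma>)\<^sup>2 / 2)"
proof -
  have "sqrt (2 * pi * \<sigma>\<^sup>2) = sqrt (2 * pi) * \<sigma>"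
    using assms by (simp add: real_sqrt_mult)
  then have "2 * pi * (1 / sqrt (2 * pi * \<sigma>\<^sup>2)) = 2 * pi / sqrt (2 * pi) / \<sigma>"
    by (simp only:) simp
  also have "\<dots> = sqrt (2 * pi) / \<sigma>"
    by (simp only: real_div_sqrt pi_ge_zero mult_nonneg_nonneg zero_le_numeral)
  finally have "2 * pi * (1 / sqrt (2 * pi * \<sigma>\<^sup>2)) = sqrt (2 * pi) / \<sigma>" .
  moreover have "normal_density 0 \<sigma> w = 1 / sqrt (2 * pi * \<sigma>\<^sup>2) * exp (- (w/\<sigma>)\<^sup>2 / 2)"
    by (simp add: normal_density_def power_divide)
  ultimately show ?thesis
    by (simp only: mult.assoc[symmetric])
qed

lemma gaussian_fourier:
  assumes "0 < \<sigma>"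
  shows "(LINT s|lborel. cis (- (s * w)) * of_real (exp (- (\<sigma>\<^sup>2 * s\<^sup>2 / 2))))
    = of_real (2 * pi * normal_density 0 \<sigma> w)"
proof -
  let ?I = "(LINT s|lborel. cis (- (s * w)) * of_real (exp (- (\<sigma>\<^sup>2 * s\<^sup>2 / 2))))"
  let ?F = "\<lambda>x. of_real (std_normal_density x) * cis (- (w/\<sigma>) * x)"
  let ?c = "complex_of_real (\<sigma> / sqrt (2*pi))" and ?d = "complex_of_real (sqrt (2*pi) / \<sigma>)"
  have "complex_of_real (exp (- (w/\<sigma>)\<^sup>2 / 2)) = char std_normal_distribution (- (w/\<sigma>))"
    by (simp add: char_std_normal_distribution)
  also have "\<dots> = (LINT x|lborel. ?F x)"
    unfolding char_def by (subst integral_density) (auto simp: cis_conv_exp scaleR_conv_of_real)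
  also have "\<dots> = \<bar>\<sigma>\<bar> *\<^sub>R (LINT s|lborel. ?F (0 + \<sigma> * s))"
    by (rule lborel_integral_real_affine) (use assms in simp)
  also have "(\<lambda>s. ?F (0 + \<sigma> * s))
      = (\<lambda>s. of_real (1 / sqrt (2*pi)) * (cis (- (s * w)) * of_real (exp (- (\<sigma>\<^sup>2 * s\<^sup>2 / 2)))))"
    using assms by (auto simp: std_normal_density_def power_mult_distrib mult_ac)
  finally have "complex_of_real (exp (- (w/\<sigma>)\<^sup>2 / 2)) = ?c * ?I"
    using assms by (simp add: scaleR_conv_of_real)
  then have "?d * of_real (exp (- (w/\<sigma>)\<^sup>2 / 2)) = (?d * ?c) * ?I"
    by (simp only: mult.assoc)
  also have "?d * ?c = 1"
    using assms unfolding of_real_mult[symmetric] by simp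
  finally show ?thesis
    by (simp only: two_pi_normal_density[OF assms] of_real_mult mult_1)
qed

definition gauss_weight :: "real \<Rightarrow> real^'d \<Rightarrow> real" where
  "gauss_weight \<sigma> s = (\<Prod>i\<in>UNIV. exp (- (\<sigma>\<^sup>2 * (s$i)\<^sup>2 / 2)))"

definition gauss_kernel :: "real \<Rightarrow> real^'d \<Rightarrow> real" where
  "gauss_kernel \<sigma> x = (\<Prod>i\<in>UNIV. normal_density 0 \<sigma> (x$i))"

lemma gauss_weight_measurable [measurable]: "gauss_weight \<sigma> \<in> borel_measurable borel"
  unfolding gauss_weight_def by measurable

lemma gauss_kernel_measurable [measurable]: "gauss_kernel \<sigma> \<in> borel_measurable borel"
  unfolding gauss_kernel_def by measurable

lemma gauss_weight_bounds: "0 \<le> gauss_weight \<sigma> s" "gauss_weight \<sigma> s \<le> 1"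
  unfolding gauss_weight_def by (auto intro!: prod_nonneg prod_le_1)

lemma gauss_kernel_nonneg: "0 \<le> gauss_kernel \<sigma> x"
  unfolding gauss_kernel_def by (intro prod_nonneg) auto

lemma gauss_weight_integrable: "0 < \<sigma> \<Longrightarrow> integrable lborel (gauss_weight \<sigma> :: real^'d \<Rightarrow> real)"
  unfolding gauss_weight_def by (intro integral_lborel_prod_vec gaussian_integrable)

lemma gauss_kernel_integrable: "0 < \<sigma> \<Longrightarrow> integrable lborel (gauss_kernel \<sigma> :: real^'d \<Rightarrow> real)"
  unfolding gauss_kernel_def by (intro integral_lborel_prod_vec) auto

lemma gauss_kernel_integral:
  assumes "0 < \<sigma>"
  shows "(LINT x|lborel. gauss_kernel \<sigma> (x::real^'d)) = 1"
  unfolding gauss_kernel_def using assms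
  by (subst integral_lborel_prod_vec) (auto simp: integral_normal_density)

lemma gauss_kernel_le:
  fixes x :: "real^'d"
  shows "0 < \<sigma> \<Longrightarrow> gauss_kernel \<sigma> x \<le> gauss_kernel \<sigma> (0::real^'d)"
  unfolding gauss_kernel_def by (intro prod_mono) (auto simp: normal_density_def divide_right_mono)

lemma nn_integral_gauss_kernel:
  assumes "0 < \<sigma>"
  shows "(\<integral>\<^sup>+x. ennreal (gauss_kernel \<sigma> (x::real^'d)) \<partial>lborel) = 1"
  using nn_integral_eq_integral[OF gauss_kernel_integrable[OF assms, where 'd='d]]
  by (simp add: gauss_kernel_nonneg gauss_kernel_integral[OF assms])

lemma nn_integral_gauss_kernel_rescale:
  fixes F :: "real^'d \<Rightarrow> ennreal"
  assumes "0 < \<sigma>" and [measurable]: "F \<in> borel_measurable borel"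
  shows "(\<integral>\<^sup>+w. F w * ennreal (gauss_kernel \<sigma> w) \<partial>lborel) = (\<integral>\<^sup>+y. F (\<sigma> *\<^sub>R y) * ennreal (gauss_kernel 1 y) \<partial>lborel)"
proof -
  have "\<sigma> * normal_density 0 \<sigma> (\<sigma> * t) = normal_density 0 1 t" for t
    using assms(1) by (simp add: normal_density_def real_sqrt_mult power_mult_distrib)
  then have scale: "\<sigma> ^ CARD('d) * gauss_kernel \<sigma> (\<sigma> *\<^sub>R y) = gauss_kernel 1 y" for y :: "real^'d"
    by (simp add: gauss_kernel_def prod.distrib[symmetric] flip: prod_constant)
  have "(\<integral>\<^sup>+w. F w * ennreal (gauss_kernel \<sigma> w) \<partial>lborel)
      = (\<integral>\<^sup>+y. ennreal (\<sigma> ^ CARD('d)) * (F (\<sigma> *\<^sub>R y) * ennreal (gauss_kernel \<sigma> (\<sigma> *\<^sub>R y))) \<partial>lborel)"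
    using assms(1) by (subst lborel_affine[of \<sigma> 0]) (simp_all add: nn_integral_density nn_integral_distr)
  also have "\<dots> = (\<integral>\<^sup>+y. F (\<sigma> *\<^sub>R y) * ennreal (gauss_kernel 1 y) \<partial>lborel)"
    using assms(1) by (simp add: scale[symmetric] ennreal_mult gauss_kernel_nonneg mult_ac)
  finally show ?thesis .
qed

lemma norm_weighted_integral_sq_le:
  fixes g :: "'a \<Rightarrow> 'b::{banach, second_countable_topology}"
  assumes [measurable]: "g \<in> borel_measurable M" "k \<in> borel_measurable M"
    and k: "\<And>x. 0 \<le> k x" "(\<integral>\<^sup>+x. ennreal (k x) \<partial>M) = 1"
  shows "ennreal ((norm (LINT x|M. k x *\<^sub>R g x))\<^sup>2) \<le> (\<integral>\<^sup>+x. ennreal ((norm (g x))\<^sup>2) * ennreal (k x) \<partial>M)"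
proof -
  let ?g = "\<lambda>x. ennreal (norm (g x) * sqrt (k x))" and ?k = "\<lambda>x. ennreal (sqrt (k x))"
  have "ennreal (norm (LINT x|M. k x *\<^sub>R g x)) \<le> (\<integral>\<^sup>+x. ennreal (norm (k x *\<^sub>R g x)) \<partial>M)"
  proof (cases "integrable M (\<lambda>x. k x *\<^sub>R g x)")
    case True then show ?thesis by (rule integral_norm_bound_ennreal)
  qed (simp add: not_integrable_integral_eq)
  also have "\<dots> = (\<integral>\<^sup>+x. ?g x * ?k x \<partial>M)"
    using k(1) by (intro nn_integral_cong) (simp add: ennreal_mult[symmetric] mult.assoc)
  finally have "(ennreal (norm (LINT x|M. k x *\<^sub>R g x)))\<^sup>2 \<le> (\<integral>\<^sup>+x. ?g x * ?k x \<partial>M)\<^sup>2"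
    by (rule power_mono) simp
  also have "\<dots> \<le> (\<integral>\<^sup>+x. (?g x)\<^sup>2 \<partial>M) * (\<integral>\<^sup>+x. (?k x)\<^sup>2 \<partial>M)"
    by (rule Cauchy_Schwarz_nn_integral) measurable
  also have "(\<integral>\<^sup>+x. (?k x)\<^sup>2 \<partial>M) = 1"
    using k by (simp add: ennreal_power)
  finally show ?thesis
    using k(1) by (simp add: ennreal_power power_mult_distrib ennreal_mult)
qed

definition mollify :: "real \<Rightarrow> (real^'d \<Rightarrow> complex) \<Rightarrow> real^'d \<Rightarrow> complex" where
  "mollify \<sigma> f x = (LINT w|lborel. gauss_kernel \<sigma> w *\<^sub>R f (x + w))"

lemma mollify_measurable [measurable]:
  assumes [measurable]: "f \<in> borel_measurable borel"
  shows "mollify \<sigma> f \<in> borel_measurable borel"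
  unfolding mollify_def by measurable

lemma integrable_gauss_kernel_shift:
  fixes f :: "real^'d \<Rightarrow> complex"
  assumes "0 < \<sigma>" and f: "integrable lborel f"
  shows "integrable lborel (\<lambda>w. gauss_kernel \<sigma> w *\<^sub>R f (x + w))"
proof (rule Bochner_Integration.integrable_bound)
  have [measurable]: "f \<in> borel_measurable borel" using borel_measurable_integrable[OF f] by simp
  have "integrable lborel (\<lambda>w. f (x + w))"
    using integral_lborel_translate(2)[of f x] f by (simp add: add.commute)
  then show "integrable lborel (\<lambda>w. gauss_kernel \<sigma> (0::real^'d) *\<^sub>R f (x + w))" by simp
  show "(\<lambda>w. gauss_kernel \<sigma> w *\<^sub>R f (x + w)) \<in> borel_measurable lborel" by measurable
  show "AE w in lborel. norm (gauss_kernel \<sigma> w *\<^sub>R f (x + w)) \<le> norm (gauss_kernel \<sigma> (0::real^'d) *\<^sub>R f (x + w))"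
    using gauss_kernel_le[OF \<open>0 < \<sigma>\<close>, where 'd='d] by (auto simp: gauss_kernel_nonneg intro!: AE_I2 mult_right_mono)
qed

lemma
  fixes f :: "real^'d \<Rightarrow> complex"
  assumes f: "sq_int f" and \<sigma>: "0 < \<sigma>"
  shows sq_int_mollify: "sq_int (mollify \<sigma> f)"
    and L2_norm_mollify_le: "L2_norm (mollify \<sigma> f) \<le> L2_norm f"
proof -
  note [measurable] = sq_int_measurable[OF f]
  have "(\<integral>\<^sup>+x. ennreal ((cmod (mollify \<sigma> f x))\<^sup>2) \<partial>lborel)
      \<le> (\<integral>\<^sup>+x. (\<integral>\<^sup>+w. ennreal ((cmod (f (x + w)))\<^sup>2) * ennreal (gauss_kernel \<sigma> w) \<partial>lborel) \<partial>lborel)"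
    unfolding mollify_def
    by (intro nn_integral_mono norm_weighted_integral_sq_le)
       (simp_all add: gauss_kernel_nonneg nn_integral_gauss_kernel[OF \<sigma>])
  also have "\<dots> = (\<integral>\<^sup>+w. (\<integral>\<^sup>+x. ennreal ((cmod (f (x + w)))\<^sup>2) * ennreal (gauss_kernel \<sigma> w) \<partial>lborel) \<partial>lborel)"
    by (rule lborel_pair.Fubini') measurable
  also have "\<dots> = (\<integral>\<^sup>+w. ennreal ((L2_norm f)\<^sup>2) * ennreal (gauss_kernel \<sigma> (w::real^'d)) \<partial>lborel)"
    by (simp add: nn_integral_multc nn_integral_norm_sq[OF sq_int_shift[OF f]] L2_norm_shift[OF f])
  also have "\<dots> = ennreal ((L2_norm f)\<^sup>2)"
    by (simp add: nn_integral_cmult nn_integral_gauss_kernel[OF \<sigma>])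
  finally have bound: "(\<integral>\<^sup>+x. ennreal ((cmod (mollify \<sigma> f x))\<^sup>2) \<partial>lborel) \<le> ennreal ((L2_norm f)\<^sup>2)" .
  note nn_integral_norm_sq_le_imp[OF _ bound zero_le_power2]
  then show "sq_int (mollify \<sigma> f)" "L2_norm (mollify \<sigma> f) \<le> L2_norm f"
    by (auto intro: power2_le_imp_le)
qed

lemma mollify_diff_le:
  fixes f :: "real^'d \<Rightarrow> complex"
  assumes f: "integrable lborel f" "sq_int f" and \<sigma>: "0 < \<sigma>"
  shows "(L2_norm (\<lambda>x. mollify \<sigma> f x - f x))\<^sup>2 \<le> (LINT y|lborel. gauss_kernel 1 y * (L2_modulus f (\<sigma> *\<^sub>R y))\<^sup>2)"
proof -
  note [measurable] = sq_int_measurable[OF f(2)]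
  have average: "integrable lborel (\<lambda>y::real^'d. gauss_kernel 1 y * (L2_modulus f (\<sigma> *\<^sub>R y))\<^sup>2)"
    by (intro integrable_L2_modulus_average f gauss_kernel_integrable) simp_all
  have diff: "mollify \<sigma> f x - f x = (LINT w|lborel. gauss_kernel \<sigma> w *\<^sub>R (f (x + w) - f x))" for x
    using integrable_gauss_kernel_shift[OF \<sigma> f(1), of x] gauss_kernel_integrable[OF \<sigma>, where 'd='d]
    by (simp add: mollify_def scaleR_diff_right gauss_kernel_integral[OF \<sigma>])
  have "(\<integral>\<^sup>+x. ennreal ((cmod (mollify \<sigma> f x - f x))\<^sup>2) \<partial>lborel)
      \<le> (\<integral>\<^sup>+x. (\<integral>\<^sup>+w. ennreal ((cmod (f (x + w) - f x))\<^sup>2) * ennreal (gauss_kernel \<sigma> w) \<partial>lborel) \<partial>lborel)"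
    unfolding diff
    by (intro nn_integral_mono norm_weighted_integral_sq_le)
       (simp_all add: gauss_kernel_nonneg nn_integral_gauss_kernel[OF \<sigma>])
  also have "\<dots> = (\<integral>\<^sup>+w. ennreal ((L2_modulus f w)\<^sup>2) * ennreal (gauss_kernel \<sigma> w) \<partial>lborel)"
    by (rule nn_integral_weighted_L2_modulus[OF f(2)]) measurable
  also have "\<dots> = (\<integral>\<^sup>+y. ennreal (gauss_kernel 1 y * (L2_modulus f (\<sigma> *\<^sub>R y))\<^sup>2) \<partial>lborel)"
    by (subst nn_integral_gauss_kernel_rescale[OF \<sigma>])
       (simp_all add: ennreal_mult gauss_kernel_nonneg mult.commute)
  also have "\<dots> = ennreal (LINT y|lborel. gauss_kernel 1 y * (L2_modulus f (\<sigma> *\<^sub>R y))\<^sup>2)"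
    by (rule nn_integral_eq_integral[OF average]) (simp add: gauss_kernel_nonneg)
  finally show ?thesis
    by (rule nn_integral_norm_sq_le_imp(2)[rotated]) (simp_all add: gauss_kernel_nonneg)
qed

lemma mollify_tendsto:
  assumes f: "integrable lborel f" "sq_int f" and \<sigma>: "\<And>n. 0 < \<sigma> n" "\<sigma> \<longlonglongrightarrow> 0"
  shows "(\<lambda>n. L2_norm (\<lambda>x. mollify (\<sigma> n) f x - f x)) \<longlonglongrightarrow> 0"
proof -
  have "(\<lambda>n. LINT y|lborel. gauss_kernel 1 y * (L2_modulus f (\<sigma> n *\<^sub>R y))\<^sup>2) \<longlonglongrightarrow> 0"
    using tendsto_scaleR[OF \<sigma>(2) tendsto_const]
    by (intro L2_modulus_average_tendsto_0 f gauss_kernel_integrable) simp_all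
  then have "(\<lambda>n. (L2_norm (\<lambda>x. mollify (\<sigma> n) f x - f x))\<^sup>2) \<longlonglongrightarrow> 0"
    by (rule Lim_null_comparison[rotated]) (simp add: mollify_diff_le[OF f \<sigma>(1)])
  then have "(\<lambda>n. sqrt ((L2_norm (\<lambda>x. mollify (\<sigma> n) f x - f x))\<^sup>2)) \<longlonglongrightarrow> sqrt 0"
    by (rule tendsto_real_sqrt)
  then show ?thesis by simp
qed

subsection \<open>The Fourier transform\<close>

lemma cis_sum: "cis (\<Sum>i\<in>I. f i) = (\<Prod>i\<in>I. cis (f i))"
  by (induction I rule: infinite_finite_induct) (auto simp: cis_mult[symmetric])

lemma gauss_weight_fourier:
  fixes w :: "real^'d"
  assumes "0 < \<sigma>"
  shows "(LINT s|lborel. cis (- (s \<bullet> w)) * of_real (gauss_weight \<sigma> s))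
    = of_real ((2 * pi) ^ CARD('d) * gauss_kernel \<sigma> w)"
proof -
  have integrable: "integrable lborel (\<lambda>s. cis (- (s * t)) * of_real (exp (- (\<sigma>\<^sup>2 * s\<^sup>2 / 2))))" for t :: real
    by (rule Bochner_Integration.integrable_bound[OF gaussian_integrable[OF assms]])
       (auto simp: norm_mult cis_conv_exp)
  have "cis (- (s \<bullet> w)) * of_real (gauss_weight \<sigma> s)
      = (\<Prod>i\<in>UNIV. cis (- (s$i * w$i)) * of_real (exp (- (\<sigma>\<^sup>2 * (s$i)\<^sup>2 / 2))))" for s :: "real^'d"
    by (simp add: inner_vec_def gauss_weight_def prod.distrib cis_sum sum_negf[symmetric])
  then have "(LINT s|lborel. cis (- (s \<bullet> w)) * of_real (gauss_weight \<sigma> s))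
      = (\<Prod>i\<in>UNIV. LINT t|lborel. cis (- (t * w$i)) * of_real (exp (- (\<sigma>\<^sup>2 * t\<^sup>2 / 2))))"
    using integral_lborel_prod_vec(2)[of "\<lambda>i t. cis (- (t * w$i)) * of_real (exp (- (\<sigma>\<^sup>2 * t\<^sup>2 / 2)))", OF integrable]
    by simp
  also have "\<dots> = of_real ((2 * pi) ^ CARD('d) * gauss_kernel \<sigma> w)"
    by (simp only: gaussian_fourier[OF assms]) (simp add: gauss_kernel_def prod.distrib)
  finally show ?thesis .
qed

lemma integrable_pair_bound:
  fixes F :: "'a::euclidean_space \<times> 'b::euclidean_space \<Rightarrow> complex"
  assumes F [measurable]: "F \<in> borel_measurable (lborel \<Otimes>\<^sub>M lborel)"
    and f: "integrable lborel (f :: 'a \<Rightarrow> real)" and g: "integrable lborel (g :: 'b \<Rightarrow> real)"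
    and bound: "\<And>x y. cmod (F (x, y)) \<le> f x * g y"
  shows "integrable (lborel \<Otimes>\<^sub>M lborel) F"
proof -
  have [measurable]: "f \<in> borel_measurable borel" "g \<in> borel_measurable borel"
    using borel_measurable_integrable[OF f] borel_measurable_integrable[OF g] by simp_all
  have "integrable (lborel \<Otimes>\<^sub>M lborel) (\<lambda>(x, y). f x * g y)"
  proof (rule lborel_pair.Fubini_integrable)
    show "integrable lborel (\<lambda>x. LINT y|lborel. norm (case (x, y) of (x, y) \<Rightarrow> f x * g y))"
      using f g by (simp add: abs_mult)
    show "AE x in lborel. integrable lborel (\<lambda>y. case (x, y) of (x, y) \<Rightarrow> f x * g y)"
      using g by simp
  qed measurable
  then show ?thesis
  proof (rule Bochner_Integration.integrable_bound)
    show "AE p in lborel \<Otimes>\<^sub>M lborel. norm (F p) \<le> norm (case p of (x, y) \<Rightarrow> f x * g y)"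
      using bound by (auto intro!: AE_I2 order_trans[OF bound abs_ge_self])
  qed measurable
qed

lemma fourier1_measurable [measurable]:
  fixes u :: "real^'d \<Rightarrow> complex"
  assumes [measurable]: "u \<in> borel_measurable borel"
  shows "fourier1 u \<in> borel_measurable borel"
  unfolding fourier1_def by measurable

lemma integrable_cis_mult:
  fixes u :: "'a::euclidean_space \<Rightarrow> complex"
  assumes u: "integrable lborel u" and [measurable]: "f \<in> borel_measurable borel"
  shows "integrable lborel (\<lambda>t. cis (f t) * u t)"
proof -
  have [measurable]: "u \<in> borel_measurable borel"
    using borel_measurable_integrable[OF u] by simp
  show ?thesis
    by (rule Bochner_Integration.integrable_bound[OF u]) (auto simp: norm_mult)
qed

lemma fourier1_bound:
  fixes u :: "real^'d \<Rightarrow> complex"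
  assumes "integrable lborel u"
  shows "cmod (fourier1 u s) \<le> (2*pi) powr (- real CARD('d) / 2) * (LINT t|lborel. cmod (u t))"
proof -
  have "cmod (LINT t|lborel. cis (- (s \<bullet> t)) * u t) \<le> (LINT t|lborel. cmod (cis (- (s \<bullet> t)) * u t))"
    by (rule integral_norm_bound)
  then show ?thesis by (simp add: fourier1_def norm_mult mult_left_mono)
qed

lemma fourier1_tendsto:
  fixes u :: "real^'d \<Rightarrow> complex"
  assumes u: "integrable lborel u" and "s \<longlonglongrightarrow> s0"
  shows "(\<lambda>n. fourier1 u (s n)) \<longlonglongrightarrow> fourier1 u s0"
proof -
  have "(\<lambda>n. LINT t|lborel. cis (- (s n \<bullet> t)) * u t) \<longlonglongrightarrow> (LINT t|lborel. cis (- (s0 \<bullet> t)) * u t)"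
  proof (rule integral_dominated_convergence)
    show "integrable lborel (\<lambda>t. cmod (u t))" using u by simp
    show "AE t in lborel. (\<lambda>n. cis (- (s n \<bullet> t)) * u t) \<longlonglongrightarrow> cis (- (s0 \<bullet> t)) * u t"
      by (intro AE_I2 tendsto_intros assms)
    have [measurable]: "u \<in> borel_measurable borel" using borel_measurable_integrable[OF u] by simp
    show "(\<lambda>t. cis (- (s0 \<bullet> t)) * u t) \<in> borel_measurable lborel"
      "(\<lambda>t. cis (- (s n \<bullet> t)) * u t) \<in> borel_measurable lborel" for n
      by measurable
  qed (simp add: norm_mult)
  then show ?thesis
    unfolding fourier1_def by (rule tendsto_mult[OF tendsto_const])
qed

lemma fourier1_multiplication:
  fixes u v :: "real^'d \<Rightarrow> complex"
  assumes u: "integrable lborel u" and v: "integrable lborel v"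
  shows "(LINT s|lborel. fourier1 u s * v s) = (LINT t|lborel. u t * fourier1 v t)"
proof -
  define c where "c = complex_of_real ((2*pi) powr (- real CARD('d) / 2))"
  have [measurable]: "u \<in> borel_measurable borel" "v \<in> borel_measurable borel"
    using borel_measurable_integrable[OF u] borel_measurable_integrable[OF v] by simp_all
  have integrable: "integrable (lborel \<Otimes>\<^sub>M lborel) (\<lambda>(t, s). cis (- (s \<bullet> t)) * u t * v s)"
    by (rule integrable_pair_bound[OF _ integrable_norm[OF u] integrable_norm[OF v]])
       (auto simp: norm_mult)
  have "(LINT s|lborel. fourier1 u s * v s) = (LINT s|lborel. c * (LINT t|lborel. cis (- (s \<bullet> t)) * u t * v s))"
  proof (rule Bochner_Integration.integral_cong[OF refl])
    fix s
    show "fourier1 u s * v s = c * (LINT t|lborel. cis (- (s \<bullet> t)) * u t * v s)"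
      unfolding fourier1_def c_def by (subst integral_mult_left_zero) (simp add: mult.assoc)
  qed
  also have "\<dots> = c * (LINT s|lborel. (LINT t|lborel. cis (- (s \<bullet> t)) * u t * v s))"
    by (rule integral_mult_right_zero)
  also have "\<dots> = c * (LINT t|lborel. (LINT s|lborel. cis (- (s \<bullet> t)) * u t * v s))"
    by (subst lborel_pair.Fubini_integral[OF integrable]) simp
  also have "\<dots> = (LINT t|lborel. c * (LINT s|lborel. cis (- (s \<bullet> t)) * u t * v s))"
    by (rule integral_mult_right_zero[symmetric])
  also have "\<dots> = (LINT t|lborel. u t * fourier1 v t)"
  proof (rule Bochner_Integration.integral_cong[OF refl])
    fix t
    have "(LINT s|lborel. cis (- (s \<bullet> t)) * u t * v s) = u t * (LINT s|lborel. cis (- (t \<bullet> s)) * v s)"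
      by (subst integral_mult_right_zero[symmetric]) (simp add: mult_ac inner_commute)
    then show "c * (LINT s|lborel. cis (- (s \<bullet> t)) * u t * v s) = u t * fourier1 v t"
      by (simp add: fourier1_def c_def mult_ac)
  qed
  finally show ?thesis .
qed

lemma fourier1_gauss_modulated:
  fixes x y :: "real^'d"
  assumes "0 < \<sigma>"
  shows "fourier1 (\<lambda>s. cis (s \<bullet> x) * of_real (gauss_weight \<sigma> s)) y
    = of_real ((2*pi) powr (real CARD('d) / 2) * gauss_kernel \<sigma> (y - x))"
proof -
  have "cis (- (y \<bullet> s)) * (cis (s \<bullet> x) * of_real (gauss_weight \<sigma> s))
      = cis (- (s \<bullet> (y - x))) * of_real (gauss_weight \<sigma> s)" for s
    by (simp add: mult.assoc[symmetric] cis_mult inner_diff_right inner_commute)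
  then have "fourier1 (\<lambda>s. cis (s \<bullet> x) * of_real (gauss_weight \<sigma> s)) y
      = of_real ((2*pi) powr (- real CARD('d) / 2) * (2 * pi) ^ CARD('d) * gauss_kernel \<sigma> (y - x))"
    by (simp only: fourier1_def gauss_weight_fourier[OF assms]) simp
  also have "(2*pi) powr (- real CARD('d) / 2) * (2 * pi) ^ CARD('d) = (2*pi) powr (real CARD('d) / 2)"
    by (subst powr_realpow[symmetric]) (auto simp: powr_add[symmetric])
  finally show ?thesis .
qed

lemma
  fixes u :: "real^'d \<Rightarrow> complex"
  assumes u: "integrable lborel u" and \<sigma>: "0 < \<sigma>"
  shows fourier1_gauss_weight_integrable: "integrable lborel (\<lambda>s. fourier1 u s * of_real (gauss_weight \<sigma> s))"
    and fourier1_gauss_weight_sq_int: "sq_int (\<lambda>s. fourier1 u s * of_real (gauss_weight \<sigma> s))"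
proof -
  define B where "B = (2*pi) powr (- real CARD('d) / 2) * (LINT t|lborel. cmod (u t))"
  have [measurable]: "u \<in> borel_measurable borel" using borel_measurable_integrable[OF u] by simp
  have bound: "cmod (fourier1 u s * of_real (gauss_weight \<sigma> s)) \<le> B * gauss_weight \<sigma> s" for s
    using mult_right_mono[OF fourier1_bound[OF u], of "gauss_weight \<sigma> s" s]
    by (simp add: norm_mult gauss_weight_bounds B_def)
  note gauss = gauss_weight_integrable[OF \<sigma>, where 'd='d]
  show "integrable lborel (\<lambda>s. fourier1 u s * of_real (gauss_weight \<sigma> s))"
    by (rule Bochner_Integration.integrable_bound[OF integrable_mult_right[of B, OF gauss]])
       (auto intro!: AE_I2 order_trans[OF bound abs_ge_self])
  show "sq_int (\<lambda>s. fourier1 u s * of_real (gauss_weight \<sigma> s))"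
  proof (rule sq_int_bound[OF integrable_mult_right[of "B\<^sup>2", OF gauss]])
    fix s
    have "(cmod (fourier1 u s * of_real (gauss_weight \<sigma> s)))\<^sup>2 \<le> (B * gauss_weight \<sigma> s)\<^sup>2"
      by (intro power_mono bound) simp
    also have "\<dots> \<le> B\<^sup>2 * gauss_weight \<sigma> s"
      using gauss_weight_bounds[of \<sigma> s]
      by (simp add: power_mult_distrib power2_eq_square[of "gauss_weight _ _"] mult_left_mono mult_left_le)
    finally show "(cmod (fourier1 u s * of_real (gauss_weight \<sigma> s)))\<^sup>2 \<le> B\<^sup>2 * gauss_weight \<sigma> s" .
  qed simp
qed

text \<open>The conjugations turn the inner Fourier transform into its inverse.\<close>

lemma mollify_eq_fourier1:
  fixes e :: "real^'d \<Rightarrow> complex"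
  assumes e: "integrable lborel e" and \<sigma>: "0 < \<sigma>"
  shows "fourier1 (\<lambda>s. cnj (fourier1 (\<lambda>y. cnj (e y)) s) * of_real (gauss_weight \<sigma> s)) = mollify \<sigma> e"
proof
  fix x :: "real^'d"
  let ?c = "complex_of_real ((2*pi) powr (- real CARD('d) / 2))"
  let ?d = "complex_of_real ((2*pi) powr (real CARD('d) / 2))"
  let ?v = "\<lambda>s. cis (s \<bullet> x) * of_real (gauss_weight \<sigma> s)"
  have [measurable]: "e \<in> borel_measurable borel" using borel_measurable_integrable[OF e] by simp
  have constants: "?c * ?d = 1"
    unfolding of_real_mult[symmetric] powr_add[symmetric] by simp
  have v: "integrable lborel ?v"
    by (intro integrable_cis_mult integrable_of_real gauss_weight_integrable \<sigma>) simp
  have "fourier1 (\<lambda>s. cnj (fourier1 (\<lambda>y. cnj (e y)) s) * of_real (gauss_weight \<sigma> s)) x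
      = ?c * cnj (LINT s|lborel. fourier1 (\<lambda>y. cnj (e y)) s * ?v s)"
    by (simp add: fourier1_def[of _ x] Bochner_Integration.integral_cnj[symmetric] cis_cnj inner_commute mult_ac
        del: Bochner_Integration.integral_cnj)
  also have "\<dots> = ?c * cnj (LINT y|lborel. cnj (e y) * fourier1 ?v y)"
    by (subst fourier1_multiplication[OF integrable_cnj[OF e] v]) simp
  also have "\<dots> = ?c * (LINT y|lborel. ?d * (gauss_kernel \<sigma> (y - x) *\<^sub>R e y))"
    by (simp add: fourier1_gauss_modulated[OF \<sigma>] Bochner_Integration.integral_cnj[symmetric] scaleR_conv_of_real mult_ac
        del: Bochner_Integration.integral_cnj integral_mult_right_zero)
  also have "\<dots> = (LINT y|lborel. gauss_kernel \<sigma> (y - x) *\<^sub>R e y)"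
    by (simp only: integral_mult_right_zero mult.assoc[symmetric] constants mult_1)
  also have "\<dots> = mollify \<sigma> e x"
    unfolding mollify_def
    by (subst integral_lborel_translate(1)[of _ x, symmetric]) (simp_all add: add.commute)
  finally show "fourier1 (\<lambda>s. cnj (fourier1 (\<lambda>y. cnj (e y)) s) * of_real (gauss_weight \<sigma> s)) x = mollify \<sigma> e x" .
qed

lemma fourier1_weighted_norm_le:
  fixes u :: "real^'d \<Rightarrow> complex"
  assumes u: "integrable lborel u" "sq_int u" and \<sigma>: "0 < \<sigma>"
  shows "(\<integral>\<^sup>+s. ennreal ((cmod (fourier1 u s))\<^sup>2 * gauss_weight \<sigma> s) \<partial>lborel) \<le> ennreal ((L2_norm u)\<^sup>2)"
proof -
  let ?I = "LINT s|lborel. (cmod (fourier1 u s))\<^sup>2 * gauss_weight \<sigma> s"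
  let ?\<theta> = "\<lambda>s. cnj (fourier1 u s) * of_real (gauss_weight \<sigma> s)"
  let ?v = "mollify \<sigma> (\<lambda>y. cnj (u y))"
  note [measurable] = sq_int_measurable[OF u(2)]
  have v: "sq_int ?v" "L2_norm ?v \<le> L2_norm u"
    using sq_int_mollify[OF sq_int_cnj[OF u(2)] \<sigma>] L2_norm_mollify_le[OF sq_int_cnj[OF u(2)] \<sigma>]
    by (simp_all add: L2_norm_cnj)
  have integrand: "fourier1 u s * ?\<theta> s = of_real ((cmod (fourier1 u s))\<^sup>2 * gauss_weight \<sigma> s)" for s
    by (simp add: complex_norm_square del: of_real_power)
  have \<theta>: "integrable lborel ?\<theta>"
    using integrable_cnj[OF fourier1_gauss_weight_integrable[OF u(1) \<sigma>]] by simp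
  have "complex_of_real ?I = (LINT s|lborel. fourier1 u s * ?\<theta> s)"
    unfolding integrand by (rule integral_complex_of_real[symmetric])
  also have "\<dots> = L2_inner u (\<lambda>t. cnj (?v t))"
    unfolding fourier1_multiplication[OF u(1) \<theta>]
    using mollify_eq_fourier1[OF integrable_cnj[OF u(1)] \<sigma>] by (simp add: L2_inner_def)
  finally have "\<bar>?I\<bar> \<le> L2_norm u * L2_norm ?v"
    using L2_Cauchy_Schwarz[OF u(2) sq_int_cnj[OF v(1)]] by (metis L2_norm_cnj norm_of_real)
  also have "\<dots> \<le> (L2_norm u)\<^sup>2"
    unfolding power2_eq_square by (intro mult_left_mono v) simp
  finally have "ennreal ?I \<le> ennreal ((L2_norm u)\<^sup>2)"
    by (intro ennreal_leI) simp
  moreover have "integrable lborel (\<lambda>s. (cmod (fourier1 u s))\<^sup>2 * gauss_weight \<sigma> s)"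
  proof (rule Bochner_Integration.integrable_bound)
    let ?C = "(2*pi) powr (- real CARD('d) / 2) * (LINT t|lborel. cmod (u t))"
    show "integrable lborel (\<lambda>s. ?C * cmod (?\<theta> s))" using \<theta> by simp
    show "AE s in lborel. norm ((cmod (fourier1 u s))\<^sup>2 * gauss_weight \<sigma> s) \<le> norm (?C * cmod (?\<theta> s))"
      using fourier1_bound[OF u(1)]
      by (auto simp: norm_mult gauss_weight_bounds power2_eq_square mult.assoc[symmetric]
          intro!: AE_I2 mult_right_mono order_trans[OF _ abs_ge_self])
  qed measurable
  ultimately show ?thesis
    by (subst nn_integral_eq_integral) (simp_all add: gauss_weight_bounds)
qed

lemma fourier1_sq_int:
  fixes u :: "real^'d \<Rightarrow> complex"
  assumes u: "integrable lborel u" "sq_int u"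
  shows "sq_int (fourier1 u)"
proof (rule nn_integral_norm_sq_le_imp(1))
  note [measurable] = sq_int_measurable[OF u(2)]
  let ?F = "\<lambda>n s. ennreal ((cmod (fourier1 u s))\<^sup>2 * gauss_weight (1 / real (Suc n)) s)"
  have "(\<lambda>n. ?F n s) \<longlonglongrightarrow> ennreal ((cmod (fourier1 u s))\<^sup>2)" for s
  proof -
    have "(\<lambda>n. gauss_weight (1 / real (Suc n)) s) \<longlonglongrightarrow> (\<Prod>i\<in>(UNIV::'d set). exp (- (0\<^sup>2 * (s$i)\<^sup>2 / 2)))"
      unfolding gauss_weight_def
      by (intro tendsto_intros LIMSEQ_Suc[OF lim_1_over_n]) auto
    then have "(\<lambda>n. ?F n s) \<longlonglongrightarrow> ennreal ((cmod (fourier1 u s))\<^sup>2 * 1)"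
      by (intro tendsto_ennrealI tendsto_mult tendsto_const) simp
    then show ?thesis by simp
  qed
  then have "(\<integral>\<^sup>+s. ennreal ((cmod (fourier1 u s))\<^sup>2) \<partial>lborel) = (\<integral>\<^sup>+s. liminf (\<lambda>n. ?F n s) \<partial>lborel)"
    by (intro nn_integral_cong lim_imp_Liminf[symmetric]) simp_all
  also have "\<dots> \<le> liminf (\<lambda>n. \<integral>\<^sup>+s. ?F n s \<partial>lborel)"
    by (rule nn_integral_liminf) measurable
  also have "\<dots> \<le> liminf (\<lambda>n. ennreal ((L2_norm u)\<^sup>2))"
    by (intro Liminf_mono always_eventually allI fourier1_weighted_norm_le u) simp
  also have "\<dots> = ennreal ((L2_norm u)\<^sup>2)" by (simp add: Liminf_const)
  finally show "(\<integral>\<^sup>+s. ennreal ((cmod (fourier1 u s))\<^sup>2) \<partial>lborel) \<le> ennreal ((L2_norm u)\<^sup>2)" .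
  show "fourier1 u \<in> borel_measurable borel" by measurable
qed simp

lemma L2_dense_fourier1:
  fixes f :: "real^'d \<Rightarrow> complex"
  assumes f: "sq_int f" and "0 < \<epsilon>"
  obtains \<theta> where "integrable lborel \<theta>" "sq_int \<theta>" "sq_int (fourier1 \<theta>)"
    "L2_norm (\<lambda>x. f x - fourier1 \<theta> x) < \<epsilon>"
proof -
  obtain M e where "bounded_support M e" and f_e: "L2_norm (\<lambda>x. f x - e x) < \<epsilon>/2"
    using L2_dense_bounded_support[OF f half_gt_zero[OF \<open>0 < \<epsilon>\<close>]] by blast
  then have e: "integrable lborel e" "sq_int e"
    by (simp_all add: integrable_bounded_support sq_int_bounded_support)
  define \<sigma> where "\<sigma> n = 1 / real (Suc n)" for n
  have \<sigma>: "0 < \<sigma> n" "\<sigma> \<longlonglongrightarrow> 0" for n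
    unfolding \<sigma>_def using LIMSEQ_Suc[OF lim_1_over_n] by auto
  obtain n where mollify_e: "L2_norm (\<lambda>x. mollify (\<sigma> n) e x - e x) < \<epsilon>/2"
    using eventually_happens'[OF sequentially_bot order_tendstoD(2)[OF mollify_tendsto[OF e \<sigma>] half_gt_zero[OF \<open>0 < \<epsilon>\<close>]]]
    by blast
  define \<theta> where "\<theta> s = cnj (fourier1 (\<lambda>y. cnj (e y)) s) * of_real (gauss_weight (\<sigma> n) s)" for s
  have F\<theta>: "fourier1 \<theta> = mollify (\<sigma> n) e"
    unfolding \<theta>_def by (rule mollify_eq_fourier1[OF e(1) \<sigma>(1)])
  have "integrable lborel (\<lambda>s. cnj (\<theta> s))" "sq_int (\<lambda>s. cnj (\<theta> s))"
    using fourier1_gauss_weight_integrable[OF integrable_cnj[OF e(1)] \<sigma>(1)]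
      fourier1_gauss_weight_sq_int[OF integrable_cnj[OF e(1)] \<sigma>(1)] by (simp_all add: \<theta>_def)
  then have "integrable lborel \<theta>" "sq_int \<theta>"
    using integrable_cnj[of lborel "\<lambda>s. cnj (\<theta> s)"] sq_int_cnj[of "\<lambda>s. cnj (\<theta> s)"] by simp_all
  moreover have "sq_int (fourier1 \<theta>)"
    unfolding F\<theta> by (rule sq_int_mollify[OF e(2) \<sigma>(1)])
  moreover from this have "L2_norm (\<lambda>x. f x - fourier1 \<theta> x) < \<epsilon>"
    using L2_norm_triangle_via[OF f e(2), of "fourier1 \<theta>"] f_e mollify_e L2_norm_minus_commute[of e "fourier1 \<theta>"]
    unfolding F\<theta> by linarith
  ultimately show ?thesis using that by blast
qed

lemma fourier_L2_multiplication:
  assumes "fourier_L2 f g" and \<theta>: "integrable lborel \<theta>" "sq_int \<theta>" "sq_int (fourier1 \<theta>)"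
  shows "(LINT t|lborel. f t * fourier1 \<theta> t) = (LINT s|lborel. g s * \<theta> s)"
proof -
  obtain u where f: "sq_int f" and g: "sq_int g" and u: "\<And>k. integrable lborel (u k)" "\<And>k. sq_int (u k)"
    and ulim: "(\<lambda>k. L2_norm (\<lambda>t. u k t - f t)) \<longlonglongrightarrow> 0"
    and uhat: "(\<lambda>k. L2_norm (\<lambda>t. fourier1 (u k) t - g t)) \<longlonglongrightarrow> 0"
    using assms(1) unfolding fourier_L2_def by blast
  have "(\<lambda>k. LINT t|lborel. u k t * fourier1 \<theta> t) \<longlonglongrightarrow> (LINT t|lborel. f t * fourier1 \<theta> t)"
    using L2_inner_tendsto_left[OF sq_int_cnj[OF \<theta>(3)] u(2) f ulim] by (simp add: L2_inner_def)
  moreover have "(\<lambda>k. LINT t|lborel. u k t * fourier1 \<theta> t) \<longlonglongrightarrow> (LINT s|lborel. g s * \<theta> s)"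
    using L2_inner_tendsto_left[OF sq_int_cnj[OF \<theta>(2)] fourier1_sq_int[OF u] g uhat]
    by (simp add: L2_inner_def fourier1_multiplication[OF u(1) \<theta>(1)])
  ultimately show ?thesis by (rule LIMSEQ_unique)
qed

theorem L2_weak_limit_of_fourier1_limit:
  fixes v :: "nat \<Rightarrow> real^'d \<Rightarrow> complex"
  assumes v: "\<And>n. integrable lborel (v n)" "\<And>n. sq_int (v n)" "\<And>n. L2_norm (v n) \<le> B"
    and lim: "\<And>s. (\<lambda>n. fourier1 (v n) s) \<longlonglongrightarrow> g s"
    and bound: "\<And>n s. cmod (fourier1 (v n) s) \<le> B'"
    and \<phi>: "fourier_L2 \<phi> g" and f: "sq_int f"
  shows "(\<lambda>n. L2_inner f (v n)) \<longlonglongrightarrow> L2_inner f \<phi>"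
proof (rule L2_weak_limit_dense[OF v(2,3) _ f])
  show "sq_int \<phi>" using \<phi> by (simp add: fourier_L2_def)
  fix \<epsilon> :: real assume "0 < \<epsilon>"
  then obtain \<theta> where \<theta>: "integrable lborel \<theta>" "sq_int \<theta>" "sq_int (fourier1 \<theta>)"
    and dist: "L2_norm (\<lambda>x. cnj (f x) - fourier1 \<theta> x) < \<epsilon>"
    using L2_dense_fourier1[OF sq_int_cnj[OF f]] by metis
  define e where "e x = cnj (fourier1 \<theta> x)" for x
  note [measurable] = sq_int_measurable[OF v(2)] sq_int_measurable[OF \<theta>(2)]
  have "g \<in> borel_measurable borel" using \<phi> by (simp add: fourier_L2_def sq_int_def)
  note [measurable] = this
  have "(\<lambda>n. LINT s|lborel. fourier1 (v n) s * \<theta> s) \<longlonglongrightarrow> (LINT s|lborel. g s * \<theta> s)"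
  proof (rule integral_dominated_convergence)
    show "integrable lborel (\<lambda>s. B' * cmod (\<theta> s))" using \<theta>(1) by simp
    show "AE s in lborel. (\<lambda>n. fourier1 (v n) s * \<theta> s) \<longlonglongrightarrow> g s * \<theta> s"
      by (intro AE_I2 tendsto_mult lim tendsto_const)
    show "AE s in lborel. norm (fourier1 (v n) s * \<theta> s) \<le> B' * cmod (\<theta> s)" for n
      by (intro AE_I2) (simp add: norm_mult bound mult_right_mono)
  qed measurable
  then have "(\<lambda>n. L2_inner (v n) e) \<longlonglongrightarrow> L2_inner \<phi> e"
    by (simp add: L2_inner_def e_def fourier1_multiplication[OF v(1) \<theta>(1)] fourier_L2_multiplication[OF \<phi> \<theta>])
  moreover have "sq_int e" unfolding e_def by (rule sq_int_cnj[OF \<theta>(3)])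
  moreover have "L2_norm (\<lambda>x. f x - e x) < \<epsilon>"
    using dist L2_norm_cnj[of "\<lambda>x. f x - e x"] by (simp add: e_def)
  ultimately show "\<exists>e. sq_int e \<and> L2_norm (\<lambda>x. f x - e x) < \<epsilon> \<and> (\<lambda>n. L2_inner (v n) e) \<longlonglongrightarrow> L2_inner \<phi> e"
    by blast
qed

subsection \<open>Translations and dilations\<close>

lemma transl_eq_shift: "transl l f = (\<lambda>t. f (t + - rvec l))"
  by (simp add: transl_def fun_eq_iff)

lemma transl_transl: "transl k (transl l f) = transl (k + l) f"
  by (simp add: transl_def fun_eq_iff rvec_add algebra_simps)

lemma transl_zero [simp]: "transl 0 f = f"
  by (simp add: transl_def fun_eq_iff)

lemma transl_dil: "transl l (dil A f) = dil A (transl (A *v l) f)"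
  by (simp add: transl_def dil_def rvec_matrix matrix_vector_mult_diff_distrib fun_eq_iff)

lemma sq_int_transl: "sq_int f \<Longrightarrow> sq_int (transl l f)"
  unfolding transl_eq_shift by (rule sq_int_shift)

lemma L2_norm_transl: "sq_int f \<Longrightarrow> L2_norm (transl l f) = L2_norm f"
  unfolding transl_eq_shift by (rule L2_norm_shift)

lemma
  assumes "integrable lborel f"
  shows integrable_transl: "integrable lborel (transl l f)"
    and integral_transl: "(LINT t|lborel. transl l f t) = (LINT t|lborel. f t)"
  unfolding transl_eq_shift
  using assms integral_lborel_translate[of f "- rvec l"] borel_measurable_integrable[OF assms] by simp_all

lemma L2_inner_transl:
  assumes "sq_int f" "sq_int g"
  shows "L2_inner f (transl l g) = L2_inner (transl (- l) f) g"
proof -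
  note [measurable] = assms[THEN sq_int_measurable]
  have "L2_inner (transl (- l) f) g = (LINT t|lborel. f (t + rvec l) * cnj (g (t + rvec l + - rvec l)))"
    by (simp add: L2_inner_def transl_eq_shift rvec_uminus)
  also have "\<dots> = L2_inner f (transl l g)"
    unfolding L2_inner_def transl_eq_shift
    by (rule integral_lborel_translate(1)[where F="\<lambda>t. f t * cnj (g (t + - rvec l))"]) measurable
  finally show ?thesis ..
qed

lemma of_real_sqrt_2_mult_self: "complex_of_real (sqrt 2) * complex_of_real (sqrt 2) = 2"
  by (simp flip: of_real_mult)

context dilation_lattice
begin

lemma dil_dil_inv [simp]: "dil A (dil_inv A f) = f" and dil_inv_dil [simp]: "dil_inv A (dil A f) = f"
  by (auto simp: dil_def dil_inv_def fun_eq_iff)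

lemma sq_int_dil:
  assumes "sq_int f" shows "sq_int (dil A f)"
proof -
  note [measurable] = sq_int_measurable[OF assms]
  have "dil A f \<in> borel_measurable borel" unfolding dil_def by measurable
  then show ?thesis
    using sq_int_integrable_norm2[OF assms] integral_dilate(2)[of "\<lambda>t. (cmod (f t))\<^sup>2"]
    by (simp add: sq_int_def dil_def norm_mult power_mult_distrib)
qed

lemma sq_int_dil_inv:
  assumes "sq_int f" shows "sq_int (dil_inv A f)"
proof -
  note [measurable] = sq_int_measurable[OF assms]
  have "dil_inv A f \<in> borel_measurable borel" unfolding dil_inv_def by measurable
  then show ?thesis
    using sq_int_integrable_norm2[OF assms] integral_dilate_inv(2)[of "\<lambda>t. (cmod (f t))\<^sup>2"]
    by (simp add: sq_int_def dil_inv_def norm_divide power_divide)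
qed

lemma
  assumes "integrable lborel f"
  shows integrable_dil: "integrable lborel (dil A f)"
    and integral_dil: "(LINT t|lborel. dil A f t) = (LINT t|lborel. f t) / of_real (sqrt 2)"
proof -
  have f: "f \<in> borel_measurable borel" using borel_measurable_integrable[OF assms] by simp
  show "integrable lborel (dil A f)"
    using integral_dilate(2)[OF f] assms by (simp add: dil_def[abs_def])
  show "(LINT t|lborel. dil A f t) = (LINT t|lborel. f t) / of_real (sqrt 2)"
    using of_real_sqrt_2_mult_self
    by (simp add: dil_def integral_dilate(1)[OF f] scaleR_conv_of_real field_simps)
qed

lemma L2_inner_dil_dil:
  assumes "sq_int f" "sq_int g"
  shows "L2_inner (dil A f) (dil A g) = L2_inner f g"
proof -
  note [measurable] = assms[THEN sq_int_measurable]
  have "dil A f t * cnj (dil A g t) = 2 * (f (R *v t) * cnj (g (R *v t)))" for t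
    by (simp add: dil_def mult_ac flip: of_real_mult)
  then have "L2_inner (dil A f) (dil A g) = 2 * (LINT t|lborel. f (R *v t) * cnj (g (R *v t)))"
    unfolding L2_inner_def by simp
  also have "\<dots> = L2_inner f g"
    using integral_dilate(1)[of "\<lambda>t. f t * cnj (g t)"]
    by (simp add: L2_inner_def scaleR_conv_of_real mult.commute[of 2])
  finally show ?thesis .
qed

lemma L2_inner_dil_inv_dil_inv:
  assumes "sq_int f" "sq_int g"
  shows "L2_inner (dil_inv A f) (dil_inv A g) = L2_inner f g"
  using L2_inner_dil_dil[OF sq_int_dil_inv[OF assms(1)] sq_int_dil_inv[OF assms(2)]] by simp

lemma L2_inner_dil:
  assumes "sq_int f" "sq_int g"
  shows "L2_inner f (dil A g) = L2_inner (dil_inv A f) g"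
  using L2_inner_dil_dil[OF sq_int_dil_inv[OF assms(1)] assms(2)] by simp

lemma dil_pow_int: "dil_pow A (int j) = dil A ^^ j"
  and dil_pow_minus_int: "dil_pow A (- int j) = dil_inv A ^^ j"
  by (cases "j = 0"; simp add: dil_pow_def)+

lemma dil_pow_int_apply: "dil_pow A (int j) f t = of_real (sqrt 2 ^ j) * f (mat_iter R j t)"
  unfolding dil_pow_int by (induction j arbitrary: t) (simp_all add: dil_def funpow_swap1[of "(*v) R"])

lemma dil_pow_minus_int_apply: "dil_pow A (- int j) f t = f (mat_iter Rinv j t) / of_real (sqrt 2 ^ j)"
  unfolding dil_pow_minus_int by (induction j arbitrary: t) (simp_all add: dil_inv_def funpow_swap1[of "(*v) Rinv"])

lemma dil_pow_diff: "dil_pow A n (\<lambda>t. f t - g t) = (\<lambda>t. dil_pow A n f t - dil_pow A n g t)"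
  by (cases n rule: int_cases2)
     (auto simp: fun_eq_iff dil_pow_int_apply dil_pow_minus_int_apply right_diff_distrib diff_divide_distrib)

lemma dil_pow_minus_cancel: "dil_pow A n (dil_pow A (- n) f) = f"
proof -
  have "(dil A ^^ j) ((dil_inv A ^^ j) f) = f" "(dil_inv A ^^ j) ((dil A ^^ j) f) = f" for j
    by (induction j arbitrary: f) (simp_all add: funpow_swap1[of "dil A"] funpow_swap1[of "dil_inv A"])
  then show ?thesis
    by (cases n rule: int_cases2) (simp_all add: dil_pow_int dil_pow_minus_int)
qed

lemma dil_inv_dil_pow: "dil_inv A (dil_pow A (- n) f) = dil_pow A (- (n + 1)) f"
proof (cases n rule: int_cases)
  case (nonneg j)
  then have "- (n + 1) = - int (Suc j)" by simp
  then show ?thesis by (simp only: nonneg dil_pow_minus_int) simp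
next
  case (neg j)
  then have "- n = int (Suc j)" "- (n + 1) = int j" by simp_all
  then show ?thesis by (simp only: dil_pow_int) simp
qed

lemma sq_int_funpow_dil:
  assumes "sq_int f"
  shows "sq_int ((dil A ^^ j) f)" "sq_int ((dil_inv A ^^ j) f)"
  using assms by (induction j) (auto intro: sq_int_dil sq_int_dil_inv)

lemma sq_int_dil_pow: "sq_int f \<Longrightarrow> sq_int (dil_pow A n f)"
  by (simp add: dil_pow_def sq_int_funpow_dil)

lemma L2_inner_dil_pow_dil_pow:
  assumes "sq_int f" "sq_int g"
  shows "L2_inner (dil_pow A n f) (dil_pow A n g) = L2_inner f g"
proof -
  have "L2_inner ((dil A ^^ j) f) ((dil A ^^ j) g) = L2_inner f g"
    "L2_inner ((dil_inv A ^^ j) f) ((dil_inv A ^^ j) g) = L2_inner f g" for j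
    by (induction j) (simp_all add: L2_inner_dil_dil L2_inner_dil_inv_dil_inv sq_int_funpow_dil assms)
  then show ?thesis by (simp add: dil_pow_def)
qed

lemma L2_norm_dil_pow:
  assumes f: "sq_int f"
  shows "L2_norm (dil_pow A n f) = L2_norm f"
proof -
  have "complex_of_real ((L2_norm (dil_pow A n f))\<^sup>2) = complex_of_real ((L2_norm f)\<^sup>2)"
    using L2_inner_dil_pow_dil_pow[OF f f] by (simp only: L2_inner_self)
  then show ?thesis by (simp only: of_real_eq_iff power2_eq_iff_nonneg L2_norm_nonneg)
qed

lemma L2_inner_dil_pow:
  assumes f: "sq_int f" and g: "sq_int g"
  shows "L2_inner f (dil_pow A n g) = L2_inner (dil_pow A (- n) f) g"
  using L2_inner_dil_pow_dil_pow[OF sq_int_dil_pow[OF f] g, of n "- n"] by (simp add: dil_pow_minus_cancel)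

lemma L2_modulus_dil_pow:
  assumes f: "sq_int f"
  shows "L2_modulus (dil_pow A (- int j) f) u = L2_modulus f (mat_iter Rinv j u)"
proof -
  have "dil_pow A (- int j) f (t + u) - dil_pow A (- int j) f t
      = dil_pow A (- int j) (\<lambda>t. f (t + mat_iter Rinv j u) - f t) t" for t
    by (simp add: dil_pow_minus_int_apply mat_iter_add diff_divide_distrib)
  then show ?thesis
    unfolding L2_modulus_def by (simp add: L2_norm_dil_pow sq_int_diff sq_int_shift f)
qed

lemma dil_pow_bounded_support:
  assumes e: "bounded_support M e"
  obtains \<delta> where "\<delta> \<longlonglongrightarrow> 0" "\<And>j t. \<delta> j < norm t \<Longrightarrow> dil_pow A (int j) e t = 0"
proof -
  obtain C r where decay: "0 \<le> C" "0 < r" "r < 1" "\<And>j x. norm (mat_iter Rinv j x) \<le> C * r ^ j * norm x"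
    using geometric_decayE[OF geometric_decay_Rinv] by blast
  have "dil_pow A (int j) e t = 0" if t: "C * r ^ j * M < norm t" for j t
  proof -
    have "norm t \<le> C * r ^ j * norm (mat_iter R j t)"
      using decay(4)[of j "mat_iter R j t"] by (simp add: mat_iter_Rinv_R)
    then have "C * r ^ j * M < C * r ^ j * norm (mat_iter R j t)" using t by linarith
    then have "M < norm (mat_iter R j t)"
      using decay(1,2) by (auto simp: mult_less_cancel_left)
    then show ?thesis by (simp add: dil_pow_int_apply bounded_support_eq_0[OF e])
  qed
  moreover have "(\<lambda>j. C * r ^ j * M) \<longlonglongrightarrow> 0"
    using decay by (intro tendsto_mult_left_zero tendsto_mult_right_zero LIMSEQ_power_zero) auto
  ultimately show ?thesis using that by blast
qed

lemma dil_pow_weakly_null: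
  assumes e: "bounded_support M e" and g: "sq_int g"
  shows "(\<lambda>j. L2_inner (dil_pow A (int j) e) g) \<longlonglongrightarrow> 0"
proof -
  obtain \<delta> where \<delta>: "\<delta> \<longlonglongrightarrow> 0" "\<And>j t. \<delta> j < norm t \<Longrightarrow> dil_pow A (int j) e t = 0"
    using dil_pow_bounded_support[OF e] by blast
  define G where "G j t = g t * indicator (cball 0 (\<delta> j)) t" for j t
  have G: "sq_int (G j)" for j
    unfolding G_def by (rule sq_int_mult_indicator[OF g]) simp
  have "(\<lambda>j. L2_norm (G j)) \<longlonglongrightarrow> 0"
  proof (rule L2_norm_tendsto_0_dominated[OF sq_int_integrable_norm2[OF g]])
    show "AE t in lborel. (\<lambda>j. G j t) \<longlonglongrightarrow> 0"
      using AE_lborel_singleton[of "0::real^'d"]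
    proof eventually_elim
      case (elim t)
      then have "\<forall>\<^sub>F j in sequentially. \<delta> j < norm t"
        by (intro order_tendstoD(2)[OF \<delta>(1)]) simp
      then have "\<forall>\<^sub>F j in sequentially. G j t = 0"
        by eventually_elim (simp add: G_def)
      then show ?case by (rule tendsto_eventually)
    qed
  qed (auto simp: G_def indicator_def sq_int_measurable[OF G])
  then have lim: "(\<lambda>j. L2_norm e * L2_norm (G j)) \<longlonglongrightarrow> 0"
    by (rule tendsto_mult_right_zero)
  have "norm (L2_inner (dil_pow A (int j) e) g) \<le> L2_norm e * L2_norm (G j)" for j
  proof -
    have "dil_pow A (int j) e t * cnj (g t) = dil_pow A (int j) e t * cnj (G j t)" for t
      using \<delta>(2)[of j t] by (cases "norm t \<le> \<delta> j") (auto simp: G_def)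
    then have "L2_inner (dil_pow A (int j) e) g = L2_inner (dil_pow A (int j) e) (G j)"
      unfolding L2_inner_def by (rule Bochner_Integration.integral_cong[OF refl])
    then show ?thesis
      using L2_Cauchy_Schwarz[OF sq_int_dil_pow G] sq_int_bounded_support[OF e] by (simp add: L2_norm_dil_pow)
  qed
  then show ?thesis
    by (intro Lim_null_comparison[OF _ lim]) simp
qed

end

subsection \<open>The cascade algorithm\<close>

locale scaling_filter = dilation_lattice A lA
  for A :: "int^'d^'d" and lA :: "int^'d" +
  fixes h :: "int^'d \<Rightarrow> complex" and N0 :: nat
  assumes orth: "\<forall>k\<in>latt A. (\<Sum>\<^sub>\<infinity>n. h n * cnj (h (n + k))) = (if k = 0 then 1 else 0)"
    and hsum: "(\<Sum>\<^sub>\<infinity>n. h n) = complex_of_real (sqrt 2)"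
    and hsupp: "\<forall>n. n \<notin> {n::int^'d. \<forall>j. \<bar>n$j\<bar> \<le> int N0} \<longrightarrow> h n = 0"
begin

definition h_box :: "(int^'d) set" where
  "h_box = {n. \<forall>j. \<bar>n$j\<bar> \<le> int N0}"

lemma finite_h_box [simp]: "finite h_box"
  unfolding h_box_def by (rule finite_box_int)

lemma h_outside: "n \<notin> h_box \<Longrightarrow> h n = 0"
  using hsupp by (simp add: h_box_def)

lemma infsum_h_box:
  fixes f :: "int^'d \<Rightarrow> complex"
  assumes "\<And>n. n \<notin> h_box \<Longrightarrow> f n = 0"
  shows "(\<Sum>\<^sub>\<infinity>n. f n) = (\<Sum>n\<in>h_box. f n)"
  using infsum_cong_neutral[of h_box UNIV f f] assms by simp

lemma orth_sum:
  assumes "k \<in> latt A"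
  shows "(\<Sum>n\<in>h_box. h n * cnj (h (n + k))) = (if k = 0 then 1 else 0)"
  using orth assms infsum_h_box[of "\<lambda>n. h n * cnj (h (n + k))"] by (simp add: h_outside)

lemma h_sum: "(\<Sum>n\<in>h_box. h n) = complex_of_real (sqrt 2)"
  using hsum infsum_h_box[of h] by (simp add: h_outside)

definition refine :: "(real^'d \<Rightarrow> complex) \<Rightarrow> real^'d \<Rightarrow> complex" where
  "refine f t = (\<Sum>n\<in>h_box. h n * dil A (transl n f) t)"

lemma sq_int_refine: "sq_int f \<Longrightarrow> sq_int (refine f)"
  unfolding refine_def by (intro sq_int_sum sq_int_cmult sq_int_dil sq_int_transl)

lemma integrable_refine: "integrable lborel f \<Longrightarrow> integrable lborel (refine f)"
  unfolding refine_def
  by (intro Bochner_Integration.integrable_sum integrable_mult_right integrable_dil integrable_transl)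

lemma integral_refine:
  assumes "integrable lborel f"
  shows "(LINT t|lborel. refine f t) = (LINT t|lborel. f t)"
proof -
  have "(LINT t|lborel. refine f t) = (\<Sum>n\<in>h_box. LINT t|lborel. h n * dil A (transl n f) t)"
    unfolding refine_def using assms
    by (intro Bochner_Integration.integral_sum integrable_mult_right integrable_dil integrable_transl)
  also have "\<dots> = (\<Sum>n\<in>h_box. h n) * ((LINT t|lborel. f t) / of_real (sqrt 2))"
    by (simp only: sum_distrib_right integral_mult_right_zero integral_dil integrable_transl integral_transl assms)
  finally show ?thesis by (simp add: h_sum)
qed

lemma transl_refine: "transl l (refine f) = (\<lambda>t. \<Sum>n\<in>h_box. h n * dil A (transl (A *v l + n) f) t)"
proof
  fix t
  have "transl l (refine f) t = (\<Sum>n\<in>h_box. h n * transl l (dil A (transl n f)) t)"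
    by (simp add: transl_def refine_def)
  then show "transl l (refine f) t = (\<Sum>n\<in>h_box. h n * dil A (transl (A *v l + n) f) t)"
    by (simp add: transl_dil transl_transl)
qed

lemma refine_orthonormal:
  assumes f: "sq_int f"
    and orthonormal: "\<And>k l. L2_inner (transl k f) (transl l f) = (if k = l then 1 else 0)"
  shows "L2_inner (transl k (refine f)) (transl l (refine f)) = (if k = l then 1 else 0)"
proof -
  have sq_int_terms: "sq_int (\<lambda>t. h n * dil A (transl m f) t)" for n m
    by (intro sq_int_cmult sq_int_dil sq_int_transl f)
  let ?ip = "\<lambda>n m. h n * (cnj (h m) * L2_inner (transl (A *v k + n) f) (transl (A *v l + m) f))"
  have "L2_inner (transl k (refine f)) (transl l (refine f)) = (\<Sum>n\<in>h_box. \<Sum>m\<in>h_box. ?ip n m)"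
    unfolding transl_refine
    by (subst L2_inner_sum_left[OF sq_int_terms sq_int_sum[OF sq_int_terms]], rule sum.cong[OF refl],
        subst L2_inner_sum_right[OF sq_int_terms sq_int_terms])
       (simp add: L2_inner_cmult_left L2_inner_cmult_right L2_inner_dil_dil sq_int_transl f sum_distrib_left)
  also have "\<dots> = (\<Sum>n\<in>h_box. h n * cnj (h (n + A *v (k - l))))"
  proof (rule sum.cong[OF refl])
    fix n
    have "A *v k + n = A *v l + m \<longleftrightarrow> m = n + A *v (k - l)" for m
      by (auto simp: matrix_vector_mult_diff_distrib algebra_simps)
    then have "(\<Sum>m\<in>h_box. ?ip n m) = (\<Sum>m\<in>h_box. if m = n + A *v (k - l) then h n * cnj (h m) else 0)"
      by (intro sum.cong) (auto simp: orthonormal)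
    then show "(\<Sum>m\<in>h_box. ?ip n m) = h n * cnj (h (n + A *v (k - l)))"
      by (simp add: h_outside)
  qed
  also have "\<dots> = (if A *v (k - l) = 0 then 1 else 0)"
    by (rule orth_sum) (simp add: latt_def)
  also have "A *v (k - l) = 0 \<longleftrightarrow> k = l"
    using A_inject[of k l] by (simp add: matrix_vector_mult_diff_distrib)
  finally show ?thesis .
qed

definition cascade :: "nat \<Rightarrow> real^'d \<Rightarrow> complex" where
  "cascade n = (refine ^^ n) (indicator ucube)"

lemma cascade_0: "cascade 0 = indicator ucube"
  by (simp add: cascade_def)

lemma cascade_Suc: "cascade (Suc n) = refine (cascade n)"
  by (simp add: cascade_def)

lemma bounded_support_indicator_ucube:
  "bounded_support (real CARD('d)) (indicator (ucube :: (real^'d) set))"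
  by (auto simp: bounded_support_def indicator_def Suc_le_eq dest: norm_ucube_le)

lemma sq_int_cascade: "sq_int (cascade n)"
  by (induction n)
     (simp_all add: cascade_0 cascade_Suc sq_int_bounded_support[OF bounded_support_indicator_ucube] sq_int_refine)

lemma integrable_cascade: "integrable lborel (cascade n)"
  by (induction n)
     (simp_all add: cascade_0 cascade_Suc integrable_bounded_support[OF bounded_support_indicator_ucube] integrable_refine)

lemma indicator_ucube_orthonormal:
  fixes k l :: "int^'d"
  shows "L2_inner (transl k (indicator ucube)) (transl l (indicator ucube)) = (if k = l then 1 else 0)"
proof (cases "k = l")
  case True
  have "L2_norm (indicator (ucube :: (real^'d) set)) = 1"
    unfolding L2_norm_def
    by (subst Bochner_Integration.integral_cong[OF refl, where g="indicator ucube"])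
       (auto simp: indicator_def measure_def)
  then show ?thesis
    using True by (simp add: L2_inner_self L2_norm_transl sq_int_bounded_support[OF bounded_support_indicator_ucube])
next
  case False
  then have "transl k (indicator ucube) t * cnj (transl l (indicator ucube) t) = 0" for t :: "real^'d"
    by (auto simp: transl_def indicator_def diff_rvec_in_ucube_iff)
  with False show ?thesis by (simp only: L2_inner_def) simp
qed

lemma cascade_orthonormal:
  "L2_inner (transl k (cascade n)) (transl l (cascade n)) = (if k = l then 1 else 0)"
proof (induction n arbitrary: k l)
  case 0
  show ?case unfolding cascade_0 by (rule indicator_ucube_orthonormal)
next
  case (Suc n)
  show ?case unfolding cascade_Suc
    by (rule refine_orthonormal[OF sq_int_cascade Suc])
qed

lemma L2_norm_cascade: "L2_norm (cascade n) = 1"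
proof -
  have "complex_of_real ((L2_norm (cascade n))\<^sup>2) = complex_of_real (1\<^sup>2)"
    using cascade_orthonormal[of 0 n 0] by (simp add: L2_inner_self)
  then show ?thesis by (simp only: of_real_eq_iff power2_eq_iff_nonneg L2_norm_nonneg zero_le_one)
qed

lemma integral_cascade: "(LINT t|lborel. cascade n t) = 1"
proof (induction n)
  case 0
  have "(LINT t|lborel. indicator (ucube::(real^'d) set) t :: complex)
      = (LINT t|lborel. of_real (indicator (ucube::(real^'d) set) t))"
    by (simp only: of_real_indicator)
  also have "\<dots> = of_real (LINT t|lborel. indicator (ucube::(real^'d) set) t)"
    by (rule integral_complex_of_real)
  also have "\<dots> = 1" by (simp add: measure_def)
  finally show ?case by (simp only: cascade_0)
qed (simp add: cascade_Suc integral_refine integrable_cascade)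

lemma cascade_nonzero_expansion:
  assumes "cascade n t \<noteq> 0"
  shows "\<exists>x\<in>ucube. \<exists>k. (\<forall>j. k j \<in> h_box) \<and> t = mat_iter Rinv n x + (\<Sum>j<n. mat_iter Rinv (Suc j) (rvec (k j)))"
  using assms
proof (induction n arbitrary: t)
  case 0
  then have "t \<in> ucube" by (auto simp: cascade_0 indicator_def split: if_splits)
  moreover have "(0::int^'d) \<in> h_box" by (simp add: h_box_def)
  ultimately show ?case by (intro bexI[of _ t] exI[of _ "\<lambda>_. 0"]) simp_all
next
  case (Suc n)
  then have "\<exists>m\<in>h_box. h m * dil A (transl m (cascade n)) t \<noteq> 0"
    unfolding cascade_Suc refine_def by (meson sum.neutral)
  then obtain m where m: "m \<in> h_box" "cascade n (R *v t - rvec m) \<noteq> 0"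
    by (auto simp: dil_def transl_def)
  then obtain x k where x: "x \<in> ucube" and k: "\<And>j. k j \<in> h_box"
    and Rt: "R *v t - rvec m = mat_iter Rinv n x + (\<Sum>j<n. mat_iter Rinv (Suc j) (rvec (k j)))"
    using Suc.IH[OF m(2)] by blast
  have "t = Rinv *v (rvec m + (R *v t - rvec m))" by simp
  also have "\<dots> = mat_iter Rinv (Suc n) x + (\<Sum>j<Suc n. mat_iter Rinv (Suc j) (rvec (case_nat m k j)))"
    unfolding Rt
    by (subst sum.lessThan_Suc_shift)
       (simp add: matrix_vector_right_distrib vec.linear_sum[OF matrix_vector_mul_linear_gen])
  finally have "t = mat_iter Rinv (Suc n) x + (\<Sum>j<Suc n. mat_iter Rinv (Suc j) (rvec (case_nat m k j)))" .
  moreover have "case_nat m k j \<in> h_box" for j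
    using m(1) k by (cases j) simp_all
  ultimately show ?case using x by blast
qed

lemma cascade_bounded_support: "\<exists>\<kappa>. \<forall>n t. \<kappa> < norm t \<longrightarrow> cascade n t = 0"
proof -
  obtain C r where decay: "0 \<le> C" "0 < r" "r < 1" "\<And>j x. norm (mat_iter Rinv j x) \<le> C * r ^ j * norm x"
    using geometric_decayE[OF geometric_decay_Rinv] by blast
  define K where "K = (\<Sum>k\<in>h_box. norm (rvec k))"
  have K: "norm (rvec k) \<le> K" if "k \<in> h_box" for k
    unfolding K_def by (rule member_le_sum) (use that in auto)
  have K_nonneg: "0 \<le> K" unfolding K_def by (intro sum_nonneg) auto
  have iter: "norm (mat_iter Rinv j x) \<le> C * b * r ^ j" if "norm x \<le> b" for j x b
    using decay(4)[of j x] mult_left_mono[OF that, of "C * r ^ j"] decay(1,2) by (simp add: mult_ac)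
  have "norm t \<le> C * real CARD('d) + C * K * r / (1 - r)" if nz: "cascade n t \<noteq> 0" for n t
  proof -
    obtain x k where x: "x \<in> ucube" and k: "\<And>j. k j \<in> h_box"
      and t: "t = mat_iter Rinv n x + (\<Sum>j<n. mat_iter Rinv (Suc j) (rvec (k j)))"
      using cascade_nonzero_expansion[OF nz] by blast
    have "norm t \<le> norm (mat_iter Rinv n x) + (\<Sum>j<n. norm (mat_iter Rinv (Suc j) (rvec (k j))))"
      unfolding t by (intro order_trans[OF norm_triangle_ineq] add_left_mono norm_sum)
    also have "\<dots> \<le> C * real CARD('d) * 1 + (\<Sum>j<n. C * K * r ^ Suc j)"
    proof (intro add_mono sum_mono)
      have "norm (mat_iter Rinv n x) \<le> C * real CARD('d) * r ^ n"
        by (rule iter[OF norm_ucube_le[OF x]])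
      also have "\<dots> \<le> C * real CARD('d) * 1"
        using decay by (intro mult_left_mono power_le_one) auto
      finally show "norm (mat_iter Rinv n x) \<le> C * real CARD('d) * 1" .
      show "norm (mat_iter Rinv (Suc j) (rvec (k j))) \<le> C * K * r ^ Suc j" for j
        by (rule iter[OF K[OF k]])
    qed
    also have "(\<Sum>j<n. C * K * r ^ Suc j) = C * K * r * (\<Sum>j<n. r ^ j)"
      by (simp add: sum_distrib_left mult_ac)
    also have "\<dots> \<le> C * K * r * (1 / (1 - r))"
    proof (intro mult_left_mono)
      show "(\<Sum>j<n. r ^ j) \<le> 1 / (1 - r)"
        using decay(2,3) by (simp add: sum_gp_strict divide_right_mono)
    qed (use decay K_nonneg in simp)
    finally show ?thesis by simp
  qed
  then show ?thesis by (meson linorder_not_le)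
qed

definition cascade_radius :: real where
  "cascade_radius = (SOME \<kappa>. \<forall>n t. \<kappa> < norm t \<longrightarrow> cascade n t = 0)"

lemma cascade_eq_0: "cascade_radius < norm t \<Longrightarrow> cascade n t = 0"
  using someI_ex[OF cascade_bounded_support] by (simp add: cascade_radius_def)

lemma fourier1_dil_transl:
  assumes f: "integrable lborel f"
  shows "fourier1 (dil A (transl n f)) \<xi> = cis (- (rvec n \<bullet> (Rtinv *v \<xi>))) * fourier1 f (Rtinv *v \<xi>) / of_real (sqrt 2)"
proof -
  have [measurable]: "f \<in> borel_measurable borel" using borel_measurable_integrable[OF f] by simp
  define F where "F y = cis (- ((Rtinv *v \<xi>) \<bullet> y)) * f (y - rvec n)" for y
  have F: "F \<in> borel_measurable borel" unfolding F_def by measurable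
  have "cis (- (\<xi> \<bullet> t)) * dil A (transl n f) t = of_real (sqrt 2) * F (R *v t)" for t
    by (simp add: F_def dil_def transl_def inner_Rtinv)
  then have "(LINT t|lborel. cis (- (\<xi> \<bullet> t)) * dil A (transl n f) t) = (LINT t|lborel. F t) / of_real (sqrt 2)"
    using of_real_sqrt_2_mult_self
    by (simp add: integral_dilate(1)[OF F] scaleR_conv_of_real field_simps)
  also have "(LINT t|lborel. F t) = (LINT t|lborel. F (t + rvec n))"
    by (rule integral_lborel_translate(1)[OF F, symmetric])
  also have "\<dots> = (LINT t|lborel. cis (- (rvec n \<bullet> (Rtinv *v \<xi>))) * (cis (- ((Rtinv *v \<xi>) \<bullet> t)) * f t))"
    by (simp add: F_def inner_add_left inner_add_right cis_mult mult.assoc[symmetric] inner_commute add.commute)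
  also have "\<dots> = cis (- (rvec n \<bullet> (Rtinv *v \<xi>))) * (LINT t|lborel. cis (- ((Rtinv *v \<xi>) \<bullet> t)) * f t)"
    by (rule integral_mult_right_zero)
  finally show ?thesis
    by (simp add: fourier1_def)
qed

lemma fourier1_refine:
  assumes f: "integrable lborel f"
  shows "fourier1 (refine f) \<xi> = mask0 h N0 (Rtinv *v \<xi>) * fourier1 f (Rtinv *v \<xi>)"
proof -
  let ?c = "complex_of_real ((2*pi) powr (- real CARD('d) / 2))"
  have "fourier1 (refine f) \<xi> = ?c * (LINT t|lborel. (\<Sum>n\<in>h_box. h n * (cis (- (\<xi> \<bullet> t)) * dil A (transl n f) t)))"
    by (simp add: fourier1_def refine_def sum_distrib_left mult_ac)
  also have "(LINT t|lborel. (\<Sum>n\<in>h_box. h n * (cis (- (\<xi> \<bullet> t)) * dil A (transl n f) t)))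
     = (\<Sum>n\<in>h_box. LINT t|lborel. h n * (cis (- (\<xi> \<bullet> t)) * dil A (transl n f) t))"
    by (rule Bochner_Integration.integral_sum)
       (intro integrable_mult_right integrable_cis_mult integrable_dil integrable_transl f, measurable)
  also have "?c * \<dots> = (\<Sum>n\<in>h_box. h n * fourier1 (dil A (transl n f)) \<xi>)"
    by (simp add: fourier1_def sum_distrib_left mult_ac)
  also have "\<dots> = mask0 h N0 (Rtinv *v \<xi>) * fourier1 f (Rtinv *v \<xi>)"
    unfolding mask0_def h_box_def[symmetric] fourier1_dil_transl[OF f] sum_distrib_left sum_distrib_right
    by (intro sum.cong refl) simp
  finally show ?thesis .
qed

lemma fourier1_cascade:
  "fourier1 (cascade n) \<xi>
    = (\<Prod>j<n. mask0 h N0 (mat_iter Rtinv (Suc j) \<xi>)) * fourier1 (indicator ucube) (mat_iter Rtinv n \<xi>)"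
proof (induction n arbitrary: \<xi>)
  case (Suc n)
  show ?case
    unfolding cascade_Suc fourier1_refine[OF integrable_cascade] Suc mat_iter_Suc_right[symmetric]
    by (subst prod.lessThan_Suc_shift) (simp add: mult.assoc)
qed (simp add: cascade_0)

lemma mask0_lipschitz:
  obtains L where "0 \<le> L" "\<And>t. cmod (mask0 h N0 t - 1) \<le> L * norm t"
proof
  define L where "L = (\<Sum>n\<in>h_box. cmod (h n) * norm (rvec n)) / sqrt 2"
  show "0 \<le> L" unfolding L_def by (intro divide_nonneg_nonneg sum_nonneg) auto
  fix t
  have "(\<Sum>n\<in>h_box. h n * (cis (- (rvec n \<bullet> t)) - 1)) = (\<Sum>n\<in>h_box. h n * cis (- (rvec n \<bullet> t))) - of_real (sqrt 2)"
    by (simp add: right_diff_distrib sum_subtractf h_sum)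
  then have mask0_diff: "mask0 h N0 t - 1 = (\<Sum>n\<in>h_box. h n * (cis (- (rvec n \<bullet> t)) - 1)) / of_real (sqrt 2)"
    unfolding mask0_def h_box_def[symmetric] by (simp add: diff_divide_distrib)
  have cmod_cis_diff_1: "cmod (cis x - 1) \<le> \<bar>x\<bar>" for x
    using iexp_approx1[of x 0] by (simp add: cis_conv_exp)
  have "cmod (\<Sum>n\<in>h_box. h n * (cis (- (rvec n \<bullet> t)) - 1)) \<le> (\<Sum>n\<in>h_box. cmod (h n) * norm (rvec n) * norm t)"
  proof (rule sum_norm_le)
    fix n
    have "cmod (cis (- (rvec n \<bullet> t)) - 1) \<le> norm (rvec n) * norm t"
      using cmod_cis_diff_1[of "- (rvec n \<bullet> t)"] Cauchy_Schwarz_ineq2[of "rvec n" t] by simp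
    then show "cmod (h n * (cis (- (rvec n \<bullet> t)) - 1)) \<le> cmod (h n) * norm (rvec n) * norm t"
      by (simp add: norm_mult mult.assoc mult_left_mono)
  qed
  then show "cmod (mask0 h N0 t - 1) \<le> L * norm t"
    unfolding mask0_diff L_def by (simp add: norm_divide sum_distrib_right divide_right_mono)
qed

lemma mask0_product_tendsto:
  "(\<lambda>n. \<Prod>j<n. mask0 h N0 (mat_iter Rtinv (Suc j) \<xi>)) \<longlonglongrightarrow> prodinf (\<lambda>j. mask0 h N0 (mat_iter Rtinv (Suc j) \<xi>))"
proof -
  let ?m = "\<lambda>j. mask0 h N0 (mat_iter Rtinv (Suc j) \<xi>)"
  obtain C r where decay: "0 \<le> C" "0 < r" "r < 1" "\<And>j x. norm (mat_iter Rtinv j x) \<le> C * r ^ j * norm x"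
    using geometric_decayE[OF geometric_decay_Rtinv] by blast
  obtain L where L: "0 \<le> L" "\<And>t. cmod (mask0 h N0 t - 1) \<le> L * norm t" using mask0_lipschitz by blast
  have "summable (\<lambda>j. norm (?m j - 1))"
  proof (rule summable_comparison_test')
    show "summable (\<lambda>j. (L * C * norm \<xi> * r) * r ^ j)"
      using decay by (intro summable_mult summable_geometric) auto
    fix j
    have "norm (?m j - 1) \<le> L * norm (mat_iter Rtinv (Suc j) \<xi>)" by (rule L)
    also have "\<dots> \<le> L * (C * r ^ Suc j * norm \<xi>)" by (intro mult_left_mono decay L)
    finally show "norm (norm (?m j - 1)) \<le> (L * C * norm \<xi> * r) * r ^ j" by (simp add: mult_ac)
  qed
  then have "convergent_prod ?m"
    by (intro abs_convergent_prod_imp_convergent_prod summable_imp_abs_convergent_prod)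
  then show ?thesis
    using convergent_prod_LIMSEQ LIMSEQ_lessThan_iff_atMost[of "\<lambda>A. prod ?m A"] by blast
qed

lemma fourier1_cascade_tendsto: "(\<lambda>n. fourier1 (cascade n) \<xi>) \<longlonglongrightarrow> gfun A h N0 \<xi>"
proof -
  have "fourier1 (indicator (ucube :: (real^'d) set)) 0 = complex_of_real ((2*pi) powr (- real CARD('d) / 2))"
    using integral_cascade[of 0] by (simp add: fourier1_def cascade_0)
  then have "(\<lambda>n. fourier1 (indicator ucube) (mat_iter Rtinv n \<xi>)) \<longlonglongrightarrow> complex_of_real ((2*pi) powr (- real CARD('d) / 2))"
    using fourier1_tendsto[OF integrable_bounded_support[OF bounded_support_indicator_ucube]
        geometric_decay_tendsto_0[OF geometric_decay_Rtinv]] by metis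
  from tendsto_mult[OF mask0_product_tendsto this] show ?thesis
    unfolding fourier1_cascade gfun_def by (simp add: mult.commute)
qed

lemma cascade_fourier1_bounded: obtains B where "\<And>n \<xi>. cmod (fourier1 (cascade n) \<xi>) \<le> B"
proof -
  let ?k = "indicator (cball 0 cascade_radius) :: real^'d \<Rightarrow> complex"
  have "(LINT t|lborel. cmod (cascade n t)) \<le> L2_norm ?k" for n
  proof -
    have "cmod (cascade n t) = cmod (cascade n t) * cmod (?k t)" for t
      using cascade_eq_0[of t n] by (cases "norm t \<le> cascade_radius") auto
    then have "(LINT t|lborel. cmod (cascade n t)) = (LINT t|lborel. cmod (cascade n t) * cmod (?k t))"
      by (rule Bochner_Integration.integral_cong[OF refl])
    also have "\<dots> \<le> L2_norm (cascade n) * L2_norm ?k"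
      by (rule L2_Cauchy_Schwarz_norm[OF sq_int_cascade sq_int_indicator_cball])
    finally show ?thesis by (simp add: L2_norm_cascade)
  qed
  then have "cmod (fourier1 (cascade n) \<xi>) \<le> (2*pi) powr (- real CARD('d) / 2) * L2_norm ?k" for n \<xi>
    by (intro order_trans[OF fourier1_bound[OF integrable_cascade]] mult_left_mono) auto
  with that show ?thesis by blast
qed

lemma cascade_weak_limit:
  assumes "fourier_L2 \<phi> (gfun A h N0)" "sq_int f"
  shows "(\<lambda>n. L2_inner f (cascade n)) \<longlonglongrightarrow> L2_inner f \<phi>"
proof -
  obtain B where B: "\<And>n \<xi>. cmod (fourier1 (cascade n) \<xi>) \<le> B" using cascade_fourier1_bounded by blast
  show ?thesis
    by (rule L2_weak_limit_of_fourier1_limit[OF integrable_cascade sq_int_cascade _ fourier1_cascade_tendsto B assms, of 1])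
       (simp add: L2_norm_cascade)
qed

end

subsection \<open>Perfect reconstruction\<close>

lemma dotz_diff: "dotz q (a - b) = dotz q a - dotz q b"
  by (simp add: dotz_def right_diff_distrib sum_subtractf)

lemma minus_one_powi: "(-1 :: complex) powi n = (if even n then 1 else -1)"
  by (auto simp: power_int_minus_left)

lemma has_sum_diff:
  fixes f g :: "'a \<Rightarrow> 'b::topological_ab_group_add"
  assumes "(f has_sum a) X" "(g has_sum b) X"
  shows "((\<lambda>x. f x - g x) has_sum (a - b)) X"
  using has_sum_add[OF assms(1), of "\<lambda>x. - g x" "- b"] assms(2) by (simp add: has_sum_uminus)

lemma has_sum_sum:
  fixes f :: "'i \<Rightarrow> 'a \<Rightarrow> 'b::topological_comm_monoid_add"
  assumes "\<And>i. i \<in> I \<Longrightarrow> (f i has_sum s i) X"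
  shows "((\<lambda>x. \<Sum>i\<in>I. f i x) has_sum (\<Sum>i\<in>I. s i)) X"
  using assms by (induction I rule: infinite_finite_induct) (auto intro: has_sum_add)

definition autocorr :: "('a::ab_group_add \<Rightarrow> complex) \<Rightarrow> 'a \<Rightarrow> 'a \<Rightarrow> complex" where
  "autocorr c m n = c n * cnj (c (n + m))"

lemma autocorr_summable:
  assumes c: "(\<lambda>n. (cmod (c n))\<^sup>2) summable_on UNIV"
  shows "autocorr c m summable_on S"
proof -
  have "(\<lambda>n. (cmod (c (n + m)))\<^sup>2) summable_on UNIV"
    using c summable_on_reindex_bij_witness[of UNIV "\<lambda>n. n - m" "\<lambda>n. n + m" UNIV
        "\<lambda>n. (cmod (c n))\<^sup>2" "\<lambda>n. (cmod (c (n + m)))\<^sup>2"]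
    by simp
  then have sum: "(\<lambda>n. norm ((cmod (c n))\<^sup>2 + (cmod (c (n + m)))\<^sup>2)) summable_on UNIV"
    using summable_on_add[OF c] by simp
  have "(\<lambda>n. norm (autocorr c m n)) summable_on UNIV"
  proof (rule Infinite_Sum.abs_summable_on_comparison_test[OF sum])
    show "norm (autocorr c m n) \<le> norm ((cmod (c n))\<^sup>2 + (cmod (c (n + m)))\<^sup>2)" for n
      unfolding autocorr_def norm_mult complex_mod_cnj real_norm_def
      by (rule order_trans[OF norm_mult_le_sum_squares abs_ge_self])
  qed
  then show ?thesis
    by (rule summable_on_subset_banach[OF Infinite_Sum.abs_summable_summable subset_UNIV])
qed

locale wavelet_filter = scaling_filter A lA h N0
  for A :: "int^'d^'d" and lA h N0 +
  fixes qA :: "int^'d"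
  assumes qeven: "\<forall>k\<in>latt A. even (dotz qA k)"
    and qodd: "\<forall>k\<in>latt A. odd (dotz qA (lA + k))"
begin

lemma latt_iff_even_dotz: "m \<in> latt A \<longleftrightarrow> even (dotz qA m)"
proof (cases "m \<in> latt A")
  case False
  then have "m \<in> (\<lambda>k. lA + k) ` latt A" using UNIV_I[of m] by (subst (asm) part) simp
  with False qodd show ?thesis by auto
qed (use qeven in auto)

lemma odd_dotz_lA: "odd (dotz qA lA)"
  using qodd latt_zero[of A] by force

lemma range_coset: "range (\<lambda>l. A *v l + x) = {n. even (dotz qA (n - x))}"
proof -
  have "n \<in> range (\<lambda>l. A *v l + x) \<longleftrightarrow> n - x \<in> latt A" for n
    by (auto simp: latt_def image_iff algebra_simps)
  then show ?thesis by (auto simp: latt_iff_even_dotz)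
qed

definition sgn_q :: "int^'d \<Rightarrow> complex" where
  "sgn_q k = (-1) powi (dotz qA k)"

lemma sgn_q_mult: "sgn_q (lA - p) * sgn_q (lA - x) = (if x - p \<in> latt A then 1 else -1)"
  by (simp add: sgn_q_def minus_one_powi latt_iff_even_dotz dotz_diff)

lemma cnj_sgn_q [simp]: "cnj (sgn_q k) = sgn_q k"
  by (simp add: sgn_q_def minus_one_powi)

definition lowpass :: "(int^'d \<Rightarrow> complex) \<Rightarrow> int^'d \<Rightarrow> complex" where
  "lowpass c l = (\<Sum>n\<in>h_box. cnj (h n) * c (A *v l + n))"

definition highpass :: "(int^'d \<Rightarrow> complex) \<Rightarrow> int^'d \<Rightarrow> complex" where
  "highpass c l = (\<Sum>n\<in>h_box. sgn_q (lA - n) * h n * c (A *v l + (lA - n)))"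

lemma lowpass_mult_cnj:
  "lowpass c l * cnj (lowpass c l)
    = (\<Sum>p\<in>h_box. \<Sum>x\<in>h_box. cnj (h p) * h x * autocorr c (x - p) (A *v l + p))"
proof -
  have "lowpass c l * cnj (lowpass c l)
    = (\<Sum>p\<in>h_box. \<Sum>x\<in>h_box. (cnj (h p) * c (A *v l + p)) * cnj (cnj (h x) * c (A *v l + x)))"
    unfolding lowpass_def cnj_sum by (rule sum_product)
  also have "\<dots> = (\<Sum>p\<in>h_box. \<Sum>x\<in>h_box. cnj (h p) * h x * autocorr c (x - p) (A *v l + p))"
    by (intro sum.cong refl) (simp add: autocorr_def mult_ac)
  finally show ?thesis .
qed

lemma highpass_mult_cnj:
  "highpass c l * cnj (highpass c l)
    = (\<Sum>p\<in>h_box. \<Sum>x\<in>h_box. cnj (h p) * h x *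
        ((if x - p \<in> latt A then 1 else -1) * autocorr c (x - p) (A *v l + (lA - x))))"
proof -
  have "highpass c l * cnj (highpass c l)
    = (\<Sum>p\<in>h_box. \<Sum>x\<in>h_box. cnj (sgn_q (lA - p) * h p * c (A *v l + (lA - p)))
        * (sgn_q (lA - x) * h x * c (A *v l + (lA - x))))"
    unfolding highpass_def cnj_sum by (subst mult.commute) (rule sum_product)
  also have "\<dots> = (\<Sum>p\<in>h_box. \<Sum>x\<in>h_box. cnj (h p) * h x *
        (sgn_q (lA - p) * sgn_q (lA - x) * autocorr c (x - p) (A *v l + (lA - x))))"
    by (intro sum.cong refl) (simp add: autocorr_def algebra_simps)
  finally show ?thesis unfolding sgn_q_mult .
qed

text \<open>The cosets of \<open>p\<close> and \<open>lA - x\<close> are complementary if \<open>x - p \<in> latt A\<close> and coincide otherwise.\<close>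

lemma autocorr_coset_sums:
  assumes c: "(\<lambda>n. (cmod (c n))\<^sup>2) summable_on UNIV"
  shows "((\<lambda>l. autocorr c (x - p) (A *v l + p) +
        (if x - p \<in> latt A then 1 else -1) * autocorr c (x - p) (A *v l + (lA - x)))
      has_sum (if x - p \<in> latt A then infsum (autocorr c (x - p)) UNIV else 0)) UNIV"
proof -
  let ?G = "autocorr c (x - p)"
  have coset: "((\<lambda>l. ?G (A *v l + y)) has_sum infsum ?G {n. even (dotz qA (n - y))}) UNIV" for y
  proof -
    have "inj (\<lambda>l. A *v l + y)" by (auto simp: inj_on_def)
    from has_sum_reindex[OF this, of ?G] show ?thesis
      using has_sum_infsum[OF autocorr_summable[OF c], of "x - p" "range (\<lambda>l. A *v l + y)"]
      by (simp add: range_coset o_def)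
  qed
  show ?thesis
  proof (cases "x - p \<in> latt A")
    case True
    then have compl: "{n. even (dotz qA (n - (lA - x)))} = - {n. even (dotz qA (n - p))}"
      using odd_dotz_lA by (auto simp: latt_iff_even_dotz dotz_diff)
    have "infsum ?G {n. even (dotz qA (n - p))} + infsum ?G {n. even (dotz qA (n - (lA - x)))} = infsum ?G UNIV"
      unfolding compl
      by (subst infsum_Un_disjoint[symmetric]) (auto simp: autocorr_summable[OF c] Compl_partition)
    then show ?thesis
      using has_sum_add[OF coset[of p] coset[of "lA - x"]] True by simp
  next
    case False
    then have "{n. even (dotz qA (n - (lA - x)))} = {n. even (dotz qA (n - p))}"
      using odd_dotz_lA by (auto simp: latt_iff_even_dotz dotz_diff)
    then show ?thesis
      using has_sum_diff[OF coset[of p] coset[of "lA - x"]] False by simp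
  qed
qed

lemma orthonormal_filter_contraction:
  "(\<Sum>p\<in>h_box. \<Sum>x\<in>h_box. cnj (h p) * h x * (if x - p \<in> latt A then T (x - p) else 0)) = T 0"
proof -
  define M where "M = {m\<in>(\<lambda>(x, p). x - p) ` (h_box \<times> h_box). m \<in> latt A}"
  have "finite M" unfolding M_def by simp
  have "(0, 0) \<in> h_box \<times> h_box" by (simp add: h_box_def)
  then have "0 \<in> M" unfolding M_def by (auto simp: latt_zero intro!: image_eqI)
  have "(\<Sum>x\<in>h_box. h x * (if x - p \<in> latt A then T (x - p) else 0)) = (\<Sum>m\<in>M. h (p + m) * T m)"
    if "p \<in> h_box" for p
  proof -
    have "(\<Sum>x\<in>h_box. h x * (if x - p \<in> latt A then T (x - p) else 0))
        = (\<Sum>x\<in>{x\<in>h_box. x - p \<in> latt A}. h x * T (x - p))"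
      by (intro sum.mono_neutral_cong_right) auto
    also have "\<dots> = (\<Sum>m\<in>(\<lambda>x. x - p) ` {x\<in>h_box. x - p \<in> latt A}. h (p + m) * T m)"
      by (subst sum.reindex) (auto simp: inj_on_def)
    also have "\<dots> = (\<Sum>m\<in>M. h (p + m) * T m)"
    proof (rule sum.mono_neutral_left[OF \<open>finite M\<close>])
      show "(\<lambda>x. x - p) ` {x\<in>h_box. x - p \<in> latt A} \<subseteq> M" using that by (auto simp: M_def)
      show "\<forall>m\<in>M - (\<lambda>x. x - p) ` {x\<in>h_box. x - p \<in> latt A}. h (p + m) * T m = 0"
      proof
        fix m assume "m \<in> M - (\<lambda>x. x - p) ` {x\<in>h_box. x - p \<in> latt A}"
        then have "p + m \<notin> h_box" by (auto simp: M_def image_iff algebra_simps)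
        then show "h (p + m) * T m = 0" by (simp add: h_outside)
      qed
    qed
    finally show ?thesis .
  qed
  then have "(\<Sum>p\<in>h_box. \<Sum>x\<in>h_box. cnj (h p) * h x * (if x - p \<in> latt A then T (x - p) else 0))
      = (\<Sum>p\<in>h_box. \<Sum>m\<in>M. cnj (h p) * (h (p + m) * T m))"
    by (simp add: mult.assoc flip: sum_distrib_left)
  also have "\<dots> = (\<Sum>m\<in>M. cnj (\<Sum>p\<in>h_box. h p * cnj (h (p + m))) * T m)"
    by (subst sum.swap) (simp add: sum_distrib_right mult.assoc)
  also have "\<dots> = (\<Sum>m\<in>M. if m = 0 then T m else 0)"
    by (intro sum.cong refl, subst orth_sum) (auto simp: M_def)
  also have "\<dots> = T 0" using \<open>finite M\<close> \<open>0 \<in> M\<close> by simp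
  finally show ?thesis .
qed

theorem filter_bank_energy:
  assumes c: "(\<lambda>n. (cmod (c n))\<^sup>2) summable_on UNIV"
  shows "((\<lambda>l. (cmod (lowpass c l))\<^sup>2 + (cmod (highpass c l))\<^sup>2) has_sum (\<Sum>\<^sub>\<infinity>n. (cmod (c n))\<^sup>2)) UNIV"
proof -
  have "complex_of_real ((cmod (lowpass c l))\<^sup>2 + (cmod (highpass c l))\<^sup>2)
      = (\<Sum>p\<in>h_box. \<Sum>x\<in>h_box. cnj (h p) * h x * (autocorr c (x - p) (A *v l + p) +
        (if x - p \<in> latt A then 1 else -1) * autocorr c (x - p) (A *v l + (lA - x))))" for l
    unfolding of_real_add complex_norm_square lowpass_mult_cnj highpass_mult_cnj
    by (simp only: sum.distrib[symmetric] distrib_left)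
  moreover have "((\<lambda>l. \<Sum>p\<in>h_box. \<Sum>x\<in>h_box. cnj (h p) * h x * (autocorr c (x - p) (A *v l + p) +
        (if x - p \<in> latt A then 1 else -1) * autocorr c (x - p) (A *v l + (lA - x))))
      has_sum infsum (autocorr c 0) UNIV) UNIV"
    unfolding orthonormal_filter_contraction[of "\<lambda>m. infsum (autocorr c m) UNIV", symmetric]
    by (intro has_sum_sum has_sum_cmult_right autocorr_coset_sums c)
  moreover have "autocorr c 0 = (\<lambda>n. complex_of_real ((cmod (c n))\<^sup>2))"
    by (simp add: autocorr_def fun_eq_iff complex_norm_square del: of_real_power)
  then have "infsum (autocorr c 0) UNIV = complex_of_real (\<Sum>\<^sub>\<infinity>n. (cmod (c n))\<^sup>2)"
    by (simp only:) (rule infsumI, rule has_sum_of_real[OF has_sum_infsum[OF c]])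
  ultimately have "((\<lambda>l. complex_of_real ((cmod (lowpass c l))\<^sup>2 + (cmod (highpass c l))\<^sup>2))
      has_sum complex_of_real (\<Sum>\<^sub>\<infinity>n. (cmod (c n))\<^sup>2)) UNIV"
    by (simp only:)
  then show ?thesis by (simp only: has_sum_of_real_iff)
qed

end

subsection \<open>Energy of the approximation coefficients\<close>

locale refinable_function = wavelet_filter A lA h N0 qA
  for A :: "int^'d^'d" and lA h N0 qA +
  fixes \<phi> :: "real^'d \<Rightarrow> complex"
  assumes phi: "fourier_L2 \<phi> (gfun A h N0)"
begin

lemma sq_int_phi: "sq_int \<phi>"
  using phi by (simp add: fourier_L2_def)

definition coef :: "(real^'d \<Rightarrow> complex) \<Rightarrow> int^'d \<Rightarrow> complex" where
  "coef f l = L2_inner f (transl l \<phi>)"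

lemma coef_tendsto:
  assumes "sq_int f"
  shows "(\<lambda>n. L2_inner f (transl l (cascade n))) \<longlonglongrightarrow> coef f l"
  using cascade_weak_limit[OF phi sq_int_transl[OF assms, of "- l"]]
  by (simp add: coef_def L2_inner_transl assms sq_int_cascade sq_int_phi)

lemma coef_diff: "sq_int f \<Longrightarrow> sq_int g \<Longrightarrow> coef (\<lambda>t. f t - g t) l = coef f l - coef g l"
  unfolding coef_def by (intro L2_inner_diff_left sq_int_transl sq_int_phi)

lemma coef_refinement:
  assumes f: "sq_int f"
  shows "coef f l = lowpass (coef (dil_inv A f)) l"
proof (rule LIMSEQ_unique)
  show "(\<lambda>n. L2_inner f (transl l (cascade (Suc n)))) \<longlonglongrightarrow> coef f l"
    by (rule LIMSEQ_Suc[OF coef_tendsto[OF f]])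
  have "L2_inner f (transl l (cascade (Suc n)))
      = (\<Sum>k\<in>h_box. cnj (h k) * L2_inner (dil_inv A f) (transl (A *v l + k) (cascade n)))" for n
    unfolding cascade_Suc transl_refine
    by (subst L2_inner_sum_right)
       (auto intro!: sq_int_cmult sq_int_dil sq_int_transl sq_int_cascade f
             simp: L2_inner_cmult_right L2_inner_dil sq_int_transl sq_int_cascade f)
  then show "(\<lambda>n. L2_inner f (transl l (cascade (Suc n)))) \<longlonglongrightarrow> lowpass (coef (dil_inv A f)) l"
    unfolding lowpass_def by (simp only:) (intro tendsto_intros coef_tendsto sq_int_dil_inv f)
qed

lemma coef_Bessel_finite:
  assumes f: "sq_int f" and F: "finite F"
  shows "(\<Sum>l\<in>F. (cmod (coef f l))\<^sup>2) \<le> (L2_norm f)\<^sup>2"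
proof (rule LIMSEQ_le_const2)
  show "(\<lambda>n. \<Sum>l\<in>F. (cmod (L2_inner f (transl l (cascade n))))\<^sup>2) \<longlonglongrightarrow> (\<Sum>l\<in>F. (cmod (coef f l))\<^sup>2)"
    by (intro tendsto_intros coef_tendsto f)
  show "\<exists>N. \<forall>n\<ge>N. (\<Sum>l\<in>F. (cmod (L2_inner f (transl l (cascade n))))\<^sup>2) \<le> (L2_norm f)\<^sup>2"
    by (intro exI allI impI L2_Bessel_finite f F sq_int_transl sq_int_cascade cascade_orthonormal)
qed

definition energy :: "(real^'d \<Rightarrow> complex) \<Rightarrow> real" where
  "energy f = (\<Sum>\<^sub>\<infinity>l. (cmod (coef f l))\<^sup>2)"

lemma coef_summable:
  assumes "sq_int f" shows "(\<lambda>l. (cmod (coef f l))\<^sup>2) summable_on UNIV"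
  by (rule nonneg_bdd_above_summable_on)
     (auto intro!: bdd_aboveI2[where M="(L2_norm f)\<^sup>2"] coef_Bessel_finite assms)

lemma energy_nonneg: "0 \<le> energy f"
  unfolding energy_def by (intro infsum_nonneg) auto

lemma finite_sum_le_energy:
  assumes "sq_int f" "finite F" shows "(\<Sum>l\<in>F. (cmod (coef f l))\<^sup>2) \<le> energy f"
  unfolding energy_def by (rule finite_sum_le_infsum[OF coef_summable]) (use assms in auto)

lemma energy_leI:
  assumes "sq_int f" "\<And>F. finite F \<Longrightarrow> (\<Sum>l\<in>F. (cmod (coef f l))\<^sup>2) \<le> b"
  shows "energy f \<le> b"
  unfolding energy_def by (rule infsum_le_finite_sums[OF coef_summable]) (use assms in auto)

lemma sqrt_energy_triangle:
  assumes f: "sq_int f" and g: "sq_int g"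
  shows "sqrt (energy f) \<le> sqrt (energy g) + L2_norm (\<lambda>t. f t - g t)"
proof (rule real_le_lsqrt)
  show "energy f \<le> (sqrt (energy g) + L2_norm (\<lambda>t. f t - g t))\<^sup>2"
  proof (rule energy_leI[OF f])
    fix F :: "(int^'d) set" assume F: "finite F"
    have "L2_set (\<lambda>l. cmod (coef f l)) F \<le> L2_set (\<lambda>l. cmod (coef g l) + cmod (coef (\<lambda>t. f t - g t) l)) F"
    proof (rule L2_set_mono)
      fix l
      show "cmod (coef f l) \<le> cmod (coef g l) + cmod (coef (\<lambda>t. f t - g t) l)"
        using norm_triangle_sub[of "coef f l" "coef g l"] by (simp add: coef_diff f g)
    qed simp
    also have "\<dots> \<le> L2_set (\<lambda>l. cmod (coef g l)) F + L2_set (\<lambda>l. cmod (coef (\<lambda>t. f t - g t) l)) F"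
      by (rule L2_set_triangle_ineq)
    also have "\<dots> \<le> sqrt (energy g) + sqrt ((L2_norm (\<lambda>t. f t - g t))\<^sup>2)"
      unfolding L2_set_def
      by (intro add_mono real_sqrt_le_mono finite_sum_le_energy coef_Bessel_finite g F sq_int_diff f)
    finally have "L2_set (\<lambda>l. cmod (coef f l)) F \<le> sqrt (energy g) + L2_norm (\<lambda>t. f t - g t)" by simp
    then have "(L2_set (\<lambda>l. cmod (coef f l)) F)\<^sup>2 \<le> (sqrt (energy g) + L2_norm (\<lambda>t. f t - g t))\<^sup>2"
      by (rule power_mono) simp
    then show "(\<Sum>l\<in>F. (cmod (coef f l))\<^sup>2) \<le> (sqrt (energy g) + L2_norm (\<lambda>t. f t - g t))\<^sup>2"
      by (simp add: L2_set_def sum_nonneg)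
  qed
qed (simp add: energy_nonneg)

definition wavelet :: "real^'d \<Rightarrow> complex" where
  "wavelet t = (\<Sum>\<^sub>\<infinity>k. (-1) powi (dotz qA k) * cnj (h (lA - k)) * dil A (transl k \<phi>) t)"

lemma wavelet_eq_sum: "wavelet t = (\<Sum>n\<in>h_box. sgn_q (lA - n) * cnj (h n) * dil A (transl (lA - n) \<phi>) t)"
proof -
  let ?w = "\<lambda>k. sgn_q k * cnj (h (lA - k)) * dil A (transl k \<phi>) t"
  have inj: "inj_on (\<lambda>n. lA - n) h_box" by (auto simp: inj_on_def)
  have "wavelet t = infsum ?w ((\<lambda>n. lA - n) ` h_box)"
    unfolding wavelet_def sgn_q_def
  proof (rule infsum_cong_neutral)
    fix k assume "k \<in> UNIV - (\<lambda>n. lA - n) ` h_box"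
    then have "lA - k \<notin> h_box" by (auto simp: image_iff algebra_simps)
    then show "(- 1) powi dotz qA k * cnj (h (lA - k)) * dil A (transl k \<phi>) t = 0" by (simp add: h_outside)
  qed auto
  also have "\<dots> = (\<Sum>n\<in>h_box. ?w (lA - n))" by (simp add: sum.reindex[OF inj])
  finally show ?thesis by simp
qed

lemma sq_int_wavelet: "sq_int wavelet"
  unfolding wavelet_eq_sum[abs_def] by (intro sq_int_sum sq_int_cmult sq_int_dil sq_int_transl sq_int_phi)

lemma L2_inner_transl_wavelet:
  assumes f: "sq_int f"
  shows "L2_inner f (transl l wavelet) = highpass (coef (dil_inv A f)) l"
proof -
  have "transl l wavelet t = (\<Sum>n\<in>h_box. sgn_q (lA - n) * cnj (h n) * transl l (dil A (transl (lA - n) \<phi>)) t)" for t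
    by (simp add: transl_def wavelet_eq_sum)
  then have "transl l wavelet = (\<lambda>t. \<Sum>n\<in>h_box. sgn_q (lA - n) * cnj (h n) * dil A (transl (A *v l + (lA - n)) \<phi>) t)"
    by (simp add: transl_dil transl_transl fun_eq_iff)
  then show ?thesis
    unfolding highpass_def coef_def
    by (simp only:, subst L2_inner_sum_right)
       (auto intro!: sq_int_cmult sq_int_dil sq_int_transl sq_int_phi f
             simp: L2_inner_cmult_right L2_inner_dil sq_int_transl sq_int_phi f)
qed

lemma wavelet_energy_step:
  assumes f: "sq_int f"
  shows "((\<lambda>l. (cmod (L2_inner f (transl l wavelet)))\<^sup>2) has_sum (energy (dil_inv A f) - energy f)) UNIV"
proof -
  have "((\<lambda>l. (cmod (coef f l))\<^sup>2 + (cmod (L2_inner f (transl l wavelet)))\<^sup>2) has_sum energy (dil_inv A f)) UNIV"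
    unfolding coef_refinement[OF f] L2_inner_transl_wavelet[OF f] energy_def
    by (rule filter_bank_energy[OF coef_summable[OF sq_int_dil_inv[OF f]]])
  moreover have "((\<lambda>l. (cmod (coef f l))\<^sup>2) has_sum energy f) UNIV"
    unfolding energy_def by (rule has_sum_infsum[OF coef_summable[OF f]])
  ultimately have "((\<lambda>l. ((cmod (coef f l))\<^sup>2 + (cmod (L2_inner f (transl l wavelet)))\<^sup>2) - (cmod (coef f l))\<^sup>2)
      has_sum (energy (dil_inv A f) - energy f)) UNIV"
    by (rule has_sum_diff)
  then show ?thesis by simp
qed

end

subsection \<open>Limits of the energies\<close>

lemma nn_integral_count_space_eq_infsum:
  assumes "f summable_on A" "\<And>x. x \<in> A \<Longrightarrow> 0 \<le> (f x :: real)"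
  shows "(\<integral>\<^sup>+x. ennreal (f x) \<partial>count_space A) = ennreal (infsum f A)"
proof -
  have "(\<lambda>x. norm (f x)) summable_on A \<longleftrightarrow> f summable_on A"
    using assms(2) by (intro summable_on_cong) simp
  then have "Infinite_Set_Sum.abs_summable_on f A" using assms(1) abs_summable_equivalent by blast
  then show ?thesis
    by (simp add: nn_integral_conv_infsetsum infsetsum_infsum assms(2))
qed

context refinable_function
begin

lemma coef_eq_0:
  assumes f: "sq_int f" and supp: "\<And>t. r < norm t \<Longrightarrow> f t = 0"
    and l: "cascade_radius + r < norm (rvec l)"
  shows "coef f l = 0"
proof -
  have "f t * cnj (transl l (cascade n) t) = 0" for n t
  proof (cases "norm t \<le> r")
    case True
    then have "cascade_radius < norm (t - rvec l)"
      using l norm_triangle_ineq2[of "rvec l" t] by (simp add: norm_minus_commute)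
    then show ?thesis by (simp add: transl_def cascade_eq_0)
  qed (simp add: supp)
  then have "L2_inner f (transl l (cascade n)) = 0" for n
    unfolding L2_inner_def by (simp only:) simp
  then show ?thesis
    using coef_tendsto[OF f, of l] by (simp add: LIMSEQ_const_iff)
qed

lemma energy_tendsto_0_bounded_support:
  assumes e: "bounded_support M e"
  shows "(\<lambda>j. energy (dil_pow A (int j) e)) \<longlonglongrightarrow> 0"
proof -
  obtain \<delta> where \<delta>: "\<delta> \<longlonglongrightarrow> 0" "\<And>j t. \<delta> j < norm t \<Longrightarrow> dil_pow A (int j) e t = 0"
    using dil_pow_bounded_support[OF e] by blast
  define S where "S = {l::int^'d. norm (rvec l) \<le> cascade_radius + 1}"
  have "(\<lambda>j. \<Sum>l\<in>S. (cmod (coef (dil_pow A (int j) e) l))\<^sup>2) \<longlonglongrightarrow> (\<Sum>l\<in>S. (cmod 0)\<^sup>2)"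
    unfolding coef_def
    by (intro tendsto_intros dil_pow_weakly_null[OF e] sq_int_transl sq_int_phi)
  then have lim: "(\<lambda>j. \<Sum>l\<in>S. (cmod (coef (dil_pow A (int j) e) l))\<^sup>2) \<longlonglongrightarrow> 0" by simp
  have "\<forall>\<^sub>F j in sequentially. \<delta> j < 1" by (rule order_tendstoD(2)[OF \<delta>(1)]) simp
  then have "\<forall>\<^sub>F j in sequentially. (\<Sum>l\<in>S. (cmod (coef (dil_pow A (int j) e) l))\<^sup>2) = energy (dil_pow A (int j) e)"
  proof eventually_elim
    case (elim j)
    have "coef (dil_pow A (int j) e) l = 0" if "l \<notin> S" for l
      using that elim by (intro coef_eq_0[where r=1])
         (auto simp: S_def intro!: \<delta>(2) sq_int_dil_pow sq_int_bounded_support[OF e])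
    then have "energy (dil_pow A (int j) e) = infsum (\<lambda>l. (cmod (coef (dil_pow A (int j) e) l))\<^sup>2) S"
      unfolding energy_def by (intro infsum_cong_neutral) auto
    then show ?case by (simp add: S_def finite_rvec_norm_le)
  qed
  then show ?thesis by (rule Lim_transform_eventually[OF lim])
qed

lemma energy_tendsto_0:
  assumes f: "sq_int f"
  shows "(\<lambda>j. energy (dil_pow A (int j) f)) \<longlonglongrightarrow> 0"
proof -
  have "(\<lambda>j. sqrt (energy (dil_pow A (int j) f))) \<longlonglongrightarrow> 0"
  proof (rule LIMSEQ_I)
    fix \<epsilon> :: real assume "0 < \<epsilon>"
    obtain M e where e: "bounded_support M e" and f_e: "L2_norm (\<lambda>x. f x - e x) < \<epsilon>/2"
      using L2_dense_bounded_support[OF f half_gt_zero[OF \<open>0 < \<epsilon>\<close>]] by blast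
    note e_sq = sq_int_bounded_support[OF e]
    have "(\<lambda>j. sqrt (energy (dil_pow A (int j) e))) \<longlonglongrightarrow> sqrt 0"
      by (intro tendsto_real_sqrt energy_tendsto_0_bounded_support[OF e])
    then obtain j0 where j0: "\<And>j. j0 \<le> j \<Longrightarrow> sqrt (energy (dil_pow A (int j) e)) < \<epsilon>/2"
      using order_tendstoD(2)[of _ "sqrt 0" sequentially "\<epsilon>/2"] \<open>0 < \<epsilon>\<close> by (auto simp: eventually_sequentially)
    have "norm (sqrt (energy (dil_pow A (int j) f)) - 0) < \<epsilon>" if "j0 \<le> j" for j
    proof -
      have "sqrt (energy (dil_pow A (int j) f))
          \<le> sqrt (energy (dil_pow A (int j) e)) + L2_norm (\<lambda>t. dil_pow A (int j) f t - dil_pow A (int j) e t)"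
        by (intro sqrt_energy_triangle sq_int_dil_pow f e_sq)
      also have "L2_norm (\<lambda>t. dil_pow A (int j) f t - dil_pow A (int j) e t) = L2_norm (\<lambda>t. f t - e t)"
        unfolding dil_pow_diff[symmetric] by (intro L2_norm_dil_pow sq_int_diff e_sq f)
      finally show ?thesis using f_e j0[OF that] by (simp add: energy_nonneg)
    qed
    then show "\<exists>j0. \<forall>j\<ge>j0. norm (sqrt (energy (dil_pow A (int j) f)) - 0) < \<epsilon>" by blast
  qed
  then have "(\<lambda>j. (sqrt (energy (dil_pow A (int j) f)))\<^sup>2) \<longlonglongrightarrow> 0\<^sup>2" by (rule tendsto_power)
  then show ?thesis by (simp add: energy_nonneg)
qed

definition coef_step :: "(real^'d \<Rightarrow> complex) \<Rightarrow> real^'d \<Rightarrow> complex" where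
  "coef_step f x = coef f (vfloor x)"

lemma borel_measurable_coef_step [measurable]: "coef_step f \<in> borel_measurable borel"
  unfolding coef_step_def by measurable

lemma
  assumes f: "sq_int f"
  shows sq_int_coef_step: "sq_int (coef_step f)" and L2_norm_coef_step: "(L2_norm (coef_step f))\<^sup>2 = energy f"
proof -
  have "(\<integral>\<^sup>+x. ennreal ((cmod (coef_step f x))\<^sup>2) \<partial>lborel)
      = (\<integral>\<^sup>+x. (\<integral>\<^sup>+n. ennreal ((cmod (coef_step f (x + rvec n)))\<^sup>2) \<partial>count_space UNIV) * indicator ucube x \<partial>lborel)"
    by (rule nn_integral_periodize) measurable
  also have "\<dots> = (\<integral>\<^sup>+x. ennreal (energy f) * indicator (ucube :: (real^'d) set) x \<partial>lborel)"
  proof (rule nn_integral_cong)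
    fix x
    show "(\<integral>\<^sup>+n. ennreal ((cmod (coef_step f (x + rvec n)))\<^sup>2) \<partial>count_space UNIV) * indicator ucube x
        = ennreal (energy f) * indicator ucube x"
      using nn_integral_count_space_eq_infsum[OF coef_summable[OF f]]
      by (cases "x \<in> ucube") (simp_all add: coef_step_def vfloor_add_rvec energy_def)
  qed
  also have "\<dots> = ennreal (energy f)" by (simp add: nn_integral_cmult_indicator)
  finally have coef_step_sq: "(\<integral>\<^sup>+x. ennreal ((cmod (coef_step f x))\<^sup>2) \<partial>lborel) = ennreal (energy f)" .
  then show "sq_int (coef_step f)"
    by (intro nn_integral_norm_sq_le_imp(1)[OF _ _ energy_nonneg]) auto
  from nn_integral_norm_sq[OF this] show "(L2_norm (coef_step f))\<^sup>2 = energy f"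
    using coef_step_sq energy_nonneg by simp
qed

text \<open>\<open>cascade n\<close> has integral 1, so \<open>f x - \<langle>f, T\<^sub>l (cascade n)\<rangle>\<close> is the pairing of \<open>f x - f (t + l)\<close> with
  \<open>cascade n\<close>.\<close>

lemma coef_dist_le:
  assumes f: "sq_int f"
  shows "ennreal ((cmod (f x - coef f l))\<^sup>2)
    \<le> (\<integral>\<^sup>+t. ennreal ((cmod (f (t + rvec l) - f x))\<^sup>2) * indicator (cball 0 cascade_radius) t \<partial>lborel)"
proof -
  define G where "G t = (f x - f (t + rvec l)) * indicator (cball 0 cascade_radius) t" for t
  have G: "sq_int G"
    unfolding G_def left_diff_distrib
    by (intro sq_int_diff sq_int_cmult sq_int_indicator_cball sq_int_mult_indicator sq_int_shift f) simp
  have inner: "f x - L2_inner f (transl l (cascade n)) = L2_inner G (cascade n)" for n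
  proof -
    have G_cascade: "G t * cnj (cascade n t) = f x * cnj (cascade n t) - transl (- l) f t * cnj (cascade n t)" for t
      using cascade_eq_0[of t n] by (cases "norm t \<le> cascade_radius")
         (simp_all add: G_def transl_def rvec_uminus left_diff_distrib)
    have "f x = (LINT t|lborel. f x * cnj (cascade n t))"
      using integral_cascade[of n] by simp
    moreover have "integrable lborel (\<lambda>t. f x * cnj (cascade n t))"
      using integrable_cnj[OF integrable_cascade[of n]] by simp
    ultimately show ?thesis
      using integrable_L2_inner[OF sq_int_transl[OF f] sq_int_cascade, of "- l" n]
      by (simp add: L2_inner_transl f sq_int_cascade) (simp add: L2_inner_def G_cascade)
  qed
  have "cmod (f x - coef f l) \<le> L2_norm G"
  proof (rule LIMSEQ_le_const2)
    show "(\<lambda>n. cmod (f x - L2_inner f (transl l (cascade n)))) \<longlonglongrightarrow> cmod (f x - coef f l)"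
      by (intro tendsto_intros coef_tendsto f)
    show "\<exists>N. \<forall>n\<ge>N. cmod (f x - L2_inner f (transl l (cascade n))) \<le> L2_norm G"
      using L2_Cauchy_Schwarz[OF G sq_int_cascade] by (simp add: inner L2_norm_cascade)
  qed
  then have "ennreal ((cmod (f x - coef f l))\<^sup>2) \<le> ennreal ((L2_norm G)\<^sup>2)"
    by (intro ennreal_leI power_mono) simp_all
  also have "\<dots> = (\<integral>\<^sup>+t. ennreal ((cmod (G t))\<^sup>2) \<partial>lborel)"
    by (rule nn_integral_norm_sq[OF G, symmetric])
  also have "\<dots> = (\<integral>\<^sup>+t. ennreal ((cmod (f (t + rvec l) - f x))\<^sup>2) * indicator (cball 0 cascade_radius) t \<partial>lborel)"
    by (intro nn_integral_cong) (simp add: G_def indicator_def norm_minus_commute)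
  finally show ?thesis .
qed

lemma coef_step_dist_le:
  assumes f: "sq_int f"
  shows "(L2_norm (\<lambda>x. f x - coef_step f x))\<^sup>2
    \<le> (LINT u|lborel. indicator (cball 0 (cascade_radius + real CARD('d))) u * (L2_modulus f u)\<^sup>2)"
proof -
  let ?B = "cball (0 :: real^'d) (cascade_radius + real CARD('d))"
  note [measurable] = sq_int_measurable[OF f]
  have [measurable]: "cball (0 :: real^'d) r \<in> sets borel" for r by simp
  have "(\<integral>\<^sup>+x. ennreal ((cmod (f x - coef_step f x))\<^sup>2) \<partial>lborel)
      \<le> (\<integral>\<^sup>+x. (\<integral>\<^sup>+u. ennreal ((cmod (f (x + u) - f x))\<^sup>2) * indicator ?B u \<partial>lborel) \<partial>lborel)"
  proof (rule nn_integral_mono)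
    fix x :: "real^'d"
    let ?l = "rvec (vfloor x)"
    have "ennreal ((cmod (f x - coef_step f x))\<^sup>2)
        \<le> (\<integral>\<^sup>+t. ennreal ((cmod (f (t + ?l) - f x))\<^sup>2) * indicator (cball 0 cascade_radius) t \<partial>lborel)"
      unfolding coef_step_def by (rule coef_dist_le[OF f])
    also have "\<dots> = (\<integral>\<^sup>+u. ennreal ((cmod (f (u + (x - ?l) + ?l) - f x))\<^sup>2)
        * indicator (cball 0 cascade_radius) (u + (x - ?l)) \<partial>lborel)"
      by (rule nn_integral_lborel_translate[symmetric]) measurable
    also have "\<dots> \<le> (\<integral>\<^sup>+u. ennreal ((cmod (f (x + u) - f x))\<^sup>2) * indicator ?B u \<partial>lborel)"
    proof (intro nn_integral_mono mult_mono)
      fix u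
      have "norm (x - ?l) \<le> real CARD('d)"
        by (intro norm_ucube_le) (simp add: diff_rvec_in_ucube_iff)
      then show "(indicator (cball 0 cascade_radius) (u + (x - ?l)) :: ennreal) \<le> indicator ?B u"
        using norm_triangle_ineq4[of "u + (x - ?l)" "x - ?l"] by (auto simp: indicator_def)
    qed (simp_all add: add.commute)
    finally show "ennreal ((cmod (f x - coef_step f x))\<^sup>2)
        \<le> (\<integral>\<^sup>+u. ennreal ((cmod (f (x + u) - f x))\<^sup>2) * indicator ?B u \<partial>lborel)" .
  qed
  also have "\<dots> = (\<integral>\<^sup>+u. ennreal ((L2_modulus f u)\<^sup>2) * indicator ?B u \<partial>lborel)"
    by (rule nn_integral_weighted_L2_modulus[OF f]) measurable
  also have "\<dots> = (\<integral>\<^sup>+u. ennreal (indicator ?B u * (L2_modulus f u)\<^sup>2) \<partial>lborel)"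
    by (simp add: ennreal_mult ennreal_indicator mult.commute)
  also have "\<dots> = ennreal (LINT u|lborel. indicator ?B u * (L2_modulus f u)\<^sup>2)"
    by (intro nn_integral_eq_integral integrable_L2_modulus_average f integrable_indicator_cball) auto
  finally show ?thesis
    by (rule nn_integral_norm_sq_le_imp(2)[rotated]) (auto intro!: Bochner_Integration.integral_nonneg)
qed

lemma energy_tendsto_norm:
  assumes f: "sq_int f"
  shows "(\<lambda>j. energy (dil_pow A (- int j) f)) \<longlonglongrightarrow> (L2_norm f)\<^sup>2"
proof -
  define F where "F j = dil_pow A (- int j) f" for j
  have F: "sq_int (F j)" "L2_norm (F j) = L2_norm f" for j
    unfolding F_def by (rule sq_int_dil_pow[OF f], rule L2_norm_dil_pow[OF f])
  let ?B = "cball (0 :: real^'d) (cascade_radius + real CARD('d))"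
  have "(\<lambda>j. LINT u|lborel. indicator ?B u * (L2_modulus f (mat_iter Rinv j u))\<^sup>2) \<longlonglongrightarrow> 0"
    by (intro L2_modulus_average_tendsto_0 f integrable_indicator_cball geometric_decay_tendsto_0 geometric_decay_Rinv)
       measurable
  then have "(\<lambda>j. (L2_norm (\<lambda>x. F j x - coef_step (F j) x))\<^sup>2) \<longlonglongrightarrow> 0"
    by (rule Lim_null_comparison[rotated])
       (use coef_step_dist_le[OF F(1)] in \<open>simp add: F_def L2_modulus_dil_pow[OF f]\<close>)
  then have "(\<lambda>j. sqrt ((L2_norm (\<lambda>x. F j x - coef_step (F j) x))\<^sup>2)) \<longlonglongrightarrow> sqrt 0"
    by (rule tendsto_real_sqrt)
  then have lim: "(\<lambda>j. L2_norm (\<lambda>x. F j x - coef_step (F j) x)) \<longlonglongrightarrow> 0" by simp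
  have close: "\<bar>L2_norm (coef_step (F j)) - L2_norm f\<bar> \<le> L2_norm (\<lambda>x. F j x - coef_step (F j) x)" for j
    using L2_norm_le_add_diff[OF F(1)[of j] sq_int_coef_step[OF F(1)[of j]]]
      L2_norm_le_add_diff[OF sq_int_coef_step[OF F(1)[of j]] F(1)[of j]]
    unfolding F(2) L2_norm_minus_commute[of "coef_step (F j)"] by linarith
  have "(\<lambda>j. L2_norm (coef_step (F j)) - L2_norm f) \<longlonglongrightarrow> 0"
    by (rule Lim_null_comparison[OF _ lim]) (simp add: close)
  then have "(\<lambda>j. L2_norm (coef_step (F j))) \<longlonglongrightarrow> L2_norm f" by (rule LIM_zero_cancel)
  then have "(\<lambda>j. (L2_norm (coef_step (F j)))\<^sup>2) \<longlonglongrightarrow> (L2_norm f)\<^sup>2" by (rule tendsto_power)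
  then show ?thesis by (simp add: L2_norm_coef_step F(1) flip: F_def)
qed

end

subsection \<open>The Parseval identity\<close>

lemma has_sum_int_symmetric:
  fixes M :: "int \<Rightarrow> real"
  assumes nonneg: "\<And>n. 0 \<le> M n" and lim: "(\<lambda>j. \<Sum>n\<in>{- int j..<int j}. M n) \<longlonglongrightarrow> S"
  shows "(M has_sum S) UNIV"
proof -
  have "incseq (\<lambda>j. \<Sum>n\<in>{- int j..<int j}. M n)"
    by (intro incseq_SucI sum_mono2) (auto simp: nonneg)
  then have partial: "(\<Sum>n\<in>{- int j..<int j}. M n) \<le> S" for j
    using incseq_le lim by blast
  have finite: "sum M F \<le> S" if F: "finite F" for F
  proof -
    obtain j :: nat where "\<And>n. n \<in> F \<Longrightarrow> \<bar>n\<bar> < int j"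
    proof
      fix n assume "n \<in> F"
      then have "\<bar>n\<bar> \<le> Max (insert 0 (abs ` F))" using F by (intro Max_ge) auto
      then show "\<bar>n\<bar> < int (nat (Max (insert 0 (abs ` F))) + 1)" by linarith
    qed
    then have "F \<subseteq> {- int j..<int j}" by force
    then have "sum M F \<le> (\<Sum>n\<in>{- int j..<int j}. M n)" by (intro sum_mono2) (auto simp: nonneg)
    then show ?thesis using partial order_trans by blast
  qed
  have summable: "M summable_on UNIV"
    by (rule nonneg_bdd_above_summable_on) (auto simp: nonneg intro!: bdd_aboveI2[where M=S] finite)
  have "infsum M UNIV \<le> S" by (rule infsum_le_finite_sums[OF summable]) (use finite in auto)
  moreover have "S \<le> infsum M UNIV"
    by (rule LIMSEQ_le_const2[OF lim]) (auto intro!: exI[of _ 0] finite_sum_le_infsum[OF summable] simp: nonneg)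
  ultimately show ?thesis using has_sum_infsum[OF summable] by simp
qed

lemma has_sum_int_telescope:
  fixes E :: "int \<Rightarrow> real"
  assumes "\<And>n. E n \<le> E (n + 1)" "(\<lambda>j. E (int j)) \<longlonglongrightarrow> a" "(\<lambda>j. E (- int j)) \<longlonglongrightarrow> b"
  shows "((\<lambda>n. E (n + 1) - E n) has_sum (a - b)) UNIV"
proof (rule has_sum_int_symmetric)
  have "(\<Sum>n\<in>{- int j..<int j}. E (n + 1) - E n) = E (int j) - E (- int j)" for j
  proof (induction j)
    case (Suc j)
    have "{- int (Suc j)..<int (Suc j)} = insert (- int (Suc j)) (insert (int j) {- int j..<int j})"
      by auto
    then show ?case using Suc by (simp add: add.commute)
  qed simp
  then show "(\<lambda>j. \<Sum>n\<in>{- int j..<int j}. E (n + 1) - E n) \<longlonglongrightarrow> a - b"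
    using tendsto_diff[OF assms(2,3)] by simp
qed (use assms(1) in simp)

theorem (in refinable_function) wavelet_Parseval:
  assumes f: "sq_int f"
  shows "((\<lambda>(n, l). (cmod (L2_inner f (dil_pow A n (transl l wavelet))))\<^sup>2) has_sum (L2_norm f)\<^sup>2)
    (UNIV :: (int \<times> (int^'d)) set)"
proof -
  define E where "E n = energy (dil_pow A (- n) f)" for n
  let ?c = "\<lambda>n l. (cmod (L2_inner f (dil_pow A n (transl l wavelet))))\<^sup>2"
  have level: "((\<lambda>l. ?c n l) has_sum (E (n + 1) - E n)) UNIV" for n
    using wavelet_energy_step[OF sq_int_dil_pow[OF f], of "- n"]
    by (simp add: E_def dil_inv_dil_pow L2_inner_dil_pow f sq_int_transl sq_int_wavelet)
  have "((\<lambda>n. E (n + 1) - E n) has_sum ((L2_norm f)\<^sup>2 - 0)) UNIV"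
  proof (rule has_sum_int_telescope)
    show "E n \<le> E (n + 1)" for n using has_sum_nonneg[OF level, of n] by simp
  qed (use energy_tendsto_norm[OF f] energy_tendsto_0[OF f] in \<open>simp_all add: E_def\<close>)
  then have levels: "((\<lambda>n. E (n + 1) - E n) has_sum (L2_norm f)\<^sup>2) UNIV" by simp
  have "((\<lambda>(n, l). ?c n l) has_sum (L2_norm f)\<^sup>2) (UNIV \<times> UNIV)"
  proof (rule has_sum_SigmaI)
    show "((\<lambda>l. (case (n, l) of (n, l) \<Rightarrow> ?c n l)) has_sum (E (n + 1) - E n)) UNIV" for n
      using level by simp
    show "((\<lambda>n. E (n + 1) - E n) has_sum (L2_norm f)\<^sup>2) UNIV" by (rule levels)
    show "(\<lambda>(n, l). ?c n l) summable_on UNIV \<times> UNIV"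
      by (rule summable_on_SigmaI[where g="\<lambda>n. E (n + 1) - E n"])
         (use level levels in \<open>auto intro: has_sum_imp_summable\<close>)
  qed
  then show ?thesis by simp
qed

theorem theorem9p4:
  fixes A :: "int^'d^'d" and lA qA :: "int^'d" and h :: "int^'d \<Rightarrow> complex"
    and N0 :: nat and \<phi> :: "real^'d \<Rightarrow> complex"
  assumes expA: "expansive A"
    and detA: "\<bar>det A\<bar> = 2"
    and lat: "latt A = latt (transpose A)"
    and part: "UNIV = ((\<lambda>k. lA + k) ` latt A) \<union> latt A"
    and disj: "((\<lambda>k. lA + k) ` latt A) \<inter> latt A = {}"
    and qeven: "\<forall>k\<in>latt A. even (dotz qA k)"
    and qodd: "\<forall>k\<in>latt A. odd (dotz qA (lA + k))"
    and cond1: "\<forall>m\<in>latt A. \<forall>n. UNIV = ((\<lambda>k. n - k) ` latt A) \<union> ((\<lambda>k. lA - m - n + k) ` latt A)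
                 \<and> ((\<lambda>k. n - k) ` latt A) \<inter> ((\<lambda>k. lA - m - n + k) ` latt A) = {}"
    and cond2: "\<forall>m\<in>(\<lambda>k. lA + k) ` latt A. \<forall>n. (\<lambda>k. n - k) ` latt A = (\<lambda>k. lA - m - n + k) ` latt A"
    and orth: "\<forall>k\<in>latt A. (\<Sum>\<^sub>\<infinity>n. h n * cnj (h (n + k))) = (if k = 0 then 1 else 0)"
    and hsum: "(\<Sum>\<^sub>\<infinity>n. h n) = complex_of_real (sqrt 2)"
    and hsupp: "\<forall>n. n \<notin> {n::int^'d. \<forall>j. \<bar>n$j\<bar> \<le> int N0} \<longrightarrow> h n = 0"
    and phi: "fourier_L2 \<phi> (gfun A h N0)"
  shows "\<forall>f. sq_int f \<longrightarrow>
     ((\<lambda>(n, l). (cmod (L2_inner f (dil_pow A n (transl l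
         (\<lambda>t. \<Sum>\<^sub>\<infinity>k. (-1) powi (dotz qA k) * cnj (h (lA - k)) * dil A (transl k \<phi>) t)))))\<^sup>2)
      has_sum (L2_norm f)\<^sup>2) (UNIV :: (int \<times> (int^'d)) set)"
proof -
  interpret refinable_function A lA h N0 qA \<phi>
    by unfold_locales (fact expA part disj orth hsum hsupp qeven qodd phi)+
  show ?thesis
    using wavelet_Parseval unfolding wavelet_def[abs_def] by blast
qed

end
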